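(* Let $\lambda^{(1)},\lambda^{(2)},\ldots$ be a sequence of partitions, and let $\mathcal{X}_{\lambda^{(N)}}[\mathrm{maj}]$ be the random variable given by the major index statistic on $\mathrm{SYT}(\lambda^{(N)})$ under the uniform distribution. Then the sequence $(\mathcal{X}_{\lambda^{(N)}}^*[\mathrm{maj}])_{N\ge1}$ of normalized random variables converges in distribution if and only if at least one of the following holds: (i) $\mathrm{aft}(\lambda^{(N)})\to\infty$ as $N\to\infty$; or (ii) $|\lambda^{(N)}|\to\infty$ and $\mathrm{aft}(\lambda^{(N)})\to M<\infty$ as $N\to\infty$; or (iii) the distribution of $\mathcal{X}_{\lambda^{(N)}}^*[\mathrm{maj}]$ is eventually constant (in $N$). The limit law is the standard normal distribution $\mathcal{N}$ in case (i), the normalized Irwin--Hall distribution $\mathcal{IH}_M^*$ in case (ii), and discrete in case (iii).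
   Context: $\mathrm{SYT}(\lambda)$ is the set of standard Young tableaux of shape $\lambda\vdash n$ (English notation): bijective fillings of the diagram with $1,\dots,n$ increasing along rows and down columns. An integer $i$ is a descent of $T$ if $i+1$ appears in a strictly lower row of $T$ than $i$; $\mathrm{maj}(T)$ is the sum of the descents of $T$. The aft of a partition $\lambda$ is $\mathrm{aft}(\lambda):=|\lambda|-\max\{\lambda_1,\lambda_1'\}$, where $\lambda'$ is the conjugate partition and $|\lambda|$ the number of cells. For a real-valued random variable $\mathcal{X}$ with mean $\mu$ and standard deviation $\sigma$, $\mathcal{X}^*:=(\mathcal{X}-\mu)/\sigma$; if $\sigma=0$, set $\mathcal{X}^*:=0$. For an integer $M\ge0$, $\mathcal{IH}_M:=\sum_{k=1}^M\mathcal{U}[0,1]$ is the (Irwin--Hall) distribution of the sum of $M$ independent random variables each uniformly distributed on $[0,1]$ (for $M=0$ it is the constant $0$). *)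

theory Defs
  imports "HOL-Probability.Probability"
begin

definition is_partition :: "nat list \<Rightarrow> bool" where
  "is_partition l \<longleftrightarrow> sorted_wrt (\<ge>) l \<and> (\<forall>p \<in> set l. p > 0)"

definition first_part :: "nat list \<Rightarrow> nat" where
  "first_part l = (case l of [] \<Rightarrow> 0 | p # _ \<Rightarrow> p)"

definition conjugate :: "nat list \<Rightarrow> nat list" where
  "conjugate l = map (\<lambda>j. length (filter (\<lambda>p. j < p) l)) [0..<first_part l]"

text \<open>The natural-number subtraction does not truncate for a partition \<open>l\<close>, since both
  maximum candidates count cells of the diagram.\<close>
definition aft :: "nat list \<Rightarrow> nat" where
  "aft l = sum_list l - max (first_part l) (first_part (conjugate l))"

text \<open>Cells are pairs (row, column), counted from 0, with row 0 at the top (English notation).\<close>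
definition diagram :: "nat list \<Rightarrow> (nat \<times> nat) set" where
  "diagram l = {(r, c). r < length l \<and> c < l ! r}"

text \<open>Fillings are total functions made \<open>extensional\<close>, so that each tableau is represented by
  exactly one function. The empty partition has one (empty) tableau.\<close>
definition SYT :: "nat list \<Rightarrow> (nat \<times> nat \<Rightarrow> nat) set" where
  "SYT l = {T \<in> extensional (diagram l).
     bij_betw T (diagram l) {1..sum_list l} \<and>
     (\<forall>r c c'. (r, c) \<in> diagram l \<and> (r, c') \<in> diagram l \<and> c < c' \<longrightarrow> T (r, c) < T (r, c')) \<and>
     (\<forall>r r' c. (r, c) \<in> diagram l \<and> (r', c) \<in> diagram l \<and> r < r' \<longrightarrow> T (r, c) < T (r', c))}"

definition descents :: "nat list \<Rightarrow> (nat \<times> nat \<Rightarrow> nat) \<Rightarrow> nat set" where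
  "descents l T = {i. \<exists>r c r' c'. (r, c) \<in> diagram l \<and> (r', c') \<in> diagram l \<and>
     T (r, c) = i \<and> T (r', c') = i + 1 \<and> r < r'}"

definition maj :: "nat list \<Rightarrow> (nat \<times> nat \<Rightarrow> nat) \<Rightarrow> nat" where
  "maj l T = \<Sum>(descents l T)"

definition std_dev :: "'a measure \<Rightarrow> ('a \<Rightarrow> real) \<Rightarrow> real" where
  "std_dev M X = sqrt (\<integral>x. (X x - (\<integral>y. X y \<partial>M))\<^sup>2 \<partial>M)"

definition normalized :: "'a measure \<Rightarrow> ('a \<Rightarrow> real) \<Rightarrow> 'a \<Rightarrow> real" where
  "normalized M X = (\<lambda>x. if std_dev M X = 0 then 0
     else (X x - (\<integral>y. X y \<partial>M)) / std_dev M X)"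

definition normalized_law :: "'a measure \<Rightarrow> ('a \<Rightarrow> real) \<Rightarrow> real measure" where
  "normalized_law M X = distr M borel (normalized M X)"

definition normalized_maj_law :: "nat list \<Rightarrow> real measure" where
  "normalized_maj_law l =
     normalized_law (measure_pmf (pmf_of_set (SYT l))) (\<lambda>T. real (maj l T))"

definition irwin_hall :: "nat \<Rightarrow> real measure" where
  "irwin_hall m = distr (PiM {..<m} (\<lambda>_. uniform_measure lborel {0..1::real})) borel
     (\<lambda>u. \<Sum>k<m. u k)"

definition normalized_irwin_hall :: "nat \<Rightarrow> real measure" where
  "normalized_irwin_hall m = normalized_law (irwin_hall m) (\<lambda>x. x)"

text \<open>The limit is required to be a probability distribution on the reals; \<open>weak_conv_m\<close> alone
  imposes no condition on it.\<close>
definition converges_in_distribution :: "(nat \<Rightarrow> real measure) \<Rightarrow> bool" where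
  "converges_in_distribution \<mu> \<longleftrightarrow> (\<exists>L. real_distribution L \<and> weak_conv_m \<mu> L)"

definition eventually_constant :: "(nat \<Rightarrow> 'a) \<Rightarrow> bool" where
  "eventually_constant f \<longleftrightarrow> (\<exists>c. eventually (\<lambda>N. f N = c) sequentially)"

definition discrete_law :: "real measure \<Rightarrow> bool" where
  "discrete_law L \<longleftrightarrow> (\<exists>S. countable S \<and> (AE x in L. x \<in> S))"

end

(* The q-hook length formula
     sum_T q^maj(T) = q^b(lam) [n]_q! / prod_c [h_c]_q
   turns the characteristic function of the centred major index, at the point s, into
   prod_{k<=n} S(k s) / prod_c S(h_c s) with S(x) = sin(x/2) / (x/2), where h_c are the hook lengths.
   Its expansion at 0 gives the variance (sum k^2 - sum h_c^2) / 12.  Since the hooks of the longest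
   line (row or column) dominate the numbers 1, ..., n - aft, for every nonnegative nondecreasing g
   one has 0 <= sum_k g(k) - sum_c g(h_c) <= aft g(n); on the other hand the variance is at least a
   constant times aft n^2.  Applied to the part of -log S beyond the quadratic term, this gives the
   normal limit if aft tends to infinity.  If aft = M is fixed, all but 2M factors of the numerator
   cancel against hooks of the longest line, and what remains converges to the characteristic
   function of the normalized Irwin-Hall law.  Conversely, a subsequence argument reduces to
   telling the possible limits apart by their characteristic functions: those of different M have
   different smallest zeros, the normal one has no zero, and the law of an integer valued variable
   has a characteristic function of modulus 1 at some nonzero point.

   The q-hook length formula is proved by removing the largest entry.  Refined by the row of that
   entry, the generating function of maj is a sum over horizontal strips, and the hook product
   satisfies the same recursion: in the variables lam_i + m - 1 - i it is a Vandermonde determinant,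
   and the sum over interlacing sequences can be carried out row by row inside the determinant. *)

theory Submission
  imports Defs "Jordan_Normal_Form.Determinant" "HOL-Real_Asymp.Real_Asymp"
begin

text \<open>For generic q the quotient \<open>hook_quot\<close> is the principal specialization
  s_lam(1, q, q^2, ...) of a Schur function, and its recursion over horizontal strips is the
  branching rule: set the first variable to 1 and take a factor q out of each of the others. This is
  why the strip \<open>a\<close> carries the weight \<open>q ^ sum_list a\<close>. The obstacle
  afterwards is division. The factors 1 - q^h vanish at roots of unity, and the sines of the hooks
  have zeros of their own. The identities therefore keep the hook product as a multiplier of the sum
  over tableaux and reach the unit circle by continuity. A quotient is formed only where the
  denominator is known to be nonzero: near 0 for the moments and for the normal limit, at generic
  arguments for the Irwin-Hall limit. In the normal case the error is at most the aft times the
  remainder of -log S at x = n |t| / sd. The variance bound keeps aft x^2 bounded, so a remainder of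
  order o(x^2) suffices.\<close>

section \<open>A determinantal summation\<close>

lemma permutes_less_bound: "p permutes {0..<n} \<Longrightarrow> i < n \<Longrightarrow> p i < n" for n :: nat
  using permutes_in_image[of p "{0..<n}" i] by auto

lemma det_row_scale:
  fixes a :: "nat \<Rightarrow> nat \<Rightarrow> 'a::comm_ring_1"
  shows "Determinant.det (mat n n (\<lambda>(i, j). c i * a i j)) =
    (\<Prod>i = 0..<n. c i) * Determinant.det (mat n n (\<lambda>(i, j). a i j))"
proof -
  have "signof p * (\<Prod>i = 0..<n. mat n n (\<lambda>(i, j). c i * a i j) $$ (i, p i)) =
      (\<Prod>i = 0..<n. c i) * (signof p * (\<Prod>i = 0..<n. mat n n (\<lambda>(i, j). a i j) $$ (i, p i)))"
    if "p permutes {0..<n}" for p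
  proof -
    have "(\<Prod>i = 0..<n. mat n n (\<lambda>(i, j). c i * a i j) $$ (i, p i)) =
        (\<Prod>i = 0..<n. c i * mat n n (\<lambda>(i, j). a i j) $$ (i, p i))"
      using permutes_in_image[OF that] by (intro prod.cong) auto
    thus ?thesis by (simp add: prod.distrib algebra_simps)
  qed
  thus ?thesis
    by (subst (1 2) det_def'[of _ n]) (auto simp: sum_distrib_left intro!: sum.cong)
qed

lemma det_column_scale:
  fixes a :: "nat \<Rightarrow> nat \<Rightarrow> 'a::comm_ring_1"
  shows "Determinant.det (mat n n (\<lambda>(i, j). c j * a i j)) =
    (\<Prod>i = 0..<n. c i) * Determinant.det (mat n n (\<lambda>(i, j). a i j))"
proof -
  have tr: "transpose_mat (mat n n (\<lambda>(i, j). f i j)) = mat n n (\<lambda>(i, j). f j i)" for f :: "nat \<Rightarrow> nat \<Rightarrow> 'a"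
    by (rule eq_matI) auto
  have "Determinant.det (mat n n (\<lambda>(i, j). c j * a i j)) = Determinant.det (mat n n (\<lambda>(i, j). c i * a j i))"
    by (subst det_transpose[symmetric, of _ n]) (auto simp: tr)
  also have "\<dots> = (\<Prod>i = 0..<n. c i) * Determinant.det (mat n n (\<lambda>(i, j). a j i))"
    by (rule det_row_scale)
  also have "Determinant.det (mat n n (\<lambda>(i, j). a j i)) = Determinant.det (mat n n (\<lambda>(i, j). a i j))"
    by (subst det_transpose[symmetric, of _ n]) (auto simp: tr)
  finally show ?thesis .
qed

text \<open>Row \<open>i\<close> involves only the coordinate \<open>f i\<close>, so every Leibniz
  term is a product over the rows and its sum over the box factors: multilinearity in all rows at
  once.\<close>

lemma det_sum_rows:
  fixes a :: "nat \<Rightarrow> 'b \<Rightarrow> nat \<Rightarrow> 'a::comm_ring_1"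
  assumes "\<And>i. i < n \<Longrightarrow> finite (B i)"
  shows "(\<Sum>f \<in> PiE {0..<n} B. Determinant.det (mat n n (\<lambda>(i, j). a i (f i) j))) =
    Determinant.det (mat n n (\<lambda>(i, j). \<Sum>x \<in> B i. a i x j))"
proof -
  have "(\<Sum>f \<in> PiE {0..<n} B. Determinant.det (mat n n (\<lambda>(i, j). a i (f i) j))) =
      (\<Sum>f \<in> PiE {0..<n} B. \<Sum>p | p permutes {0..<n}. signof p * (\<Prod>i = 0..<n. a i (f i) (p i)))"
  proof (intro sum.cong refl)
    fix f
    show "Determinant.det (mat n n (\<lambda>(i, j). a i (f i) j)) =
        (\<Sum>p | p permutes {0..<n}. signof p * (\<Prod>i = 0..<n. a i (f i) (p i)))"
      by (subst det_def'[of _ n])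
         (auto intro!: sum.cong prod.cong arg_cong2[where f="(*)"] simp: permutes_less_bound)
  qed
  also have "\<dots> = (\<Sum>p | p permutes {0..<n}. signof p * (\<Sum>f \<in> PiE {0..<n} B. \<Prod>i = 0..<n. a i (f i) (p i)))"
    by (subst sum.swap) (simp add: sum_distrib_left)
  also have "\<dots> = (\<Sum>p | p permutes {0..<n}. signof p * (\<Prod>i = 0..<n. \<Sum>x \<in> B i. a i x (p i)))"
    by (intro sum.cong refl arg_cong2[where f="(*)"] prod_sum_PiE[symmetric]) (use assms in auto)
  also have "\<dots> = Determinant.det (mat n n (\<lambda>(i, j). \<Sum>x \<in> B i. a i x j))"
    by (subst det_def'[of _ n])
       (auto intro!: sum.cong prod.cong arg_cong2[where f="(*)"] simp: permutes_less_bound)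
  finally show ?thesis .
qed

text \<open>Multiplication by such a matrix performs a whole family of row or column operations
  simultaneously, each using the original neighbouring line, without changing the
  determinant.\<close>

lemma det_unitriangular_band:
  fixes d :: "nat \<Rightarrow> 'a::comm_ring_1"
  shows "Determinant.det (mat n n (\<lambda>(i, j). if i = j then 1 else if Suc i = j then d i else 0)) = 1"
  by (subst det_upper_triangular[of _ n]) (auto simp: upper_triangular_def prod_list_diag_prod)

lemma sum_two_support:
  fixes f :: "nat \<Rightarrow> 'a::comm_monoid_add"
  assumes "finite A" "a \<in> A" "b \<in> A" "a \<noteq> b" "\<And>k. k \<in> A \<Longrightarrow> k \<noteq> a \<Longrightarrow> k \<noteq> b \<Longrightarrow> f k = 0"
  shows "sum f A = f a + f b"
proof -
  have "sum f A = sum f {a, b}"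
    by (rule sum.mono_neutral_right) (use assms in auto)
  thus ?thesis using assms by simp
qed

lemma mult_band_right:
  fixes a :: "nat \<Rightarrow> nat \<Rightarrow> 'a::comm_ring_1"
  shows "mat n n (\<lambda>(i, j). a i j) * mat n n (\<lambda>(i, j). if i = j then 1 else if Suc i = j then d i else 0) =
    mat n n (\<lambda>(i, j). a i j + (if j = 0 then 0 else a i (j - 1) * d (j - 1)))"
proof (rule eq_matI, goal_cases)
  case (1 i j)
  let ?f = "\<lambda>k. a i k * (if k = j then 1 else if Suc k = j then d k else 0)"
  have "(\<Sum>k = 0..<n. ?f k) = a i j + (if j = 0 then 0 else a i (j - 1) * d (j - 1))"
  proof (cases "j = 0")
    case True
    have "(\<Sum>k = 0..<n. ?f k) = (\<Sum>k \<in> {0}. ?f k)"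
      by (rule sum.mono_neutral_right) (use 1 True in auto)
    thus ?thesis using True by simp
  next
    case False
    then obtain l where l: "j = Suc l" by (cases j) auto
    have "(\<Sum>k = 0..<n. ?f k) = ?f j + ?f l"
      by (rule sum_two_support) (use 1 l in auto)
    thus ?thesis using l by simp
  qed
  with 1 show ?case by (simp add: scalar_prod_def)
qed auto

lemma mult_band_left:
  fixes a :: "nat \<Rightarrow> nat \<Rightarrow> 'a::comm_ring_1"
  shows "mat n n (\<lambda>(i, j). if i = j then 1 else if Suc i = j then d i else 0) * mat n n (\<lambda>(i, j). a i j) =
    mat n n (\<lambda>(i, j). a i j + (if Suc i < n then d i * a (Suc i) j else 0))"
proof (rule eq_matI, goal_cases)
  case (1 i j)
  let ?f = "\<lambda>k. (if i = k then 1 else if Suc i = k then d i else 0) * a k j"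
  have "(\<Sum>k = 0..<n. ?f k) = a i j + (if Suc i < n then d i * a (Suc i) j else 0)"
  proof (cases "Suc i < n")
    case False
    have "(\<Sum>k = 0..<n. ?f k) = (\<Sum>k \<in> {i}. ?f k)"
      by (rule sum.mono_neutral_right) (use 1 False in auto)
    thus ?thesis using False by simp
  next
    case True
    have "(\<Sum>k = 0..<n. ?f k) = ?f i + ?f (Suc i)"
      by (rule sum_two_support) (use 1 True in auto)
    thus ?thesis using True by simp
  qed
  with 1 show ?case by (simp add: scalar_prod_def)
qed auto

section \<open>The Vandermonde determinant\<close>

fun vand :: "'a::comm_ring_1 list \<Rightarrow> 'a" where
  "vand [] = 1"
| "vand (x # xs) = (\<Prod>y \<leftarrow> xs. y - x) * vand xs"

text \<open>Subtracting \<open>x\<close> times the preceding column turns the first row into (1, 0,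
  ..., 0), and row \<open>i\<close> of the remaining minor has the common factor
  \<open>xs ! i - x\<close>.\<close>

lemma det_vandermonde:
  "Determinant.det (mat (length xs) (length xs) (\<lambda>(i, j). (xs ! i) ^ j)) = vand xs"
proof (induction xs)
  case Nil
  show ?case by (simp add: det_dim_zero)
next
  case (Cons x xs)
  let ?n = "length (x # xs)"
  let ?V = "mat ?n ?n (\<lambda>(i, j). ((x # xs) ! i) ^ j)"
  let ?B = "mat ?n ?n (\<lambda>(i, j). if i = j then 1 else if Suc i = j then - x else 0)"
  have "Determinant.det ?V = Determinant.det ?V * Determinant.det ?B"
    using det_unitriangular_band[of ?n "\<lambda>_. - x"] by simp
  also have "\<dots> = Determinant.det (?V * ?B)"
    by (rule det_mult[symmetric, of _ ?n]) auto
  also have "?V * ?B = mat ?n ?n (\<lambda>(i, j). ((x # xs) ! i) ^ j +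
      (if j = 0 then 0 else ((x # xs) ! i) ^ (j - 1) * - x))" (is "_ = ?W")
    by (rule mult_band_right)
  also have "Determinant.det ?W = (\<Sum>j<?n. ?W $$ (0, j) * cofactor ?W 0 j)"
    by (rule laplace_expansion_row) auto
  also have "\<dots> = (\<Sum>j \<in> {0}. ?W $$ (0, j) * cofactor ?W 0 j)"
  proof (rule sum.mono_neutral_right)
    have "?W $$ (0, j) = 0" if "j \<in> {..<?n} - {0}" for j
      using that by (cases j) auto
    thus "\<forall>j \<in> {..<?n} - {0}. ?W $$ (0, j) * cofactor ?W 0 j = 0" by simp
  qed auto
  also have "\<dots> = Determinant.det (mat_delete ?W 0 0)"
    by (simp add: cofactor_def)
  also have "mat_delete ?W 0 0 = mat (length xs) (length xs) (\<lambda>(i, j). (xs ! i - x) * (xs ! i) ^ j)"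
    by (rule eq_matI) (auto simp: mat_delete_def algebra_simps)
  also have "Determinant.det \<dots> = (\<Prod>i = 0..<length xs. xs ! i - x) * vand xs"
    by (subst det_row_scale) (simp add: Cons.IH)
  also have "(\<Prod>i = 0..<length xs. xs ! i - x) = (\<Prod>y \<leftarrow> xs. y - x)"
    by (subst prod.list_conv_set_nth) simp
  finally show ?case by simp
qed

text \<open>The q-Pochhammer symbol (q; q)_n, which is (1 - q)^n [n]_q!. The powers of 1 - q may be
  left in because a shape has as many hooks as cells.\<close>

definition qfact :: "'a::comm_ring_1 \<Rightarrow> nat \<Rightarrow> 'a" where
  "qfact q n = (\<Prod>k = 1..n. 1 - q ^ k)"

lemma qfact_0 [simp]: "qfact q 0 = 1"
  by (simp add: qfact_def)

lemma qfact_Suc: "qfact q (Suc n) = qfact q n * (1 - q ^ Suc n)"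
  by (simp add: qfact_def prod.nat_ivl_Suc')

lemma qfact_nonzero:
  fixes q :: "'a::idom"
  assumes "\<And>k. k > 0 \<Longrightarrow> q ^ k \<noteq> 1"
  shows "qfact q n \<noteq> 0"
  using assms by (auto simp: qfact_def)

text \<open>With F(x) = q^((x + 1) j) / (q; q)_x, the terms of index x on the left add up to F(x) -
  F(x - 1), because q^j - 1 + q^x = q^j - (1 - q^x).\<close>

lemma qfact_telescope:
  fixes q :: "'a::field"
  assumes "\<And>k. k > 0 \<Longrightarrow> q ^ k \<noteq> 1"
  shows "(q ^ j - 1) * (\<Sum>x\<le>L. q ^ (x * j) / qfact q x) + (\<Sum>x\<le>L. q ^ (x * Suc j) / qfact q x) =
    q ^ j * (q ^ (L * j) / qfact q L)"
proof (induction L)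
  case (Suc L)
  define a where "a = q ^ (L * j)"
  define b where "b = q ^ j"
  define c where "c = q ^ Suc L"
  define f where "f = qfact q L"
  have nz: "f \<noteq> 0" "1 - c \<noteq> 0"
    using qfact_nonzero[OF assms] assms[of "Suc L"] by (auto simp: f_def c_def)
  have pw: "q ^ (Suc L * j) = a * b" "q ^ (Suc L * Suc j) = a * b * c"
    by (simp_all add: a_def b_def c_def add.commute add.left_commute flip: power_add power_Suc)
  have IH: "(b - 1) * (\<Sum>x\<le>L. q ^ (x * j) / qfact q x) + (\<Sum>x\<le>L. q ^ (x * Suc j) / qfact q x) = b * (a / f)"
    using Suc.IH by (simp add: a_def b_def f_def)
  have "(b - 1) * (\<Sum>x\<le>Suc L. q ^ (x * j) / qfact q x) + (\<Sum>x\<le>Suc L. q ^ (x * Suc j) / qfact q x) =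
     b * (a / f) + (b - 1) * (a * b / (f * (1 - c))) + a * b * c / (f * (1 - c))"
    unfolding IH[symmetric] sum.atMost_Suc pw qfact_Suc f_def[symmetric] c_def[symmetric]
    by (simp add: algebra_simps)
  also have "\<dots> = b * (a * b / (f * (1 - c)))"
    using nz by (simp add: divide_simps) (simp add: algebra_simps)
  finally show ?case unfolding pw qfact_Suc f_def[symmetric] c_def[symmetric] b_def[symmetric] .
qed auto

text \<open>Row operations turn the differences over the boxes into initial sums, and column operations
  evaluate these by \<open>qfact_telescope\<close>.\<close>
lemma det_box_sum:
  fixes q :: "'a::field"
  assumes q: "\<And>k. k > 0 \<Longrightarrow> q ^ k \<noteq> 1"
    and L: "\<And>i. Suc i < m \<Longrightarrow> L (Suc i) < L i"
  shows "(\<Sum>M \<in> PiE {0..<m} (\<lambda>i. {(if Suc i < m then Suc (L (Suc i)) else 0)..L i}).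
      (\<Prod>i = 0..<m. q ^ M i) * Determinant.det (mat m m (\<lambda>(i, j). q ^ (M i * j) / qfact q (M i)))) =
    (\<Prod>j = 0..<m. q ^ j) * Determinant.det (mat m m (\<lambda>(i, j). q ^ (L i * j) / qfact q (L i)))"
proof -
  let ?B = "\<lambda>i. {(if Suc i < m then Suc (L (Suc i)) else 0)..L i}"
  \<comment> \<open>The exponent \<open>Suc j\<close> absorbs the weight \<open>q ^ M i\<close> of
    the row.\<close>
  let ?s = "\<lambda>x j. q ^ (x * Suc j) / qfact q x"
  let ?S = "\<lambda>i j. \<Sum>x\<le>L i. ?s x j"
  let ?bl = "mat m m (\<lambda>(i, j). if i = j then 1 else if Suc i = j then - 1 else 0) :: 'a mat"
  let ?br = "mat m m (\<lambda>(i, j). if i = j then 1 else if Suc i = j then q ^ Suc i - 1 else 0) :: 'a mat"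
  have "(\<Sum>M \<in> PiE {0..<m} ?B. (\<Prod>i = 0..<m. q ^ M i) *
      Determinant.det (mat m m (\<lambda>(i, j). q ^ (M i * j) / qfact q (M i)))) =
    (\<Sum>M \<in> PiE {0..<m} ?B. Determinant.det (mat m m (\<lambda>(i, j). ?s (M i) j)))"
    by (simp add: det_row_scale[symmetric] power_add)
  also have "\<dots> = Determinant.det (mat m m (\<lambda>(i, j). \<Sum>x \<in> ?B i. ?s x j))"
    by (rule det_sum_rows) auto
  also have "mat m m (\<lambda>(i, j). \<Sum>x \<in> ?B i. ?s x j) =
      mat m m (\<lambda>(i, j). ?S i j + (if Suc i < m then - 1 * ?S (Suc i) j else 0))"
  proof -
    \<comment> \<open>Box \<open>i\<close> is \<open>{..L i}\<close> without
      \<open>{..L (Suc i)}\<close>; the last box starts at 0, so nothing is subtracted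
      there.\<close>
    have "(\<Sum>x \<in> ?B i. ?s x j) = ?S i j + (if Suc i < m then - 1 * ?S (Suc i) j else 0)" for i j
    proof (cases "Suc i < m")
      case True
      have "{..L i} = {..L (Suc i)} \<union> ?B i" using L[OF True] True by auto
      hence "?S i j = ?S (Suc i) j + (\<Sum>x \<in> ?B i. ?s x j)"
        by (simp only:) (rule sum.union_disjoint, use True in auto)
      thus ?thesis using True by simp
    qed (auto simp: atMost_atLeast0)
    thus ?thesis by (intro cong_mat) auto
  qed
  also have "\<dots> = ?bl * mat m m (\<lambda>(i, j). ?S i j)"
    by (rule mult_band_left[symmetric])
  also have "Determinant.det \<dots> = Determinant.det (mat m m (\<lambda>(i, j). ?S i j))"
    using det_unitriangular_band[of m "\<lambda>_. - 1 :: 'a"] by (subst det_mult[of _ m]) auto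
  also have "\<dots> = Determinant.det (mat m m (\<lambda>(i, j). ?S i j) * ?br)"
    using det_unitriangular_band[of m "\<lambda>i. q ^ Suc i - 1"] by (subst det_mult[of _ m]) auto
  also have "mat m m (\<lambda>(i, j). ?S i j) * ?br =
      mat m m (\<lambda>(i, j). ?S i j + (if j = 0 then 0 else ?S i (j - 1) * (q ^ Suc (j - 1) - 1)))"
    by (rule mult_band_right)
  also have "\<dots> = mat m m (\<lambda>(i, j). q ^ j * (q ^ (L i * j) / qfact q (L i)))"
  proof -
    have "?S i j + (if j = 0 then 0 else ?S i (j - 1) * (q ^ Suc (j - 1) - 1)) =
      q ^ j * (q ^ (L i * j) / qfact q (L i))" for i j
    \<comment> \<open>Because of the shifted exponent, \<open>?S i (j - 1)\<close> carries the
      exponent \<open>j\<close>, and the column operation reproduces the left side of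
      \<open>qfact_telescope\<close>. For \<open>j = 0\<close> the factor \<open>q ^ j - 1\<close>
      there is 0, so column 0 has the required form from the start.\<close>
    proof (cases j)
      case 0
      thus ?thesis using qfact_telescope[OF q, of 0 "L i"] by simp
    next
      case j: (Suc k)
      show ?thesis
        using qfact_telescope[OF q, of "Suc k" "L i"] unfolding j diff_Suc_1
        by (simp add: ac_simps del: power_Suc mult_Suc_right)
    qed
    thus ?thesis by (intro cong_mat) auto
  qed
  also have "Determinant.det \<dots> = (\<Prod>j = 0..<m. q ^ j) *
      Determinant.det (mat m m (\<lambda>(i, j). q ^ (L i * j) / qfact q (L i)))"
    by (rule det_column_scale)
  finally show ?thesis .
qed

section \<open>Removing the largest entry of a tableau\<close>

lemma sorted_ge_nth: "sorted_wrt (\<ge>) (l :: nat list) \<Longrightarrow> i \<le> j \<Longrightarrow> j < length l \<Longrightarrow> l ! j \<le> l ! i"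
  using sorted_wrt_nth_less[of "(\<ge>)" l i j] by (cases "i = j") auto

lemma sorted_ge_iff_nth:
  "sorted_wrt (\<ge>) (l :: nat list) \<longleftrightarrow> (\<forall>i j. i \<le> j \<longrightarrow> j < length l \<longrightarrow> l ! j \<le> l ! i)"
  using sorted_ge_nth[of l] by (auto simp: sorted_wrt_iff_nth_less)

lemma diagram_eq_Sigma: "diagram l = (SIGMA r:{..<length l}. {..<l ! r})"
  by (auto simp: diagram_def)

lemma finite_diagram [simp]: "finite (diagram l)"
  by (simp add: diagram_eq_Sigma)

lemma card_diagram: "card (diagram l) = sum_list l"
  by (simp add: diagram_eq_Sigma sum_list_sum_nth lessThan_atLeast0)

lemma SYT_bij: "T \<in> SYT l \<Longrightarrow> bij_betw T (diagram l) {1..sum_list l}"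
  and SYT_ext: "T \<in> SYT l \<Longrightarrow> T \<in> extensional (diagram l)"
  and SYT_row: "T \<in> SYT l \<Longrightarrow> (r, c) \<in> diagram l \<Longrightarrow> (r, c') \<in> diagram l \<Longrightarrow> c < c' \<Longrightarrow> T (r, c) < T (r, c')"
  and SYT_col: "T \<in> SYT l \<Longrightarrow> (r, c) \<in> diagram l \<Longrightarrow> (r', c) \<in> diagram l \<Longrightarrow> r < r' \<Longrightarrow> T (r, c) < T (r', c)"
  unfolding SYT_def by blast+

lemma SYT_range: "T \<in> SYT l \<Longrightarrow> x \<in> diagram l \<Longrightarrow> T x \<in> {1..sum_list l}"
  using SYT_bij[of T l] by (auto simp: bij_betw_def)

lemma SYT_inj: "T \<in> SYT l \<Longrightarrow> x \<in> diagram l \<Longrightarrow> y \<in> diagram l \<Longrightarrow> T x = T y \<Longrightarrow> x = y"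
  using SYT_bij[of T l] by (auto simp: bij_betw_def inj_on_def)

lemma finite_SYT [simp]: "finite (SYT l)"
proof (rule finite_subset)
  show "SYT l \<subseteq> PiE (diagram l) (\<lambda>_. {1..sum_list l})"
    by (auto simp: PiE_def SYT_ext dest: SYT_range)
qed (auto intro: finite_PiE)

lemma finite_descents [simp]: "finite (descents l T)"
proof (rule finite_subset)
  show "descents l T \<subseteq> T ` diagram l"
    by (force simp: descents_def)
qed auto

text \<open>The largest entry can only be the last one of its row. The membership condition excludes
  empty rows, where the truncated \<open>l ! r - 1\<close> is 0 although no cell exists.\<close>

definition SYT_max_row :: "nat list \<Rightarrow> nat \<Rightarrow> (nat \<times> nat \<Rightarrow> nat) set" where
  "SYT_max_row l r = {T \<in> SYT l. (r, l ! r - 1) \<in> diagram l \<and> T (r, l ! r - 1) = sum_list l}"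

definition maj_gf :: "'a::comm_ring_1 \<Rightarrow> nat list \<Rightarrow> 'a" where
  "maj_gf q l = (\<Sum>T \<in> SYT l. q ^ maj l T)"

definition maj_gf_row :: "'a::comm_ring_1 \<Rightarrow> nat list \<Rightarrow> nat \<Rightarrow> 'a" where
  "maj_gf_row q l r = (\<Sum>T \<in> SYT_max_row l r. q ^ maj l T)"

definition corner :: "nat list \<Rightarrow> nat \<Rightarrow> bool" where
  "corner l r \<longleftrightarrow> r < length l \<and> 0 < l ! r \<and> (Suc r < length l \<longrightarrow> l ! Suc r < l ! r)"

definition remove_corner :: "nat list \<Rightarrow> nat \<Rightarrow> nat list" where
  "remove_corner l r = l[r := l ! r - 1]"

lemma SYT_max_position:
  assumes "T \<in> SYT l" "(r, c) \<in> diagram l" "T (r, c) = sum_list l"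
  shows "c = l ! r - 1"
proof (rule ccontr)
  assume "c \<noteq> l ! r - 1"
  hence d: "(r, Suc c) \<in> diagram l" using assms by (auto simp: diagram_def)
  with SYT_row[OF assms(1,2) d] SYT_range[OF assms(1) d] assms(3) show False by simp
qed

lemma SYT_max_row_corner:
  assumes "T \<in> SYT_max_row l r"
  shows "corner l r"
proof -
  from assms have T: "T \<in> SYT l" and d: "(r, l ! r - 1) \<in> diagram l"
    and mx: "T (r, l ! r - 1) = sum_list l" by (auto simp: SYT_max_row_def)
  have "l ! Suc r < l ! r" if "Suc r < length l"
  proof (rule ccontr)
    assume "\<not> ?thesis"
    hence d': "(Suc r, l ! r - 1) \<in> diagram l" using that d by (auto simp: diagram_def)
    with SYT_col[OF T d d'] SYT_range[OF T d'] mx show False by simp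
  qed
  with d show ?thesis by (auto simp: corner_def diagram_def)
qed

lemma maj_gf_row_noncorner: "\<not> corner l r \<Longrightarrow> maj_gf_row q l r = 0"
  using SYT_max_row_corner[of _ l r] by (auto simp: maj_gf_row_def intro!: sum.neutral)

lemma SYT_eq_UN_max_row:
  assumes "sum_list l > 0"
  shows "SYT l = (\<Union>r<length l. SYT_max_row l r)"
proof (intro equalityI subsetI)
  fix T assume T: "T \<in> SYT l"
  have "sum_list l \<in> T ` diagram l"
    using SYT_bij[OF T] assms by (auto simp: bij_betw_def)
  then obtain r c where rc: "(r, c) \<in> diagram l" "T (r, c) = sum_list l" by force
  have "c = l ! r - 1" using SYT_max_position[OF T rc] .
  with rc T show "T \<in> (\<Union>r<length l. SYT_max_row l r)"
    by (auto simp: SYT_max_row_def diagram_def)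
qed (auto simp: SYT_max_row_def)

lemma SYT_max_row_disjoint: "r \<noteq> r' \<Longrightarrow> SYT_max_row l r \<inter> SYT_max_row l r' = {}"
  by (auto simp: SYT_max_row_def dest: SYT_inj)

lemma sum_SYT_by_max_row:
  assumes "sum_list l > 0"
  shows "(\<Sum>T \<in> SYT l. f T) = (\<Sum>r<length l. \<Sum>T \<in> SYT_max_row l r. f T)"
  unfolding SYT_eq_UN_max_row[OF assms]
proof (rule sum.UNION_disjoint)
  show "\<forall>i \<in> {..<length l}. finite (SYT_max_row l i)"
    by (auto simp: SYT_max_row_def)
qed (use SYT_max_row_disjoint in auto)

lemma maj_gf_eq_sum_rows:
  "sum_list l > 0 \<Longrightarrow> maj_gf q l = (\<Sum>r<length l. maj_gf_row q l r)"
  by (simp add: maj_gf_def maj_gf_row_def sum_SYT_by_max_row)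

lemma maj_gf_empty:
  assumes "sum_list l = 0"
  shows "maj_gf q l = 1"
proof -
  have d: "diagram l = {}" using card_diagram[of l] assms by simp
  have "SYT l = {\<lambda>_. undefined}"
    unfolding SYT_def d using assms by (auto simp: bij_betw_def)
  thus ?thesis by (simp add: maj_gf_def maj_def descents_def d)
qed

context
  fixes l :: "nat list" and r :: nat
  assumes srt: "sorted_wrt (\<ge>) l" and cor: "corner l r"
begin

lemma length_remove_corner [simp]: "length (remove_corner l r) = length l"
  by (simp add: remove_corner_def)

lemma nth_remove_corner: "i < length l \<Longrightarrow> remove_corner l r ! i = (if i = r then l ! r - 1 else l ! i)"
  by (simp add: remove_corner_def)

lemma sorted_remove_corner: "sorted_wrt (\<ge>) (remove_corner l r)"
  unfolding sorted_ge_iff_nth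
proof (intro allI impI)
  fix i j assume ij: "i \<le> j" "j < length (remove_corner l r)"
  have "l ! j \<le> l ! i" using sorted_ge_nth[OF srt, of i j] ij by simp
  moreover have "l ! j < l ! r" if "r < j"
    using sorted_ge_nth[OF srt, of "Suc r" j] cor ij that by (auto simp: corner_def)
  ultimately show "remove_corner l r ! j \<le> remove_corner l r ! i"
    using ij by (auto simp: nth_remove_corner)
qed

lemma sum_list_remove_corner: "Suc (sum_list (remove_corner l r)) = sum_list l"
proof -
  have "l ! r \<le> sum_list l" using cor by (auto simp: corner_def intro!: elem_le_sum_list)
  thus ?thesis using cor by (auto simp: corner_def remove_corner_def sum_list_update)
qed

lemma corner_cell: "(r, l ! r - 1) \<in> diagram l"
  using cor by (auto simp: corner_def diagram_def)

lemma diagram_remove_corner: "diagram (remove_corner l r) = diagram l - {(r, l ! r - 1)}"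
  using cor by (auto simp: diagram_def nth_remove_corner corner_def split: if_splits)

lemma SYT_restrict_remove_corner:
  assumes "T \<in> SYT_max_row l r"
  shows "T((r, l ! r - 1) := undefined) \<in> SYT (remove_corner l r)"
proof -
  let ?x = "(r, l ! r - 1)"
  from assms have T: "T \<in> SYT l" and mx: "T ?x = sum_list l" by (auto simp: SYT_max_row_def)
  have "bij_betw T (diagram l - {?x}) ({1..sum_list l} - {T ?x})"
    using SYT_bij[OF T] corner_cell by (auto simp: bij_betw_def inj_on_def)
  also have "{1..sum_list l} - {T ?x} = {1..sum_list (remove_corner l r)}"
    using mx sum_list_remove_corner by auto
  finally have "bij_betw (T(?x := undefined)) (diagram l - {?x}) {1..sum_list (remove_corner l r)}"
    by (subst bij_betw_cong[where g = T]) auto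
  moreover have "T(?x := undefined) \<in> extensional (diagram l - {?x})"
    using SYT_ext[OF T] by (auto simp: extensional_def)
  ultimately show ?thesis
    unfolding SYT_def diagram_remove_corner using SYT_row[OF T] SYT_col[OF T] by auto
qed

lemma SYT_extend_remove_corner:
  assumes T: "T \<in> SYT (remove_corner l r)"
  shows "T((r, l ! r - 1) := sum_list l) \<in> SYT_max_row l r"
proof -
  let ?x = "(r, l ! r - 1)" and ?l = "remove_corner l r"
  let ?T = "T(?x := sum_list l)"
  have D: "diagram l = insert ?x (diagram ?l)"
    using diagram_remove_corner corner_cell by auto
  have x: "?x \<notin> diagram ?l" using diagram_remove_corner by auto
  have "bij_betw ?T (diagram ?l) {1..sum_list ?l}"
    by (subst bij_betw_cong[where g = T]) (use x SYT_bij[OF T] in auto)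
  moreover have "sum_list l \<notin> {1..sum_list ?l}" using sum_list_remove_corner by auto
  ultimately have "bij_betw ?T (diagram ?l \<union> {?x}) ({1..sum_list ?l} \<union> {?T ?x})"
    by (intro notIn_Un_bij_betw) (use x in auto)
  also have "{1..sum_list ?l} \<union> {?T ?x} = {1..sum_list l}"
    using sum_list_remove_corner by auto
  finally have bij: "bij_betw ?T (diagram l) {1..sum_list l}" unfolding D by (simp only: Un_insert_right Un_empty_right)
  have ext: "?T \<in> extensional (diagram l)"
    using SYT_ext[OF T] D by (auto simp: extensional_def)
  have small: "T y < sum_list l" if "y \<in> diagram ?l" for y
    using SYT_range[OF T that] sum_list_remove_corner by auto
  have row: "?T (a, c) < ?T (a, c')" if "(a, c) \<in> diagram l" "(a, c') \<in> diagram l" "c < c'" for a c c'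
  proof (cases "(a, c) = ?x")
    case True
    thus ?thesis using that by (auto simp: diagram_def)
  next
    case False
    with that(1) have "(a, c) \<in> diagram ?l" using D by auto
    thus ?thesis using False small SYT_row[OF T, of a c c'] that D by auto
  qed
  have col: "?T (a, c) < ?T (b, c)" if "(a, c) \<in> diagram l" "(b, c) \<in> diagram l" "a < b" for a b c
  proof (cases "(a, c) = ?x")
    case True
    \<comment> \<open>Nothing lies below the corner, since all lower rows are strictly shorter than
      row \<open>r\<close>.\<close>
    hence "l ! b \<le> l ! Suc r" "Suc r < length l"
      using that sorted_ge_nth[OF srt, of "Suc r" b] by (auto simp: diagram_def)
    hence "l ! b < l ! r" using cor by (auto simp: corner_def)
    thus ?thesis using that True by (auto simp: diagram_def)
  next
    case False
    with that(1) have "(a, c) \<in> diagram ?l" using D by auto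
    thus ?thesis using False small SYT_col[OF T, of a c b] that D by auto
  qed
  show ?thesis
    unfolding SYT_max_row_def SYT_def using ext bij row col corner_cell by auto
qed

lemma bij_SYT_remove_corner:
  "bij_betw (\<lambda>T. T((r, l ! r - 1) := sum_list l)) (SYT (remove_corner l r)) (SYT_max_row l r)"
proof (rule bij_betwI[where g = "\<lambda>T. T((r, l ! r - 1) := undefined)"])
  fix T assume T: "T \<in> SYT (remove_corner l r)"
  have "(r, l ! r - 1) \<notin> diagram (remove_corner l r)" by (simp add: diagram_remove_corner)
  hence "T (r, l ! r - 1) = undefined"
    using SYT_ext[OF T] by (simp add: extensional_def)
  thus "T((r, l ! r - 1) := sum_list l, (r, l ! r - 1) := undefined) = T" by auto
next
  fix T assume T: "T \<in> SYT_max_row l r"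
  thus "T((r, l ! r - 1) := undefined, (r, l ! r - 1) := sum_list l) = T"
    by (auto simp: SYT_max_row_def)
qed (blast intro: SYT_restrict_remove_corner SYT_extend_remove_corner)+

text \<open>The new largest entry n leaves the cells of 1, ..., n - 1 in place, so only n - 1 can
  become a descent, and it does exactly when its row \<open>r'\<close> lies above
  \<open>r\<close>.\<close>

lemma maj_extend_remove_corner:
  assumes T: "T \<in> SYT_max_row (remove_corner l r) r'" and n: "sum_list l \<ge> 2"
  shows "maj l (T((r, l ! r - 1) := sum_list l)) =
    maj (remove_corner l r) T + (if r' < r then sum_list l - 1 else 0)"
proof -
  let ?x = "(r, l ! r - 1)" and ?l = "remove_corner l r"
  let ?T = "T(?x := sum_list l)"
  let ?y = "(r', ?l ! r' - 1)"
  from T have S: "T \<in> SYT ?l" and y: "?y \<in> diagram ?l" and Ty: "T ?y = sum_list l - 1"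
    using sum_list_remove_corner by (auto simp: SYT_max_row_def)
  have D: "diagram l = insert ?x (diagram ?l)"
    using diagram_remove_corner corner_cell by auto
  have x: "?x \<notin> diagram ?l" using diagram_remove_corner by auto
  have Tx: "?T ?x = sum_list l" and Tz: "\<And>z. z \<in> diagram ?l \<Longrightarrow> ?T z = T z"
    using x by auto
  have small: "T z < sum_list l" if "z \<in> diagram ?l" for z
    using SYT_range[OF S that] sum_list_remove_corner by auto
  have desc: "descents l' T' = {i. \<exists>a \<in> diagram l'. \<exists>b \<in> diagram l'. T' a = i \<and> T' b = i + 1 \<and> fst a < fst b}"
    for l' T' unfolding descents_def by (simp add: Bex_def) blast
  have eq: "descents l ?T = descents ?l T \<union> (if r' < r then {sum_list l - 1} else {})"
  proof (intro equalityI subsetI)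
    fix i assume "i \<in> descents l ?T"
    then obtain a b where ab: "a \<in> diagram l" "b \<in> diagram l" "?T a = i" "?T b = i + 1" "fst a < fst b"
      by (auto simp: desc)
    have a: "a \<in> diagram ?l"
    proof (rule ccontr)
      assume "a \<notin> diagram ?l"
      hence "a = ?x" using ab D by auto
      hence "i = sum_list l" using ab Tx by simp
      moreover have "?T b \<le> sum_list l"
      proof (cases "b = ?x")
        case False
        hence "b \<in> diagram ?l" using ab(2) D by blast
        from Tz[OF this] small[OF this] show ?thesis by linarith
      qed (use Tx in simp)
      ultimately show False using ab by simp
    qed
    show "i \<in> descents ?l T \<union> (if r' < r then {sum_list l - 1} else {})"
    proof (cases "b = ?x")
      case True
      hence "T a = T ?y" "i = sum_list l - 1" using ab Tx Tz[OF a] Ty by auto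
      moreover from this have "a = ?y" using SYT_inj[OF S a y] by simp
      ultimately show ?thesis using ab True by auto
    next
      case False
      hence "b \<in> diagram ?l" using ab D by auto
      thus ?thesis using ab a Tz by (auto simp: desc)
    qed
  next
    fix i assume i: "i \<in> descents ?l T \<union> (if r' < r then {sum_list l - 1} else {})"
    consider "i \<in> descents ?l T" | "r' < r" "i = sum_list l - 1"
      using i by (auto split: if_splits)
    thus "i \<in> descents l ?T"
    proof cases
      case 1
      then obtain a b where "a \<in> diagram ?l" "b \<in> diagram ?l" "T a = i" "T b = i + 1" "fst a < fst b"
        by (auto simp: desc)
      thus ?thesis unfolding desc using D Tz by (intro CollectI bexI[of _ a] bexI[of _ b]) auto
    next
      case 2
      thus ?thesis unfolding desc using D Tz[OF y] Tx Ty y n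
        by (intro CollectI bexI[of _ ?y] bexI[of _ ?x]) auto
    qed
  qed
  have "sum_list l - 1 \<notin> descents ?l T"
  proof
    assume "sum_list l - 1 \<in> descents ?l T"
    then obtain b where "b \<in> diagram ?l" "T b = sum_list l - 1 + 1" by (auto simp: desc)
    thus False using small[of b] by simp
  qed
  thus ?thesis unfolding maj_def eq by auto
qed

text \<open>Sort by the row \<open>r'\<close> of the second largest entry: rows above
  \<open>r\<close> receive the factor \<open>q ^ (n - 1)\<close>, the others 1, where n is the size
  of \<open>l\<close>. Writing the rows above \<open>r\<close> as the total minus the rest leaves
  only rows from \<open>r\<close> on, which are the rows that a strip beginning in row
  \<open>r\<close> may still change.\<close>

lemma maj_gf_row_rec:
  fixes q :: "'a::comm_ring_1"
  shows "maj_gf_row q l r = (1 - q ^ (sum_list l - 1)) * (\<Sum>r' = r..<length l. maj_gf_row q (remove_corner l r) r') +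
    q ^ (sum_list l - 1) * maj_gf q (remove_corner l r)"
proof (cases "sum_list l \<ge> 2")
  case True
  let ?l = "remove_corner l r" and ?n = "sum_list l - 1"
  have pos: "sum_list ?l > 0" using True sum_list_remove_corner by simp
  have "maj_gf_row q l r = (\<Sum>T \<in> SYT ?l. q ^ maj l (T((r, l ! r - 1) := sum_list l)))"
    unfolding maj_gf_row_def by (rule sum.reindex_bij_betw[OF bij_SYT_remove_corner, symmetric])
  also have "\<dots> = (\<Sum>r'<length l. \<Sum>T \<in> SYT_max_row ?l r'. q ^ maj l (T((r, l ! r - 1) := sum_list l)))"
    by (subst sum_SYT_by_max_row[OF pos]) simp
  also have "\<dots> = (\<Sum>r'<length l. (if r' < r then q ^ ?n else 1) * maj_gf_row q ?l r')"
  proof (rule sum.cong)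
    fix r'
    have "(\<Sum>T \<in> SYT_max_row ?l r'. q ^ maj l (T((r, l ! r - 1) := sum_list l))) =
        (\<Sum>T \<in> SYT_max_row ?l r'. (if r' < r then q ^ ?n else 1) * q ^ maj ?l T)"
    proof (rule sum.cong)
      fix T assume "T \<in> SYT_max_row ?l r'"
      from maj_extend_remove_corner[OF this True]
      show "q ^ maj l (T((r, l ! r - 1) := sum_list l)) = (if r' < r then q ^ ?n else 1) * q ^ maj ?l T"
        by (simp add: power_add mult.commute)
    qed simp
    thus "(\<Sum>T \<in> SYT_max_row ?l r'. q ^ maj l (T((r, l ! r - 1) := sum_list l))) =
        (if r' < r then q ^ ?n else 1) * maj_gf_row q ?l r'"
      unfolding maj_gf_row_def by (simp only: sum_distrib_left)
  qed simp
  also have "{..<length l} = {..<r} \<union> {r..<length l}"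
    using cor by (auto simp: corner_def)
  also have "(\<Sum>r' \<in> \<dots>. (if r' < r then q ^ ?n else 1) * maj_gf_row q ?l r') =
      (\<Sum>r'<r. (if r' < r then q ^ ?n else 1) * maj_gf_row q ?l r') +
      (\<Sum>r' = r..<length l. (if r' < r then q ^ ?n else 1) * maj_gf_row q ?l r')"
    by (rule sum.union_disjoint) auto
  also have "\<dots> = q ^ ?n * (\<Sum>r'<r. maj_gf_row q ?l r') + (\<Sum>r' = r..<length l. maj_gf_row q ?l r')"
    unfolding sum_distrib_left by (intro arg_cong2[where f = "(+)"] sum.cong) auto
  also have "(\<Sum>r'<r. maj_gf_row q ?l r') = maj_gf q ?l - (\<Sum>r' = r..<length l. maj_gf_row q ?l r')"
  proof -
    have "maj_gf q ?l = (\<Sum>r'<length l. maj_gf_row q ?l r')"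
      using maj_gf_eq_sum_rows[OF pos] by simp
    also have "{..<length l} = {..<r} \<union> {r..<length l}"
      using cor by (auto simp: corner_def)
    finally show ?thesis by (subst (asm) sum.union_disjoint) auto
  qed
  finally show ?thesis by (simp add: algebra_simps)
next
  case False
  \<comment> \<open>A single cell has no second largest entry; the formula still holds because
    \<open>q ^ 0 = 1\<close> leaves just the generating function of the empty shape.\<close>
  hence n: "sum_list l = 1" using sum_list_remove_corner by simp
  hence n': "sum_list (remove_corner l r) = 0" using sum_list_remove_corner by simp
  have "maj_gf_row q l r = (\<Sum>T \<in> SYT (remove_corner l r). q ^ maj l (T((r, l ! r - 1) := sum_list l)))"
    unfolding maj_gf_row_def by (rule sum.reindex_bij_betw[OF bij_SYT_remove_corner, symmetric])
  also have "\<dots> = (\<Sum>T \<in> SYT (remove_corner l r). q ^ maj (remove_corner l r) T)"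
  proof (intro sum.cong refl arg_cong2[where f = "(^)"])
    fix T
    have "card (diagram l) = 1" using n card_diagram by simp
    then obtain z where "diagram l = {z}" by (auto simp: card_1_singleton_iff)
    hence "descents l S = {}" for S by (auto simp: descents_def)
    moreover have "diagram (remove_corner l r) = {}"
      using n' card_diagram[of "remove_corner l r"] finite_diagram by (metis card_0_eq)
    hence "descents (remove_corner l r) T = {}" by (auto simp: descents_def)
    ultimately show "maj l (T((r, l ! r - 1) := sum_list l)) = maj (remove_corner l r) T"
      by (simp add: maj_def)
  qed
  finally show ?thesis using n by (simp add: maj_gf_def)
qed

end

section \<open>The q-hook length formula\<close>

text \<open>In this section partitions may have trailing zeros, so that shapes differing by a horizontal
  strip can be compared as lists of equal length.\<close>

fun hooks :: "nat list \<Rightarrow> nat list" where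
  "hooks [] = []"
| "hooks (x # l) = map (\<lambda>c. x - c + length (filter (\<lambda>p. c < p) l)) [0..<x] @ hooks l"

text \<open>The entry with index \<open>i\<close> is \<open>l ! i + (length l - 1 - i)\<close>.\<close>
fun shifted :: "nat list \<Rightarrow> nat list" where
  "shifted [] = []"
| "shifted (x # l) = (x + length l) # shifted l"

text \<open>The usual statistic \<open>\<Sum>i. i * l ! i\<close>.\<close>
fun min_maj :: "nat list \<Rightarrow> nat" where
  "min_maj [] = 0"
| "min_maj (x # l) = sum_list l + min_maj l"

lemma length_shifted [simp]: "length (shifted l) = length l"
  by (induction l) auto

lemma nth_shifted: "i < length l \<Longrightarrow> shifted l ! i = l ! i + (length l - 1 - i)"
  by (induction l arbitrary: i) (auto simp: nth_Cons split: nat.splits)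

lemma sum_list_shifted: "sum_list (shifted l) = sum_list l + (\<Sum>j<length l. j)"
  by (induction l) auto

lemma less_length_filter_iff:
  "sorted_wrt (\<ge>) (l :: nat list) \<Longrightarrow> j < length l \<Longrightarrow> j < length (filter (\<lambda>p. c < p) l) \<longleftrightarrow> c < l ! j"
proof (induction l arbitrary: j)
  case (Cons x l)
  show ?case
  proof (cases "c < x")
    case True
    thus ?thesis using Cons by (cases j) auto
  next
    case False
    hence "filter (\<lambda>p. c < p) (x # l) = []" using Cons.prems by (auto simp: filter_empty_conv)
    moreover have "(x # l) ! j \<le> x"
      using Cons.prems by (cases j) auto
    ultimately show ?thesis using False by simp
  qed
qed simp

lemma length_filter_antimono: "c \<le> c' \<Longrightarrow> length (filter (\<lambda>p. c' < p) l) \<le> length (filter (\<lambda>p. c < (p::nat)) l)"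
  by (induction l) auto

text \<open>Both maps are injective by monotonicity. The hook in column \<open>c\<close> is larger
  than the number belonging to row \<open>j\<close> if \<open>c < l ! j\<close>, and smaller
  otherwise. So all values are distinct, they lie between 1 and \<open>x + length l\<close>, and
  there are just as many of them.\<close>

lemma row_hooks_complement:
  assumes "sorted_wrt (\<ge>) (x # l)"
  shows "mset (map (\<lambda>c. x - c + length (filter (\<lambda>p. c < p) l)) [0..<x] @
      map (\<lambda>y. x + length l - y) (shifted l)) = mset [1..<Suc (x + length l)]"
    (is "mset (?A @ ?B) = _")
proof -
  let ?k = "length l"
  let ?h = "\<lambda>c. x - c + length (filter (\<lambda>p. c < p) l)"
  have srt: "sorted_wrt (\<ge>) l" and le: "\<And>j. j < ?k \<Longrightarrow> l ! j \<le> x"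
    using assms by auto
  have B: "?B = map (\<lambda>j. x + 1 + j - l ! j) [0..<?k]"
    by (rule nth_equalityI) (auto simp: nth_shifted)
  have "inj_on ?h {0..<x}"
  proof (rule linorder_inj_onI)
    fix c c' assume "c < c'" "c \<in> {0..<x}" "c' \<in> {0..<x}"
    thus "?h c \<noteq> ?h c'" using length_filter_antimono[of c c' l] by auto
  qed auto
  moreover have "inj_on (\<lambda>j. x + 1 + j - l ! j) {0..<?k}"
  proof (rule linorder_inj_onI)
    fix j j' assume "j < j'" "j \<in> {0..<?k}" "j' \<in> {0..<?k}"
    thus "x + 1 + j - l ! j \<noteq> x + 1 + j' - l ! j'"
      using sorted_ge_nth[OF srt, of j j'] le[of j] le[of j'] by auto
  qed auto
  moreover have "?h c \<noteq> x + 1 + j - l ! j" if "c < x" "j < ?k" for c j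
    using less_length_filter_iff[OF srt that(2), of c] le[OF that(2)] that by auto
  ultimately have dist: "distinct (?A @ ?B)"
    unfolding B by (auto simp: distinct_map)
  have "set (?A @ ?B) = {1..<Suc (x + ?k)}"
  proof (rule card_subset_eq)
    show "set (?A @ ?B) \<subseteq> {1..<Suc (x + ?k)}"
    proof -
      have "?h c \<in> {1..<Suc (x + ?k)}" if "c < x" for c
        using that length_filter_le[of "\<lambda>p. c < p" l] unfolding atLeastLessThan_iff by linarith
      moreover have "x + 1 + j - l ! j \<in> {1..<Suc (x + ?k)}" if "j < ?k" for j
        using that le[OF that] by auto
      ultimately show ?thesis unfolding B by fastforce
    qed
    show "card (set (?A @ ?B)) = card {1..<Suc (x + ?k)}"
      using distinct_card[OF dist] by simp
  qed simp
  thus ?thesis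
    by (intro set_eq_iff_mset_eq_distinct[THEN iffD1, OF dist distinct_upt]) (simp only: set_upt)
qed

lemma prod_list_map_cong_mset:
  fixes f :: "'a \<Rightarrow> 'b::comm_monoid_mult"
  shows "mset xs = mset ys \<Longrightarrow> prod_list (map f xs) = prod_list (map f ys)"
  by (metis mset_map prod_mset_prod_list)

lemma qfact_row_hooks:
  fixes q :: "'a::comm_ring_1"
  assumes "sorted_wrt (\<ge>) (x # l)"
  shows "qfact q (x + length l) =
    (\<Prod>h \<leftarrow> map (\<lambda>c. x - c + length (filter (\<lambda>p. c < p) l)) [0..<x]. 1 - q ^ h) *
    (\<Prod>y \<leftarrow> shifted l. 1 - q ^ (x + length l - y))"
proof -
  have "qfact q (x + length l) = (\<Prod>h \<leftarrow> [1..<Suc (x + length l)]. 1 - q ^ h)"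
    unfolding qfact_def prod.distinct_set_conv_list[OF distinct_upt, symmetric] set_upt
      atLeastLessThanSuc_atLeastAtMost ..
  also have "\<dots> = (\<Prod>h \<leftarrow> map (\<lambda>c. x - c + length (filter (\<lambda>p. c < p) l)) [0..<x] @
      map (\<lambda>y. x + length l - y) (shifted l). 1 - q ^ h)"
    by (rule prod_list_map_cong_mset[OF row_hooks_complement[OF assms], symmetric])
  finally show ?thesis by (simp add: o_def)
qed

definition hook_quot :: "'a::field \<Rightarrow> nat list \<Rightarrow> 'a" where
  "hook_quot q l = q ^ min_maj l / (\<Prod>h \<leftarrow> hooks l. 1 - q ^ h)"

text \<open>This is the binomial coefficient \<open>k choose 3\<close>, the power of q that the
  staircase shift contributes to the Vandermonde product.\<close>

fun staircase_exp :: "nat \<Rightarrow> nat" where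
  "staircase_exp 0 = 0"
| "staircase_exp (Suc k) = staircase_exp k + (\<Sum>j<k. j)"

lemma hooks_pos: "h \<in> set (hooks l) \<Longrightarrow> h > 0"
  by (induction l) auto

lemma prod_hooks_nonzero:
  fixes q :: "'a::field"
  assumes "\<And>k. k > 0 \<Longrightarrow> q ^ k \<noteq> 1"
  shows "(\<Prod>h \<leftarrow> hooks l. 1 - q ^ h) \<noteq> 0"
  using assms hooks_pos[of _ l] by (auto simp: prod_list_zero_iff)

lemma prod_list_shift_diff:
  fixes q :: "'a::comm_ring_1"
  assumes "\<And>y. y \<in> set ys \<Longrightarrow> y \<le> L"
  shows "(\<Prod>y \<leftarrow> ys. q ^ y - q ^ L) = q ^ sum_list ys * (\<Prod>y \<leftarrow> ys. 1 - q ^ (L - y))"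
  using assms
proof (induction ys)
  case (Cons y ys)
  have "q ^ y - q ^ L = q ^ y * (1 - q ^ (L - y))"
    using Cons.prems[of y] by (simp add: algebra_simps flip: power_add)
  thus ?case using Cons by (simp add: power_add ac_simps)
qed simp

text \<open>Induction on the rows. With L the shifted top part, the top row contributes the factors
  q^y - q^L = q^y (1 - q^(L - y)), and by \<open>qfact_row_hooks\<close> the parts 1 - q^(L - y)
  cancel against (q; q)_L up to the hooks of that row. The powers q^y supply the increments of
  \<open>min_maj\<close> and \<open>staircase_exp\<close>.\<close>

lemma vand_shifted:
  fixes q :: "'a::field"
  assumes q: "\<And>k. k > 0 \<Longrightarrow> q ^ k \<noteq> 1" and "sorted_wrt (\<ge>) l"
  shows "vand (map ((^) q) (shifted l)) / (\<Prod>y \<leftarrow> shifted l. qfact q y) =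
    q ^ staircase_exp (length l) * hook_quot q l"
  using assms(2)
proof (induction l)
  case (Cons x l)
  let ?L = "x + length l"
  let ?r = "\<Prod>h \<leftarrow> map (\<lambda>c. x - c + length (filter (\<lambda>p. c < p) l)) [0..<x]. 1 - q ^ h"
  let ?d = "\<Prod>y \<leftarrow> shifted l. 1 - q ^ (?L - y)"
  have le: "y \<le> ?L" if "y \<in> set (shifted l)" for y
  proof -
    from that obtain i where "i < length l" "y = shifted l ! i" by (auto simp: in_set_conv_nth)
    moreover from this have "l ! i \<le> x" using Cons.prems by simp
    ultimately show ?thesis by (simp add: nth_shifted)
  qed
  have row: "qfact q ?L = ?r * ?d" by (rule qfact_row_hooks) fact
  have "?r \<noteq> 0" "?d \<noteq> 0" using qfact_nonzero[OF q, of ?L] unfolding row by auto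
  have IH: "vand (map ((^) q) (shifted l)) / (\<Prod>y \<leftarrow> shifted l. qfact q y) =
    q ^ staircase_exp (length l) * hook_quot q l" using Cons by simp
  have "vand (map ((^) q) (shifted (x # l))) / (\<Prod>y \<leftarrow> shifted (x # l). qfact q y) =
      (\<Prod>y \<leftarrow> shifted l. q ^ y - q ^ ?L) / qfact q ?L *
      (vand (map ((^) q) (shifted l)) / (\<Prod>y \<leftarrow> shifted l. qfact q y))"
    by (simp add: o_def)
  also have "(\<Prod>y \<leftarrow> shifted l. q ^ y - q ^ ?L) = q ^ sum_list (shifted l) * ?d"
    by (rule prod_list_shift_diff) (rule le)
  also have "q ^ sum_list (shifted l) * ?d / qfact q ?L = q ^ sum_list (shifted l) / ?r"
    unfolding row using \<open>?d \<noteq> 0\<close> by simp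
  also note IH
  also have "q ^ sum_list (shifted l) / ?r * (q ^ staircase_exp (length l) * hook_quot q l) =
      q ^ staircase_exp (length (x # l)) * hook_quot q (x # l)"
    by (simp add: hook_quot_def sum_list_shifted power_add)
  finally show ?case .
qed (auto simp: hook_quot_def)

text \<open>The shapes obtained from \<open>l\<close> by removing a horizontal strip.\<close>
definition hstrips :: "nat list \<Rightarrow> nat list set" where
  "hstrips l = {m. length m = length l \<and>
     (\<forall>i<length l. (if Suc i < length l then l ! Suc i else 0) \<le> m ! i \<and> m ! i \<le> l ! i)}"

lemma sorted_hstrips:
  assumes "m \<in> hstrips l"
  shows "sorted_wrt (\<ge>) m"
proof -
  have "m ! Suc i \<le> m ! i" if "Suc i < length m" for i
  proof -
    have "l ! Suc i \<le> m ! i" "m ! Suc i \<le> l ! Suc i"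
      using assms that unfolding hstrips_def by (auto dest: spec[of _ i])
    thus ?thesis by simp
  qed
  thus ?thesis
    by (subst sorted_wrt_iff_nth_Suc_transp) (auto intro: transpI)
qed

lemma det_shifted:
  fixes q :: "'a::field"
  assumes q: "\<And>k. k > 0 \<Longrightarrow> q ^ k \<noteq> 1" and "sorted_wrt (\<ge>) l" and m: "length l = m"
  shows "Determinant.det (mat m m (\<lambda>(i, j). q ^ (shifted l ! i * j) / qfact q (shifted l ! i))) =
    q ^ staircase_exp m * hook_quot q l"
proof -
  have "Determinant.det (mat m m (\<lambda>(i, j). q ^ (shifted l ! i * j) / qfact q (shifted l ! i))) =
      Determinant.det (mat m m (\<lambda>(i, j). inverse (qfact q (shifted l ! i)) * (map ((^) q) (shifted l) ! i) ^ j))"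
    by (intro arg_cong[where f = Determinant.det] cong_mat)
       (auto simp: m power_mult divide_inverse)
  also have "\<dots> = (\<Prod>i = 0..<m. inverse (qfact q (shifted l ! i))) * vand (map ((^) q) (shifted l))"
    using det_vandermonde[of "map ((^) q) (shifted l)"] by (subst det_row_scale) (simp add: m)
  also have "(\<Prod>i = 0..<m. inverse (qfact q (shifted l ! i))) = inverse (\<Prod>y \<leftarrow> shifted l. qfact q y)"
    by (simp add: prod.list_conv_set_nth m prod_inversef[symmetric])
  finally show ?thesis using vand_shifted[OF q assms(2)] m by (simp add: field_simps)
qed

text \<open>In shifted coordinates the interlacing l_(i+1) <= a_i <= l_i becomes L_(i+1) < M_i <=
  L_i, and 0 <= M_i <= L_i in the last row, whose shift is 0. These are independent intervals, so
  the strips form a box as in \<open>det_box_sum\<close>.\<close>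

lemma bij_hstrips:
  assumes "sorted_wrt (\<ge>) l" and m: "length l = m"
  shows "bij_betw (\<lambda>a. restrict (\<lambda>i. shifted a ! i) {0..<m}) (hstrips l)
    (PiE {0..<m} (\<lambda>i. {(if Suc i < m then Suc (shifted l ! Suc i) else 0)..shifted l ! i}))"
proof (rule bij_betwI[where g = "\<lambda>M. map (\<lambda>i. M i - (m - 1 - i)) [0..<m]"])
  show "(\<lambda>a. restrict (\<lambda>i. shifted a ! i) {0..<m}) \<in> hstrips l \<rightarrow>
    (PiE {0..<m} (\<lambda>i. {(if Suc i < m then Suc (shifted l ! Suc i) else 0)..shifted l ! i}))"
    by (intro funcsetI restrict_PiE_iff[THEN iffD2])
       (fastforce simp: hstrips_def nth_shifted m)
  show "(\<lambda>M. map (\<lambda>i. M i - (m - 1 - i)) [0..<m]) \<in>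
    (PiE {0..<m} (\<lambda>i. {(if Suc i < m then Suc (shifted l ! Suc i) else 0)..shifted l ! i})) \<rightarrow> hstrips l"
  proof (intro funcsetI)
    fix M assume M: "M \<in> PiE {0..<m} (\<lambda>i. {(if Suc i < m then Suc (shifted l ! Suc i) else 0)..shifted l ! i})"
    have "(if Suc i < m then l ! Suc i else 0) \<le> M i - (m - 1 - i) \<and> M i - (m - 1 - i) \<le> l ! i" if "i < m" for i
      using PiE_mem[OF M, of i] that by (auto simp: nth_shifted m split: if_splits)
    thus "map (\<lambda>i. M i - (m - 1 - i)) [0..<m] \<in> hstrips l" by (simp add: hstrips_def m)
  qed
next
  fix a assume "a \<in> hstrips l"
  thus "map (\<lambda>i. restrict (\<lambda>i. shifted a ! i) {0..<m} i - (m - 1 - i)) [0..<m] = a"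
    by (intro nth_equalityI) (auto simp: hstrips_def m nth_shifted)
next
  fix M assume M: "M \<in> PiE {0..<m} (\<lambda>i. {(if Suc i < m then Suc (shifted l ! Suc i) else 0)..shifted l ! i})"
  have le: "m - 1 - i \<le> M i" if "i < m" for i
    using PiE_mem[OF M, of i] that by (auto simp: nth_shifted m split: if_splits)
  show "restrict (\<lambda>i. shifted (map (\<lambda>i. M i - (m - 1 - i)) [0..<m]) ! i) {0..<m} = M"
  proof (rule extensionalityI[of _ "{0..<m}"])
    fix i assume "i \<in> {0..<m}"
    thus "restrict (\<lambda>i. shifted (map (\<lambda>i. M i - (m - 1 - i)) [0..<m]) ! i) {0..<m} i = M i"
      using le[of i] by (simp add: nth_shifted del: diff_diff_left)
  qed (use M in \<open>auto simp: PiE_def\<close>)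
qed

lemma hook_quot_hstrips:
  fixes q :: "'a::field"
  assumes q: "\<And>k. k > 0 \<Longrightarrow> q ^ k \<noteq> 1" and q0: "q \<noteq> 0" and l: "sorted_wrt (\<ge>) l"
  shows "(\<Sum>a \<in> hstrips l. q ^ sum_list a * hook_quot q a) = hook_quot q l"
proof -
  define m where "m = length l"
  let ?L = "\<lambda>i. shifted l ! i"
  let ?P = "PiE {0..<m} (\<lambda>i. {(if Suc i < m then Suc (?L (Suc i)) else 0)..?L i})"
  let ?F = "\<lambda>M. (\<Prod>i = 0..<m. q ^ M i) * Determinant.det (mat m m (\<lambda>(i, j). q ^ (M i * j) / qfact q (M i)))"
  \<comment> \<open>On the side of \<open>l\<close> the first power comes from the column factors
    \<open>q ^ j\<close>, on the side of a strip from shifting its parts. The factor is thus common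
    and cancels.\<close>
  let ?c = "q ^ (\<Sum>j<m. j) * q ^ staircase_exp m"
  have "?c * hook_quot q l = (\<Prod>j = 0..<m. q ^ j) *
      Determinant.det (mat m m (\<lambda>(i, j). q ^ (?L i * j) / qfact q (?L i)))"
    using det_shifted[OF q l, of m] by (simp add: m_def power_sum lessThan_atLeast0)
  also have "\<dots> = (\<Sum>M \<in> ?P. ?F M)"
  proof (rule det_box_sum[OF q, symmetric])
    fix i assume "Suc i < m"
    thus "?L (Suc i) < ?L i" using sorted_ge_nth[OF l, of i "Suc i"] by (simp add: nth_shifted m_def)
  qed
  also have "\<dots> = (\<Sum>a \<in> hstrips l. ?F (restrict (\<lambda>i. shifted a ! i) {0..<m}))"
    by (rule sum.reindex_bij_betw[symmetric], rule bij_hstrips[OF l]) (simp add: m_def)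
  also have "\<dots> = (\<Sum>a \<in> hstrips l. ?c * (q ^ sum_list a * hook_quot q a))"
  proof (rule sum.cong)
    fix a assume a: "a \<in> hstrips l"
    have len: "length a = m" using a by (simp add: hstrips_def m_def)
    have "(\<Prod>i = 0..<m. q ^ restrict (\<lambda>i. shifted a ! i) {0..<m} i) = q ^ sum_list (shifted a)"
      by (simp add: power_sum sum_list_sum_nth len)
    also have "\<dots> = q ^ sum_list a * q ^ (\<Sum>j<m. j)"
      by (simp add: sum_list_shifted len power_add)
    finally have 1: "(\<Prod>i = 0..<m. q ^ restrict (\<lambda>i. shifted a ! i) {0..<m} i) =
      q ^ sum_list a * q ^ (\<Sum>j<m. j)" .
    have "mat m m (\<lambda>(i, j). q ^ (restrict (\<lambda>i. shifted a ! i) {0..<m} i * j) /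
          qfact q (restrict (\<lambda>i. shifted a ! i) {0..<m} i)) =
        mat m m (\<lambda>(i, j). q ^ (shifted a ! i * j) / qfact q (shifted a ! i))"
      by (rule cong_mat) auto
    thus "?F (restrict (\<lambda>i. shifted a ! i) {0..<m}) = ?c * (q ^ sum_list a * hook_quot q a)"
      using det_shifted[OF q sorted_hstrips[OF a] len] 1 by simp
  qed simp
  finally have "?c * hook_quot q l = ?c * (\<Sum>a \<in> hstrips l. q ^ sum_list a * hook_quot q a)"
    by (simp only: sum_distrib_left)
  thus ?thesis using q0 by simp
qed

text \<open>Here \<open>r\<close> is the topmost row that loses a cell; it corresponds to the row of
  the largest entry in a tableau.\<close>

definition hstrips_row :: "nat list \<Rightarrow> nat \<Rightarrow> nat list set" where
  "hstrips_row l r = {a \<in> hstrips l. (\<forall>i<r. a ! i = l ! i) \<and> a ! r < l ! r}"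

lemma finite_hstrips [simp]: "finite (hstrips l)"
proof (rule finite_subset)
  show "hstrips l \<subseteq> {a. set a \<subseteq> {..Max (set l)} \<and> length a = length l}"
  proof safe
    fix a x assume a: "a \<in> hstrips l" "x \<in> set a"
    then obtain i where "i < length l" "x = a ! i" by (auto simp: hstrips_def in_set_conv_nth)
    hence "x \<le> l ! i" "l ! i \<in> set l" using a by (auto simp: hstrips_def)
    thus "x \<le> Max (set l)" using Max_ge[of "set l" "l ! i"] by (metis List.finite_set le_trans)
  qed (auto simp: hstrips_def)
qed (rule finite_lists_length_eq, simp)

lemma hstrips_prefix_decompose:
  assumes "sorted_wrt (\<ge>) l"
  shows "{a \<in> hstrips l. \<forall>i<r. a ! i = l ! i} = insert l (\<Union>r' \<in> {r..<length l}. hstrips_row l r')"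
proof (intro equalityI subsetI)
  fix a assume a: "a \<in> {a \<in> hstrips l. \<forall>i<r. a ! i = l ! i}"
  show "a \<in> insert l (\<Union>r' \<in> {r..<length l}. hstrips_row l r')"
  proof (cases "a = l")
    case False
    have len: "length a = length l" using a by (simp add: hstrips_def)
    define r' where "r' = (LEAST i. i < length l \<and> a ! i \<noteq> l ! i)"
    have ex: "\<exists>i. i < length l \<and> a ! i \<noteq> l ! i" 
    proof (rule ccontr)
      assume "\<not> ?thesis"
      hence "a = l" using len by (intro nth_equalityI) auto
      with False show False by simp
    qed
    have r': "r' < length l" "a ! r' \<noteq> l ! r'" using LeastI_ex[OF ex] unfolding r'_def by blast+
    have "a ! i = l ! i" if "i < r'" for i
      using not_less_Least[OF that[unfolded r'_def]] r'(1) that by (meson less_trans)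
    moreover have "a ! r' \<le> l ! r'" using r'(1) a by (simp add: hstrips_def)
    with r'(2) have "a ! r' < l ! r'" by (rule le_neq_implies_less[rotated])
    moreover have "r \<le> r'" using a r'(2) not_le by blast
    ultimately show ?thesis
      using a r' by (intro insertI2 UN_I[of r']) (auto simp: hstrips_row_def)
  qed simp
next
  fix a assume "a \<in> insert l (\<Union>r' \<in> {r..<length l}. hstrips_row l r')"
  moreover have "l ! Suc i \<le> l ! i" if "Suc i < length l" for i
    using sorted_ge_nth[OF assms, of i "Suc i"] that by simp
  hence "l \<in> hstrips l" unfolding hstrips_def by simp
  ultimately show "a \<in> {a \<in> hstrips l. \<forall>i<r. a ! i = l ! i}"
    by (auto simp: hstrips_row_def)
qed

lemma hstrips_row_unique:
  assumes "a \<in> hstrips_row l r" "a \<in> hstrips_row l r'"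
  shows "r = r'"
proof (rule ccontr)
  assume "r \<noteq> r'"
  moreover have "\<not> r < r'" "\<not> r' < r"
    using assms unfolding hstrips_row_def by force+
  ultimately show False by simp
qed

lemma sum_hstrips_prefix:
  assumes "sorted_wrt (\<ge>) l"
  shows "(\<Sum>a | a \<in> hstrips l \<and> (\<forall>i<r. a ! i = l ! i). f a) =
    f l + (\<Sum>r' = r..<length l. \<Sum>a \<in> hstrips_row l r'. f a)"
proof -
  define U where "U = (\<Union>r' \<in> {r..<length l}. hstrips_row l r')"
  have fin: "finite (hstrips_row l r')" for r' by (simp add: hstrips_row_def)
  have disj: "hstrips_row l r' \<inter> hstrips_row l s = {}" if "r' \<noteq> s" for r' s
    using hstrips_row_unique that by blast
  have "l \<notin> U" by (auto simp: U_def hstrips_row_def)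
  moreover have "finite U" unfolding U_def using fin by blast
  ultimately have "sum f (insert l U) = f l + sum f U" by simp
  also have "sum f U = (\<Sum>r' = r..<length l. \<Sum>a \<in> hstrips_row l r'. f a)"
    unfolding U_def by (rule sum.UNION_disjoint) (simp_all add: fin disj)
  finally show ?thesis
    unfolding U_def hstrips_prefix_decompose[OF assms] .
qed

text \<open>A strip with topmost changed row \<open>r\<close> consists of the corner of that row and
  a strip of the smaller shape that leaves the rows above alone. Fixing those rows compensates for
  the lower bound of row \<open>r - 1\<close>, which the removal of the corner weakens.\<close>

lemma hstrips_row_corner:
  assumes l: "sorted_wrt (\<ge>) l" and c: "corner l r"
  shows "hstrips_row l r = {a \<in> hstrips (remove_corner l r). \<forall>i<r. a ! i = remove_corner l r ! i}"
proof (intro equalityI subsetI)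
  note nth = nth_remove_corner[OF l c]
  note len = length_remove_corner[OF l c]
  have r: "r < length l" using c by (simp add: corner_def)
  fix a assume a: "a \<in> hstrips_row l r"
  have "(if Suc i < length l then remove_corner l r ! Suc i else 0) \<le> a ! i \<and> a ! i \<le> remove_corner l r ! i"
    if i: "i < length l" for i
  proof -
    have "(if Suc i < length l then l ! Suc i else 0) \<le> a ! i" "a ! i \<le> l ! i" "a ! r < l ! r"
      using a i by (auto simp: hstrips_row_def hstrips_def)
    thus ?thesis using i by (auto simp: nth split: if_splits)
  qed
  hence "a \<in> hstrips (remove_corner l r)"
    using a unfolding hstrips_def hstrips_row_def len by blast
  moreover have "a ! i = remove_corner l r ! i" if "i < r" for i
    using a r that by (simp add: hstrips_row_def nth)
  ultimately show "a \<in> {a \<in> hstrips (remove_corner l r). \<forall>i<r. a ! i = remove_corner l r ! i}"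
    by blast
next
  note nth = nth_remove_corner[OF l c]
  note len = length_remove_corner[OF l c]
  have r: "r < length l" "0 < l ! r" using c by (simp_all add: corner_def)
  fix a assume a: "a \<in> {a \<in> hstrips (remove_corner l r). \<forall>i<r. a ! i = remove_corner l r ! i}"
  have low: "(if Suc i < length l then remove_corner l r ! Suc i else 0) \<le> a ! i"
    and up: "a ! i \<le> remove_corner l r ! i" if "i < length l" for i
    using a that by (auto simp: hstrips_def len)
  have eq: "a ! i = l ! i" if "i < r" for i
    using a that r by (auto simp: nth)
  have "(if Suc i < length l then l ! Suc i else 0) \<le> a ! i \<and> a ! i \<le> l ! i" if i: "i < length l" for i
  proof (cases "i < r")
    case True
    thus ?thesis using eq[OF True] sorted_ge_nth[OF l, of i "Suc i"] by auto
  next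
    case False
    thus ?thesis using low[OF i] up[OF i] i by (auto simp: nth split: if_splits)
  qed
  moreover have "length a = length l" using a by (simp add: hstrips_def len)
  moreover have "a ! r < l ! r" using up[OF r(1)] r by (simp add: nth)
  ultimately show "a \<in> hstrips_row l r"
    using eq unfolding hstrips_row_def hstrips_def by blast
qed

lemma hstrips_row_noncorner:
  assumes "sorted_wrt (\<ge>) l" "\<not> corner l r" "r < length l"
  shows "hstrips_row l r = {}"
  using assms by (force simp: hstrips_row_def hstrips_def corner_def)

lemma hook_quot_empty: "sum_list l = 0 \<Longrightarrow> hook_quot q l = 1"
proof -
  assume "sum_list l = 0"
  hence "hooks l = [] \<and> min_maj l = 0" by (induction l) auto
  thus ?thesis by (simp add: hook_quot_def)
qed

text \<open>The refinement by the row of the largest entry is what makes the induction go through.\<close>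
lemma maj_gf_hook_quot:
  fixes q :: "'a::field"
  assumes q: "\<And>k. k > 0 \<Longrightarrow> q ^ k \<noteq> 1" and q0: "q \<noteq> 0"
  shows "sorted_wrt (\<ge>) l \<Longrightarrow> maj_gf q l = qfact q (sum_list l) * hook_quot q l \<and>
    (0 < sum_list l \<longrightarrow> (\<forall>r<length l. maj_gf_row q l r =
      qfact q (sum_list l - 1) * (\<Sum>a \<in> hstrips_row l r. q ^ sum_list a * hook_quot q a)))"
proof (induction "sum_list l" arbitrary: l rule: less_induct)
  case less
  note l = less.prems
  let ?f = "\<lambda>a. q ^ sum_list a * hook_quot q a"
  show ?case
  proof (cases "sum_list l = 0")
    case True
    show ?thesis using maj_gf_empty[OF True, of q] hook_quot_empty[OF True, of q]
      unfolding True by simp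
  next
    case False
    define n where "n = sum_list l - 1"
    have n: "sum_list l = Suc n" using False unfolding n_def by linarith
    have row: "maj_gf_row q l r = qfact q n * (\<Sum>a \<in> hstrips_row l r. ?f a)" if r: "r < length l" for r
    proof (cases "corner l r")
      case False
      thus ?thesis using hstrips_row_noncorner[OF l False r] by (simp add: maj_gf_row_noncorner)
    next
      case c: True
      let ?l = "remove_corner l r"
      have sl: "sum_list ?l = n" using sum_list_remove_corner[OF l c] n by simp
      have srt: "sorted_wrt (\<ge>) ?l" by (rule sorted_remove_corner[OF l c])
      have lt: "sum_list ?l < sum_list l" using sl n by simp
      have IH: "maj_gf q ?l = qfact q n * hook_quot q ?l"
        using less.hyps[OF lt srt] sl by (simp only:)
      have IH_row: "maj_gf_row q ?l r' = qfact q (n - 1) * (\<Sum>a \<in> hstrips_row ?l r'. ?f a)"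
        if "0 < n" "r' < length l" for r'
        using less.hyps[OF lt srt] that unfolding sl length_remove_corner[OF l c] by blast
      have "(1 - q ^ n) * (\<Sum>r' = r..<length l. maj_gf_row q ?l r') =
          qfact q n * (\<Sum>r' = r..<length l. \<Sum>a \<in> hstrips_row ?l r'. ?f a)"
      proof (cases n)
        \<comment> \<open>The row-wise hypothesis requires \<open>0 < n\<close>. For
          \<open>n = 0\<close> both sides vanish: \<open>1 - q ^ 0\<close> is 0, and no strip can
          shorten a row of the empty shape.\<close>
        case 0
        have "hstrips_row ?l r' = {}" if "r' < length l" for r'
        proof -
          have "?l ! r' \<le> sum_list ?l"
            using that length_remove_corner[OF l c] by (intro elem_le_sum_list) simp
          hence "?l ! r' = 0" unfolding sl 0 by simp
          thus ?thesis unfolding hstrips_row_def by simp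
        qed
        thus ?thesis using 0 by simp
      next
        case (Suc n')
        have "(1 - q ^ n) * (\<Sum>r' = r..<length l. maj_gf_row q ?l r') =
          (1 - q ^ n) * (\<Sum>r' = r..<length l. qfact q n' * (\<Sum>a \<in> hstrips_row ?l r'. ?f a))"
          by (intro arg_cong2[where f = "(*)"] sum.cong refl, subst IH_row) (auto simp: Suc)
        also have "\<dots> = ((1 - q ^ n) * qfact q n') * (\<Sum>r' = r..<length l. \<Sum>a \<in> hstrips_row ?l r'. ?f a)"
          by (simp only: sum_distrib_left mult.assoc)
        also have "(1 - q ^ n) * qfact q n' = qfact q n" using Suc by (simp add: qfact_Suc)
        finally show ?thesis .
      qed
      hence "maj_gf_row q l r = qfact q n * (\<Sum>r' = r..<length l. \<Sum>a \<in> hstrips_row ?l r'. ?f a) +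
          q ^ n * (qfact q n * hook_quot q ?l)"
        using maj_gf_row_rec[OF l c, of q] IH n by simp
      \<comment> \<open>The summand with \<open>q ^ n\<close> is the term of the empty strip,
        \<open>a = ?l\<close>, in a sum over strips.\<close>
      also have "\<dots> = qfact q n * (?f ?l + (\<Sum>r' = r..<length ?l. \<Sum>a \<in> hstrips_row ?l r'. ?f a))"
        using sl length_remove_corner[OF l c] by (simp add: algebra_simps)
      also have "?f ?l + (\<Sum>r' = r..<length ?l. \<Sum>a \<in> hstrips_row ?l r'. ?f a) = (\<Sum>a \<in> hstrips_row l r. ?f a)"
        unfolding hstrips_row_corner[OF l c] by (rule sum_hstrips_prefix[OF srt, symmetric])
      finally show ?thesis .
    qed
    have "maj_gf q l = (\<Sum>r<length l. qfact q n * (\<Sum>a \<in> hstrips_row l r. ?f a))"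
      using maj_gf_eq_sum_rows[of l q] n row by simp
    also have "\<dots> = qfact q n * (\<Sum>r = 0..<length l. \<Sum>a \<in> hstrips_row l r. ?f a)"
      by (simp add: sum_distrib_left lessThan_atLeast0)
    \<comment> \<open>Over all rows these are the strips of \<open>l\<close> except \<open>l\<close>
      itself; taking that term out of \<open>hook_quot_hstrips\<close> produces the factor
      \<open>1 - q ^ Suc n\<close>.\<close>
    also have "(\<Sum>r = 0..<length l. \<Sum>a \<in> hstrips_row l r. ?f a) = (\<Sum>a \<in> hstrips l. ?f a) - ?f l"
      using sum_hstrips_prefix[OF l, of ?f 0] by simp
    also have "(\<Sum>a \<in> hstrips l. ?f a) = hook_quot q l"
      by (rule hook_quot_hstrips[OF q q0 l])
    also have "qfact q n * (hook_quot q l - ?f l) = qfact q (Suc n) * hook_quot q l"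
      using n by (simp add: qfact_Suc algebra_simps)
    finally show ?thesis using row n by simp
  qed
qed

lemma q_hook_formula:
  fixes q :: "'a::field"
  assumes q: "\<And>k. k > 0 \<Longrightarrow> q ^ k \<noteq> 1" and q0: "q \<noteq> 0" and l: "sorted_wrt (\<ge>) l"
  shows "maj_gf q l * (\<Prod>h \<leftarrow> hooks l. 1 - q ^ h) = q ^ min_maj l * qfact q (sum_list l)"
  using maj_gf_hook_quot[OF q q0 l] prod_hooks_nonzero[OF q, of l] by (simp add: hook_quot_def)

section \<open>Estimates for sums over hooks\<close>

text \<open>Formulated for a set of cells, where the symmetry under transposition is immediate;
  \<open>mset_hooks\<close> carries it over to the recursive list.\<close>

definition hook_length :: "(nat \<times> nat) set \<Rightarrow> nat \<times> nat \<Rightarrow> nat" where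
  "hook_length D x = card {c. snd x < c \<and> (fst x, c) \<in> D} + card {r. fst x < r \<and> (r, snd x) \<in> D} + 1"

lemma diagram_Cons: "diagram (x # l) = Pair 0 ` {..<x} \<union> map_prod Suc id ` diagram l"
proof (intro equalityI subsetI)
  fix z assume "z \<in> diagram (x # l)"
  thus "z \<in> Pair 0 ` {..<x} \<union> map_prod Suc id ` diagram l"
    by (cases z; cases "fst z") (auto simp: diagram_def map_prod_def image_iff)
qed (auto simp: diagram_def)

lemma hook_length_row0:
  assumes "c < x"
  shows "hook_length (diagram (x # l)) (0, c) = x - c + length (filter (\<lambda>p. c < p) l)"
proof -
  have "{c'. c < c' \<and> (0, c') \<in> diagram (x # l)} = {c<..<x}"
    by (auto simp: diagram_def)
  moreover have "{r. 0 < r \<and> (r, c) \<in> diagram (x # l)} = Suc ` {r. r < length l \<and> c < l ! r}"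
  proof (intro equalityI subsetI)
    fix r assume "r \<in> {r. 0 < r \<and> (r, c) \<in> diagram (x # l)}"
    thus "r \<in> Suc ` {r. r < length l \<and> c < l ! r}" by (cases r) (auto simp: diagram_def)
  qed (auto simp: diagram_def)
  ultimately show ?thesis
    using assms by (simp add: hook_length_def card_image length_filter_conv_card)
qed

lemma hook_length_Suc: "hook_length (diagram (x # l)) (Suc r, c) = hook_length (diagram l) (r, c)"
proof -
  have "{c'. c < c' \<and> (Suc r, c') \<in> diagram (x # l)} = {c'. c < c' \<and> (r, c') \<in> diagram l}"
    by (auto simp: diagram_def)
  moreover have "{s. Suc r < s \<and> (s, c) \<in> diagram (x # l)} = Suc ` {s. r < s \<and> (s, c) \<in> diagram l}"
  proof (intro equalityI subsetI)
    fix s assume "s \<in> {s. Suc r < s \<and> (s, c) \<in> diagram (x # l)}"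
    thus "s \<in> Suc ` {s. r < s \<and> (s, c) \<in> diagram l}" by (cases s) (auto simp: diagram_def)
  qed (auto simp: diagram_def)
  ultimately show ?thesis by (simp add: hook_length_def card_image)
qed

lemma mset_hooks: "mset (hooks l) = image_mset (hook_length (diagram l)) (mset_set (diagram l))"
proof (induction l)
  case (Cons x l)
  have "mset_set (diagram (x # l)) =
      image_mset (Pair 0) (mset_set {..<x}) + image_mset (map_prod Suc id) (mset_set (diagram l))"
  proof -
    have "inj (map_prod Suc id)" by (auto simp: inj_on_def)
    hence "image_mset (map_prod Suc id) (mset_set (diagram l)) = mset_set (map_prod Suc id ` diagram l)"
      by (intro image_mset_mset_set) (rule inj_on_subset, auto)
    moreover have "image_mset (Pair (0 :: nat)) (mset_set {..<x}) = mset_set (Pair 0 ` {..<x})"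
      by (intro image_mset_mset_set) (auto simp: inj_on_def)
    moreover have "mset_set (Pair 0 ` {..<x} \<union> map_prod Suc id ` diagram l) =
        mset_set (Pair 0 ` {..<x}) + mset_set (map_prod Suc id ` diagram l)"
      by (rule mset_set_Union) auto
    ultimately show ?thesis unfolding diagram_Cons by (simp only:)
  qed
  moreover have "image_mset (\<lambda>c. hook_length (diagram (x # l)) (0, c)) (mset_set {..<x}) =
      mset (map (\<lambda>c. x - c + length (filter (\<lambda>p. c < p) l)) [0..<x])"
  proof -
    have "image_mset (\<lambda>c. hook_length (diagram (x # l)) (0, c)) (mset_set {..<x}) =
        image_mset (\<lambda>c. x - c + length (filter (\<lambda>p. c < p) l)) (mset_set {..<x})"
      by (intro image_mset_cong) (simp add: hook_length_row0)
    thus ?thesis by (simp add: lessThan_atLeast0)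
  qed
  moreover have "image_mset (\<lambda>z. hook_length (diagram (x # l)) (map_prod Suc id z)) (mset_set (diagram l)) =
      image_mset (hook_length (diagram l)) (mset_set (diagram l))"
    by (intro image_mset_cong) (auto simp: hook_length_Suc)
  ultimately show ?case
    using Cons by (simp add: image_mset.compositionality o_def)
qed (simp add: diagram_def)

lemma length_hooks: "length (hooks l) = sum_list l"
  by (induction l) auto

section \<open>Conjugate partitions and the longest line\<close>

lemma is_partition_sorted: "is_partition l \<Longrightarrow> sorted_wrt (\<ge>) l"
  by (simp add: is_partition_def)

lemma first_part_nth: "l \<noteq> [] \<Longrightarrow> first_part l = l ! 0"
  by (cases l) (auto simp: first_part_def)

lemma nth_le_first_part: "sorted_wrt (\<ge>) l \<Longrightarrow> i < length l \<Longrightarrow> l ! i \<le> first_part l"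
  using sorted_ge_nth[of l 0 i] by (cases l) (auto simp: first_part_def)

text \<open>\<open>conjugate\<close> alone would refer to the complex conjugation of the matrix library.\<close>
lemma first_part_conjugate:
  assumes "is_partition l"
  shows "first_part (Defs.conjugate l) = length l"
proof (cases l)
  case (Cons x l')
  hence "x > 0" using assms by (auto simp: is_partition_def)
  hence "first_part (Defs.conjugate l) = length (filter (\<lambda>p. 0 < p) l)"
    using Cons by (subst first_part_nth) (auto simp: Defs.conjugate_def first_part_def)
  also have "filter (\<lambda>p. 0 < p) l = l" using assms by (auto simp: is_partition_def)
  finally show ?thesis .
qed (simp add: Defs.conjugate_def first_part_def)

lemma length_conjugate: "length (Defs.conjugate l) = first_part l"
  by (simp add: Defs.conjugate_def)

lemma diagram_conjugate:
  assumes "sorted_wrt (\<ge>) l"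
  shows "diagram (Defs.conjugate l) = prod.swap ` diagram l"
proof -
  have "(r, c) \<in> diagram (Defs.conjugate l) \<longleftrightarrow> (c, r) \<in> diagram l" for r c
  proof
    assume "(r, c) \<in> diagram (Defs.conjugate l)"
    hence 1: "c < length (filter (\<lambda>p. r < p) l)" by (auto simp: diagram_def Defs.conjugate_def)
    hence "c < length l" using length_filter_le[of "\<lambda>p. r < p" l] by linarith
    with 1 show "(c, r) \<in> diagram l" using less_length_filter_iff[OF assms, of c r] by (simp add: diagram_def)
  next
    assume "(c, r) \<in> diagram l"
    thus "(r, c) \<in> diagram (Defs.conjugate l)"
      using less_length_filter_iff[OF assms, of c r] nth_le_first_part[OF assms, of c]
      by (simp add: diagram_def Defs.conjugate_def)
  qed
  moreover have "(r, c) \<in> prod.swap ` diagram l \<longleftrightarrow> (c, r) \<in> diagram l" for r c by force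
  ultimately show ?thesis by auto
qed

lemma is_partition_conjugate:
  assumes "is_partition l"
  shows "is_partition (Defs.conjugate l)"
proof (cases l)
  case (Cons x l')
  have "sorted_wrt (\<ge>) (Defs.conjugate l)"
    by (auto simp: sorted_ge_iff_nth Defs.conjugate_def intro: length_filter_antimono)
  moreover have "0 < length (filter (\<lambda>p. j < p) l)" if "j < first_part l" for j
    using that Cons by (simp add: first_part_def)
  ultimately show ?thesis by (auto simp: is_partition_def Defs.conjugate_def)
qed (simp add: Defs.conjugate_def first_part_def is_partition_def)

lemma sum_list_conjugate: "sorted_wrt (\<ge>) l \<Longrightarrow> sum_list (Defs.conjugate l) = sum_list l"
  by (simp add: card_diagram[symmetric] diagram_conjugate card_image)

lemma mset_hooks_conjugate:
  assumes "sorted_wrt (\<ge>) l"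
  shows "mset (hooks (Defs.conjugate l)) = mset (hooks l)"
proof -
  have "hook_length (prod.swap ` D) (prod.swap z) = hook_length D z" for D z
  proof -
    have "(a, b) \<in> prod.swap ` D \<longleftrightarrow> (b, a) \<in> D" for a b by force
    thus ?thesis by (simp add: hook_length_def)
  qed
  thus ?thesis
    unfolding mset_hooks diagram_conjugate[OF assms]
    by (simp add: image_mset_mset_set[symmetric] image_mset.compositionality o_def)
qed

text \<open>Passing to the conjugate if necessary, the first row may be assumed to be the longest line.\<close>
lemma wide_partition:
  assumes "is_partition l"
  obtains l' where "is_partition l'" "mset (hooks l') = mset (hooks l)" "sum_list l' = sum_list l"
    "length l' \<le> first_part l'" "aft l = sum_list l - first_part l'"
proof (cases "length l \<le> first_part l")
  case True
  thus ?thesis using assms by (intro that[of l]) (auto simp: aft_def first_part_conjugate max_def)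
next
  case False
  note s = is_partition_sorted[OF assms]
  show ?thesis
    using False assms
    by (intro that[of "Defs.conjugate l"])
       (auto simp: aft_def first_part_conjugate max_def is_partition_conjugate
         mset_hooks_conjugate[OF s] sum_list_conjugate[OF s] length_conjugate)
qed

section \<open>Comparison of the hooks with 1, ..., n\<close>

lemma sum_list_map_cong_mset:
  fixes f :: "'a \<Rightarrow> 'b::comm_monoid_add"
  shows "mset xs = mset ys \<Longrightarrow> sum_list (map f xs) = sum_list (map f ys)"
  by (metis mset_map sum_mset_sum_list)

lemma sum_list_upt_eq: "(\<Sum>c \<leftarrow> [a..<b]. f c) = (\<Sum>c = a..<b. f c)"
  by (simp add: interv_sum_list_conv_sum_set_nat)

lemma length_filter_le_sum_list: "length (filter (\<lambda>p. c < p) l) \<le> sum_list (l :: nat list)"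
  by (induction l) auto

lemma sum_reverse_shift:
  fixes G :: "nat \<Rightarrow> 'a::comm_monoid_add"
  shows "(\<Sum>c = 0..<x. G (x - c + s)) = (\<Sum>k = Suc s..s + x. G k)"
proof -
  have "(\<Sum>c = 0..<x. G (x - c + s)) = (\<Sum>k \<in> {Suc s..s + x}. G k)"
    by (rule sum.reindex_bij_witness[where i = "\<lambda>k. s + x - k" and j = "\<lambda>c. x - c + s"]) auto
  thus ?thesis .
qed

text \<open>A hook of the first row is at most \<open>x - c\<close> plus the number of cells below
  that row, and these bounds run through the \<open>x\<close> largest of the numbers 1, ..., n. The
  lower rows are covered by induction.\<close>

lemma sum_hooks_upper:
  fixes G :: "nat \<Rightarrow> real"
  assumes "\<And>i j. i \<le> j \<Longrightarrow> j \<le> sum_list l \<Longrightarrow> G i \<le> G j"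
  shows "(\<Sum>h \<leftarrow> hooks l. G h) \<le> (\<Sum>k = 1..sum_list l. G k)"
  using assms
proof (induction l)
  case (Cons x l)
  have "(\<Sum>h \<leftarrow> map (\<lambda>c. x - c + length (filter (\<lambda>p. c < p) l)) [0..<x]. G h) =
      (\<Sum>c = 0..<x. G (x - c + length (filter (\<lambda>p. c < p) l)))"
    by (simp add: o_def sum_list_upt_eq)
  also have "\<dots> \<le> (\<Sum>c = 0..<x. G (x - c + sum_list l))"
    by (intro sum_mono Cons.prems add_left_mono length_filter_le_sum_list) auto
  also have "\<dots> = (\<Sum>k = Suc (sum_list l)..sum_list l + x. G k)"
    by (rule sum_reverse_shift)
  finally have 1: "(\<Sum>h \<leftarrow> map (\<lambda>c. x - c + length (filter (\<lambda>p. c < p) l)) [0..<x]. G h) \<le>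
    (\<Sum>k = Suc (sum_list l)..sum_list l + x. G k)" .
  have 2: "(\<Sum>h \<leftarrow> hooks l. G h) \<le> (\<Sum>k = 1..sum_list l. G k)"
    by (rule Cons.IH) (simp add: Cons.prems)
  have "{1..sum_list (x # l)} = {1..sum_list l} \<union> {Suc (sum_list l)..sum_list l + x}" by auto
  hence "(\<Sum>k = 1..sum_list (x # l). G k) =
      (\<Sum>k = 1..sum_list l. G k) + (\<Sum>k = Suc (sum_list l)..sum_list l + x. G k)"
    by (simp only:) (rule sum.union_disjoint, auto)
  with 1 2 show ?case by simp
qed simp

lemma hooks_le_sum_list: "h \<in> set (hooks l) \<Longrightarrow> h \<le> sum_list l"
proof (induction l)
  case (Cons x l)
  show ?case
  proof (cases "h \<in> set (hooks l)")
    case False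
    with Cons.prems obtain c where "c < x" "h = x - c + length (filter (\<lambda>p. c < p) l)" by auto
    thus ?thesis using length_filter_le_sum_list[of c l] by simp
  qed (use Cons in auto)
qed simp

text \<open>The hooks of the first row dominate the numbers \<open>x - c\<close>, that is 1, ..., x,
  and the other hooks contribute nonnegative terms. Each of the remaining n - x numbers costs at
  most \<open>G n\<close>.\<close>

lemma sum_hooks_lower:
  fixes G :: "nat \<Rightarrow> real"
  assumes mono: "\<And>i j. i \<le> j \<Longrightarrow> j \<le> sum_list l \<Longrightarrow> G i \<le> G j"
    and nonneg: "\<And>i. i \<le> sum_list l \<Longrightarrow> 0 \<le> G i"
  shows "(\<Sum>k = 1..sum_list l. G k) - (\<Sum>h \<leftarrow> hooks l. G h) \<le>
    real (sum_list l - first_part l) * G (sum_list l)"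
proof (cases l)
  case (Cons x m)
  let ?n = "sum_list l"
  have "(\<Sum>k = 1..x. G k) = (\<Sum>c = 0..<x. G (x - c))"
    using sum_reverse_shift[of G x 0] by simp
  also have "\<dots> \<le> (\<Sum>c = 0..<x. G (x - c + length (filter (\<lambda>p. c < p) m)))"
  proof (intro sum_mono mono)
    fix c assume "c \<in> {0..<x}"
    thus "x - c + length (filter (\<lambda>p. c < p) m) \<le> sum_list l"
      using length_filter_le_sum_list[of c m] Cons by simp
  qed simp
  also have "\<dots> = (\<Sum>h \<leftarrow> map (\<lambda>c. x - c + length (filter (\<lambda>p. c < p) m)) [0..<x]. G h)"
    by (simp add: o_def sum_list_upt_eq)
  also have "\<dots> \<le> (\<Sum>h \<leftarrow> hooks l. G h)"
  proof -
    have "0 \<le> (\<Sum>h \<leftarrow> hooks m. G h)"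
      by (intro sum_list_nonneg) (use nonneg hooks_le_sum_list[of _ m] Cons in force)
    thus ?thesis using Cons by simp
  qed
  finally have 1: "(\<Sum>k = 1..x. G k) \<le> (\<Sum>h \<leftarrow> hooks l. G h)" .
  have "{1..?n} = {1..x} \<union> {Suc x..?n}" using Cons by auto
  hence "(\<Sum>k = 1..?n. G k) = (\<Sum>k = 1..x. G k) + (\<Sum>k = Suc x..?n. G k)"
    by (simp only:) (rule sum.union_disjoint, auto)
  moreover have "(\<Sum>k = Suc x..?n. G k) \<le> (\<Sum>k = Suc x..?n. G ?n)"
    by (intro sum_mono mono) auto
  ultimately show ?thesis using 1 Cons by (simp add: first_part_def)
qed simp

text \<open>This is 12 times the variance of the major index, see \<open>sum_maj_deviation_squared\<close>.\<close>
definition hook_defect :: "nat list \<Rightarrow> real" where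
  "hook_defect l = (\<Sum>k = 1..sum_list l. (real k)\<^sup>2) - (\<Sum>h \<leftarrow> hooks l. (real h)\<^sup>2)"

section \<open>Lower bound for the variance\<close>

lemma sum_squares_closed: "(\<Sum>k = 1..n. (real k)\<^sup>2) = real n * (real n + 1) * (2 * real n + 1) / 6"
  by (induction n) (auto simp: field_simps power2_eq_square)

text \<open>The cells of \<open>l\<close> are counted by columns.\<close>

lemma sum_filter_counts:
  assumes "\<And>p. p \<in> set l \<Longrightarrow> p \<le> x"
  shows "(\<Sum>c = 0..<x. length (filter (\<lambda>p. c < p) l)) = sum_list l"
  using assms
proof (induction l)
  case (Cons y l)
  have "(\<Sum>c = 0..<x. length (filter (\<lambda>p. c < p) (y # l))) =
     (\<Sum>c = 0..<x. (if c < y then 1 else 0)) + (\<Sum>c = 0..<x. length (filter (\<lambda>p. c < p) l))"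
    by (subst sum.distrib[symmetric]) (auto intro!: sum.cong)
  also have "(\<Sum>c = 0..<x. (if c < y then 1 else 0 :: nat)) = y"
    using Cons.prems[of y] by (subst sum.If_cases) (auto simp: min_def Collect_conj_eq[symmetric]
      intro!: arg_cong[where f = card, of _ "{..<y}", simplified])
  finally show ?case using Cons by simp
qed simp

lemma hooks_le_width_height: "sorted_wrt (\<ge>) l \<Longrightarrow> h \<in> set (hooks l) \<Longrightarrow> h \<le> first_part l + length l"
proof (induction l)
  case (Cons x l)
  show ?case
  proof (cases "h \<in> set (hooks l)")
    case True
    moreover have "first_part l \<le> x" using Cons.prems by (cases l) (auto simp: first_part_def)
    ultimately show ?thesis using Cons by (simp add: first_part_def)
  next
    case False
    with Cons.prems obtain c where "c < x" "h = x - c + length (filter (\<lambda>p. c < p) l)" by auto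
    thus ?thesis using length_filter_le[of "\<lambda>p. c < p" l] by (simp add: first_part_def del: length_filter_le)
  qed
qed simp

text \<open>Let \<open>e c\<close> be the legs of the first row and \<open>a\<close> the number of
  cells below it. Since the height is at most the width, 2 (x - c) + e <= 3 x - 1, so the legs
  increase the sum of squares of the first row by at most (3 x - 1) a; the lower rows have at most
  1^2 + ... + a^2. What is left is a (x^2 + x a - 2 x + 1).\<close>

lemma hook_defect_ge_first_part:
  assumes "sorted_wrt (\<ge>) l" "length l \<le> first_part l"
  shows "hook_defect l \<ge> real (sum_list l - first_part l) * (real (first_part l))\<^sup>2 / 2"
proof (cases l)
  case (Cons x m)
  define a where "a = sum_list m"
  define e where "e = (\<lambda>c. length (filter (\<lambda>p. c < p) m))"
  have le: "\<And>p. p \<in> set m \<Longrightarrow> p \<le> x" and len: "length m + 1 \<le> x"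
    using assms Cons by (auto simp: first_part_def)
  have sum_e: "(\<Sum>c = 0..<x. e c) = a" unfolding e_def a_def by (rule sum_filter_counts) (rule le)
  have e_le: "e c + 1 \<le> x" for c using length_filter_le[of "\<lambda>p. c < p" m] len unfolding e_def by linarith
  have "(real (x - c + e c))\<^sup>2 \<le> (real (x - c))\<^sup>2 + (3 * real x - 1) * real (e c)" if "c < x" for c
  proof -
    have "(real (x - c + e c))\<^sup>2 = (real (x - c))\<^sup>2 + (2 * real (x - c) + real (e c)) * real (e c)"
      by (simp add: power2_eq_square algebra_simps)
    also have "(2 * real (x - c) + real (e c)) * real (e c) \<le> (3 * real x - 1) * real (e c)"
      using e_le[of c] by (intro mult_right_mono) auto
    finally show ?thesis by simp
  qed
  hence "(\<Sum>c = 0..<x. (real (x - c + e c))\<^sup>2) \<le> (\<Sum>c = 0..<x. (real (x - c))\<^sup>2 + (3 * real x - 1) * real (e c))"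
    by (intro sum_mono) auto
  also have "\<dots> = (\<Sum>k = 1..x. (real k)\<^sup>2) + (3 * real x - 1) * real a"
    using sum_reverse_shift[of "\<lambda>k. (real k)\<^sup>2" x 0] sum_e[symmetric]
    by (simp add: sum.distrib sum_distrib_left[symmetric])
  finally have row: "(\<Sum>c = 0..<x. (real (x - c + e c))\<^sup>2) \<le> (\<Sum>k = 1..x. (real k)\<^sup>2) + (3 * real x - 1) * real a" .
  have rest: "(\<Sum>h \<leftarrow> hooks m. (real h)\<^sup>2) \<le> (\<Sum>k = 1..a. (real k)\<^sup>2)"
    unfolding a_def by (rule sum_hooks_upper) (auto intro: power_mono)
  have "hook_defect l = (\<Sum>k = 1..x + a. (real k)\<^sup>2) - (\<Sum>c = 0..<x. (real (x - c + e c))\<^sup>2) - (\<Sum>h \<leftarrow> hooks m. (real h)\<^sup>2)"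
    unfolding hook_defect_def Cons by (simp add: o_def sum_list_upt_eq a_def e_def del: of_nat_add)
  hence "hook_defect l \<ge> (\<Sum>k = 1..x + a. (real k)\<^sup>2) - (\<Sum>k = 1..x. (real k)\<^sup>2) - (3 * real x - 1) * real a - (\<Sum>k = 1..a. (real k)\<^sup>2)"
    using row rest by simp
  moreover have "(\<Sum>k = 1..x + a. (real k)\<^sup>2) - (\<Sum>k = 1..x. (real k)\<^sup>2) - (3 * real x - 1) * real a - (\<Sum>k = 1..a. (real k)\<^sup>2) =
      real a * ((real x)\<^sup>2 + real x * real a - 2 * real x + 1)"
    unfolding sum_squares_closed by (simp add: field_simps power2_eq_square)
  moreover have "real a * ((real x)\<^sup>2 + real x * real a - 2 * real x + 1) \<ge> real a * ((real x)\<^sup>2 / 2)"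
  proof (cases "a = 0")
    case False
    hence "real x * real a \<ge> real x * 1" by (intro mult_left_mono) auto
    moreover have "(real x - 1)\<^sup>2 \<ge> 0" by simp
    hence "(real x)\<^sup>2 / 2 - real x + 1 \<ge> 0" by (simp add: power2_eq_square algebra_simps)
    ultimately have "(real x)\<^sup>2 + real x * real a - 2 * real x + 1 \<ge> (real x)\<^sup>2 / 2" by linarith
    thus ?thesis by (intro mult_left_mono) auto
  qed simp
  ultimately show ?thesis using Cons by (simp add: first_part_def a_def)
qed (simp add: hook_defect_def)

text \<open>If n <= 4 x, the preceding bound applies, and 32 = 2 * 4^2. Otherwise every hook is at
  most 2 x < n / 2, so the squared hooks add up to at most n^3 / 4, whereas 1^2 + ... + n^2 is at
  least n^3 / 3; the difference n^3 / 12 is more than enough.\<close>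

lemma hook_defect_lower_wide:
  assumes "sorted_wrt (\<ge>) l" "length l \<le> first_part l"
  shows "hook_defect l \<ge> real (sum_list l - first_part l) * (real (sum_list l))\<^sup>2 / 32"
proof -
  let ?x = "first_part l" and ?n = "sum_list l"
  show ?thesis
  proof (cases "4 * ?x \<ge> ?n")
    case True
    hence "(real ?n)\<^sup>2 \<le> (4 * real ?x)\<^sup>2" by (intro power_mono) auto
    hence "real (?n - ?x) * (real ?n)\<^sup>2 / 32 \<le> real (?n - ?x) * (4 * real ?x)\<^sup>2 / 32"
      by (intro divide_right_mono mult_left_mono) auto
    also have "\<dots> = real (?n - ?x) * (real ?x)\<^sup>2 / 2" by (simp add: power2_eq_square)
    also have "\<dots> \<le> hook_defect l" by (rule hook_defect_ge_first_part[OF assms])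
    finally show ?thesis .
  next
    case False
    have "(\<Sum>h \<leftarrow> hooks l. (real h)\<^sup>2) \<le> (\<Sum>h \<leftarrow> hooks l. (real ?n / 2)\<^sup>2)"
    proof (intro sum_list_mono power_mono)
      fix h assume "h \<in> set (hooks l)"
      hence "h \<le> 2 * ?x" using hooks_le_width_height[OF assms(1)] assms(2) by fastforce
      thus "real h \<le> real ?n / 2" using False by linarith
    qed auto
    also have "\<dots> = real ?n * (real ?n)\<^sup>2 / 4"
      by (simp add: sum_list_triv length_hooks power2_eq_square)
    finally have 1: "(\<Sum>h \<leftarrow> hooks l. (real h)\<^sup>2) \<le> real ?n * (real ?n)\<^sup>2 / 4" .
    have "(\<Sum>k = 1..?n. (real k)\<^sup>2) \<ge> real ?n * (real ?n)\<^sup>2 / 3"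
      unfolding sum_squares_closed by (simp add: field_simps power2_eq_square)
    with 1 have "hook_defect l \<ge> real ?n * (real ?n)\<^sup>2 / 12" by (simp add: hook_defect_def)
    moreover have "real ?n * (real ?n)\<^sup>2 / 12 \<ge> real (?n - ?x) * (real ?n)\<^sup>2 / 32"
      by (intro frac_le mult_right_mono) auto
    ultimately show ?thesis by linarith
  qed
qed

lemma hook_defect_cong: "mset (hooks l) = mset (hooks l') \<Longrightarrow> sum_list l = sum_list l' \<Longrightarrow> hook_defect l = hook_defect l'"
  unfolding hook_defect_def using sum_list_map_cong_mset[of "hooks l" "hooks l'" "\<lambda>h. (real h)\<^sup>2"] by simp

lemma hook_defect_lower:
  assumes "is_partition l"
  shows "hook_defect l \<ge> real (aft l) * (real (sum_list l))\<^sup>2 / 32"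
proof -
  obtain l' where l': "is_partition l'" "mset (hooks l') = mset (hooks l)" "sum_list l' = sum_list l"
    "length l' \<le> first_part l'" "aft l = sum_list l - first_part l'"
    using wide_partition[OF assms] .
  show ?thesis
    using hook_defect_lower_wide[OF is_partition_sorted[OF l'(1)] l'(4)] hook_defect_cong[OF l'(2,3)] l'(3,5)
    by simp
qed

lemma sum_hooks_sandwich:
  fixes G :: "nat \<Rightarrow> real"
  assumes "is_partition l"
    and mono: "\<And>i j. i \<le> j \<Longrightarrow> j \<le> sum_list l \<Longrightarrow> G i \<le> G j"
    and nonneg: "\<And>i. i \<le> sum_list l \<Longrightarrow> 0 \<le> G i"
  shows "0 \<le> (\<Sum>k = 1..sum_list l. G k) - (\<Sum>h \<leftarrow> hooks l. G h)"
    and "(\<Sum>k = 1..sum_list l. G k) - (\<Sum>h \<leftarrow> hooks l. G h) \<le> real (aft l) * G (sum_list l)"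
proof -
  show "0 \<le> (\<Sum>k = 1..sum_list l. G k) - (\<Sum>h \<leftarrow> hooks l. G h)"
    using sum_hooks_upper[of l G] mono by simp
  obtain l' where l': "is_partition l'" "mset (hooks l') = mset (hooks l)" "sum_list l' = sum_list l"
    "length l' \<le> first_part l'" "aft l = sum_list l - first_part l'"
    using wide_partition[OF assms(1)] .
  show "(\<Sum>k = 1..sum_list l. G k) - (\<Sum>h \<leftarrow> hooks l. G h) \<le> real (aft l) * G (sum_list l)"
    using sum_hooks_lower[of l' G] mono nonneg l'(3,5) sum_list_map_cong_mset[OF l'(2), of G] by simp
qed

text \<open>No part of \<open>m\<close> exceeds M, so from column index M on the legs of the top row
  vanish and its hooks are x - M, ..., 1.\<close>

lemma mset_hooks_long_row:
  assumes "sum_list m = M" "M \<le> x"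
  shows "mset (hooks (x # m)) = mset (map (\<lambda>c. x - c + length (filter (\<lambda>p. c < p) m)) [0..<M]) +
    mset [1..<Suc (x - M)] + mset (hooks m)"
proof -
  let ?h = "\<lambda>c. x - c + length (filter (\<lambda>p. c < p) m)"
  have "[0..<x] = [0..<M] @ [M..<x]" using assms(2) upt_add_eq_append[of 0 M "x - M"] by simp
  hence "map ?h [0..<x] = map ?h [0..<M] @ map ?h [M..<x]" by (metis map_append)
  moreover have "map ?h [M..<x] = rev [1..<Suc (x - M)]"
  proof (rule nth_equalityI)
    fix i assume i: "i < length (map ?h [M..<x])"
    have "length (filter (\<lambda>p. M + i < p) m) = 0"
      using assms(1) member_le_sum_list[of _ m] by (fastforce simp: filter_empty_conv)
    thus "map ?h [M..<x] ! i = rev [1..<Suc (x - M)] ! i"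
      using i by (simp add: rev_nth del: upt_Suc)
  qed (simp del: upt_Suc)
  ultimately show ?thesis by (simp del: upt_Suc)
qed

section \<open>The characteristic function of the major index\<close>

text \<open>The characteristic function of the uniform law on [-1/2, 1/2].\<close>

definition sinc_half :: "real \<Rightarrow> real" where
  "sinc_half x = (if x = 0 then 1 else sin (x / 2) / (x / 2))"

lemma sinc_half_0 [simp]: "sinc_half 0 = 1"
  by (simp add: sinc_half_def)

lemma sin_half_sinc_half: "sin (x / 2) = x / 2 * sinc_half x"
  by (simp add: sinc_half_def)

lemma continuous_on_sinc_half: "continuous_on UNIV sinc_half"
proof -
  have "isCont sinc_half x" for x
  proof (cases "x = 0")
    case True
    have "((\<lambda>x :: real. sin (x / 2) / (x / 2)) \<longlongrightarrow> 1) (at 0)" by real_asymp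
    hence "(sinc_half \<longlongrightarrow> 1) (at 0)"
      by (rule Lim_transform_eventually) (auto simp: sinc_half_def eventually_at_filter)
    thus ?thesis using True by (simp add: isCont_def)
  next
    case False
    have "isCont (\<lambda>x. sin (x / 2) / (x / 2)) x" using False by (intro continuous_intros) auto
    moreover have "\<forall>\<^sub>F y in nhds x. sinc_half y = sin (y / 2) / (y / 2)"
      using t1_space_nhds[OF False] by eventually_elim (simp add: sinc_half_def)
    ultimately show ?thesis by (subst isCont_cong[where g = "\<lambda>x. sin (x / 2) / (x / 2)"])
  qed
  thus ?thesis by (simp add: continuous_at_imp_continuous_on)
qed

lemma isCont_sinc_half: "isCont sinc_half x"
  using continuous_on_sinc_half by (simp add: continuous_on_eq_continuous_at)

lemma tendsto_sinc_half [tendsto_intros]: "(f \<longlongrightarrow> a) F \<Longrightarrow> ((\<lambda>x. sinc_half (f x)) \<longlongrightarrow> sinc_half a) F"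
  by (rule isCont_tendsto_compose[OF isCont_sinc_half])

lemma tendsto_prod_list:
  fixes f :: "'b \<Rightarrow> 'a \<Rightarrow> 'c::real_normed_algebra_1"
  assumes "\<And>i. i \<in> set xs \<Longrightarrow> ((\<lambda>x. f i x) \<longlongrightarrow> a i) F"
  shows "((\<lambda>x. \<Prod>i \<leftarrow> xs. f i x) \<longlongrightarrow> (\<Prod>i \<leftarrow> xs. a i)) F"
  using assms by (induction xs) (auto intro!: tendsto_mult)

lemma maj_gf_tendsto:
  fixes f :: "'b \<Rightarrow> complex"
  assumes "(f \<longlongrightarrow> q) F"
  shows "((\<lambda>x. maj_gf (f x) l) \<longlongrightarrow> maj_gf q l) F"
  unfolding maj_gf_def by (intro tendsto_intros assms)

text \<open>\<open>q_hook_formula\<close> excludes roots of unity. Both sides are polynomials in q,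
  and for modulus r < 1 no positive power of q equals 1, so the identity extends to the circle by
  letting r tend to 1 radially.\<close>

lemma q_hook_formula_circle:
  fixes q :: complex
  assumes l: "sorted_wrt (\<ge>) l" and q: "norm q = 1"
  shows "maj_gf q l * (\<Prod>h \<leftarrow> hooks l. 1 - q ^ h) = q ^ min_maj l * (\<Prod>k \<leftarrow> [1..<Suc (sum_list l)]. 1 - q ^ k)"
proof -
  have eq: "qfact z n = (\<Prod>k \<leftarrow> [1..<Suc n]. 1 - z ^ k)" for z :: complex and n
    unfolding qfact_def prod.distinct_set_conv_list[OF distinct_upt, symmetric] set_upt
      atLeastLessThanSuc_atLeastAtMost ..
  let ?L = "\<lambda>z. maj_gf z l * (\<Prod>h \<leftarrow> hooks l. 1 - z ^ h)"
  let ?R = "\<lambda>z :: complex. z ^ min_maj l * (\<Prod>k \<leftarrow> [1..<Suc (sum_list l)]. 1 - z ^ k)"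
  have lim: "((\<lambda>r :: real. of_real r * q) \<longlongrightarrow> of_real 1 * q) (at_left 1)"
    by (intro tendsto_intros)
  hence lim: "((\<lambda>r :: real. of_real r * q) \<longlongrightarrow> q) (at_left 1)" by simp
  have 1: "((\<lambda>r :: real. ?L (of_real r * q)) \<longlongrightarrow> ?L q) (at_left 1)"
    by (intro tendsto_mult maj_gf_tendsto tendsto_prod_list tendsto_diff tendsto_const tendsto_power lim)
  have 2: "((\<lambda>r :: real. ?R (of_real r * q)) \<longlongrightarrow> ?R q) (at_left 1)"
    by (intro tendsto_mult tendsto_prod_list tendsto_diff tendsto_const tendsto_power lim)
  have "\<forall>\<^sub>F r in at_left (1 :: real). r \<in> {0<..<1}"
    by (rule eventually_at_left_real) simp
  hence 3: "\<forall>\<^sub>F r in at_left 1. ?L (of_real r * q) = ?R (of_real r * q)"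
  proof eventually_elim
    case (elim r)
    have "norm (of_real r * q) = r" using elim q by (simp add: norm_mult)
    hence n: "norm ((of_real r * q) ^ k) = r ^ k" for k by (simp add: norm_power)
    have "(of_real r * q) ^ k \<noteq> 1" if "k > 0" for k
    proof
      assume "(of_real r * q) ^ k = 1"
      with n[of k] have "r ^ k = 1" by simp
      moreover have "r ^ k < 1" using elim that by (intro power_less_one_iff[THEN iffD2]) auto
      ultimately show False by simp
    qed
    moreover have "of_real r * q \<noteq> 0" using elim q by auto
    ultimately show ?case using q_hook_formula[of "of_real r * q" l] l unfolding eq by blast
  qed
  show ?thesis
    using tendsto_unique[OF trivial_limit_at_left_real Lim_transform_eventually[OF 1 3] 2] .
qed

lemma one_minus_cis: "1 - cis x = - 2 * \<i> * (of_real (sin (x / 2)) * cis (x / 2))"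
proof -
  have "cis x = cis (x / 2) * cis (x / 2)" by (simp add: cis_mult)
  moreover have "1 = cis (x / 2) * cis (- (x / 2))" by (simp add: cis_mult)
  ultimately have "1 - cis x = cis (x / 2) * (cis (- (x / 2)) - cis (x / 2))"
    by (simp add: algebra_simps)
  also have "cis (- (x / 2)) - cis (x / 2) = - 2 * \<i> * of_real (sin (x / 2))"
    by (simp add: complex_eq_iff)
  finally show ?thesis by (simp add: algebra_simps)
qed

lemma prod_one_minus_cis:
  "(\<Prod>k \<leftarrow> ks. 1 - cis x ^ k) = (- 2 * \<i>) ^ length ks *
    of_real (\<Prod>k \<leftarrow> ks. sin (real k * x / 2)) * cis (x * (\<Sum>k \<leftarrow> ks. real k) / 2)"
proof (induction ks)
  case (Cons k ks)
  have "1 - cis x ^ k = - 2 * \<i> * (of_real (sin (real k * x / 2)) * cis (real k * x / 2))"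
    by (simp only: Complex.DeMoivre one_minus_cis)
  moreover have "cis (x * (\<Sum>k \<leftarrow> k # ks. real k) / 2) = cis (real k * x / 2) * cis (x * (\<Sum>k \<leftarrow> ks. real k) / 2)"
    by (simp add: cis_mult algebra_simps add_divide_distrib)
  ultimately show ?case
    by (simp only: list.map prod_list.Cons Cons length_Cons power_Suc of_real_mult mult_ac)
qed simp

lemma prod_sin_half: "(\<Prod>k \<leftarrow> ks. sin (real k * x / 2)) =
  (x / 2) ^ length ks * (\<Prod>k \<leftarrow> ks. real k) * (\<Prod>k \<leftarrow> ks. sinc_half (real k * x))"
proof (induction ks)
  case (Cons k ks)
  show ?case by (simp only: list.map prod_list.Cons Cons sin_half_sinc_half[of "real k * x"]) (simp add: algebra_simps)
qed simp

text \<open>The midpoint between the lowest and the highest degree of the generating function. It is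
  the phase left over when each 1 - q^k is written as a sine times a complex unit.\<close>

definition maj_mean :: "nat list \<Rightarrow> real" where
  "maj_mean l = real (min_maj l) + ((\<Sum>k \<leftarrow> [1..<Suc (sum_list l)]. real k) - (\<Sum>h \<leftarrow> hooks l. real h)) / 2"

text \<open>At q = 1/2 the right side of the hook formula is nonzero, so the sum over tableaux
  cannot be empty.\<close>

lemma SYT_nonempty:
  assumes "sorted_wrt (\<ge>) l"
  shows "SYT l \<noteq> {}"
proof
  assume "SYT l = {}"
  hence "maj_gf (1 / 2 :: real) l = 0" by (simp add: maj_gf_def)
  moreover have q: "(1 / 2 :: real) ^ k \<noteq> 1" if "k > 0" for k
    using power_less_one_iff[of "1/2 :: real" k] that by auto
  ultimately show False
    using q_hook_formula[of "1/2 :: real" l] assms qfact_nonzero[of "1/2 :: real" "sum_list l"] by simp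
qed

lemma sum_SYT_cis_sin:
  assumes l: "sorted_wrt (\<ge>) l"
  shows "(\<Sum>T \<in> SYT l. cis (x * (real (maj l T) - maj_mean l))) * of_real (\<Prod>h \<leftarrow> hooks l. sin (real h * x / 2)) =
    of_real (\<Prod>k \<leftarrow> [1..<Suc (sum_list l)]. sin (real k * x / 2))"
proof -
  let ?n = "sum_list l"
  let ?S = "\<Prod>h \<leftarrow> hooks l. sin (real h * x / 2)"
  let ?K = "\<Prod>k \<leftarrow> [1..<Suc ?n]. sin (real k * x / 2)"
  let ?a = "x * (\<Sum>h \<leftarrow> hooks l. real h) / 2"
  let ?b = "x * (\<Sum>k \<leftarrow> [1..<Suc ?n]. real k) / 2"
  \<comment> \<open>The same power arises on both sides, since there are n hooks.\<close>
  let ?c = "(- 2 * \<i>) ^ ?n"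
  have "maj_gf (cis x) l * (?c * of_real ?S * cis ?a) = cis x ^ min_maj l * (?c * of_real ?K * cis ?b)"
    using q_hook_formula_circle[OF l, of "cis x"]
    by (simp only: norm_cis prod_one_minus_cis length_hooks length_upt diff_Suc_1)
  hence "?c * (maj_gf (cis x) l * of_real ?S * cis ?a) = ?c * (cis x ^ min_maj l * of_real ?K * cis ?b)"
    by (simp only: mult_ac)
  hence "maj_gf (cis x) l * of_real ?S * cis ?a = cis x ^ min_maj l * of_real ?K * cis ?b"
    by (subst (asm) mult_cancel_left) simp
  hence "maj_gf (cis x) l * of_real ?S * cis ?a * cis (- ?b - real (min_maj l) * x) =
      of_real ?K * (cis (real (min_maj l) * x) * cis ?b * cis (- ?b - real (min_maj l) * x))"
    by (simp only: Complex.DeMoivre mult_ac)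
  also have "cis (real (min_maj l) * x) * cis ?b * cis (- ?b - real (min_maj l) * x) = 1"
    by (simp add: cis_mult)
  also have "maj_gf (cis x) l * of_real ?S * cis ?a * cis (- ?b - real (min_maj l) * x) =
      (maj_gf (cis x) l * (cis ?a * cis (- ?b - real (min_maj l) * x))) * of_real ?S"
    by (simp only: mult_ac)
  also have "cis ?a * cis (- ?b - real (min_maj l) * x) = cis (- (x * maj_mean l))"
    by (simp add: cis_mult maj_mean_def algebra_simps diff_divide_distrib add_divide_distrib del: upt_Suc)
  also have "maj_gf (cis x) l * cis (- (x * maj_mean l)) =
      (\<Sum>T \<in> SYT l. cis (x * (real (maj l T) - maj_mean l)))"
    unfolding maj_gf_def sum_distrib_right
    by (intro sum.cong refl) (simp add: Complex.DeMoivre cis_mult algebra_simps)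
  finally show ?thesis by simp
qed

lemma tendsto_prod_sinc_half_0: "((\<lambda>x. \<Prod>k \<leftarrow> ks. sinc_half (real k * x)) \<longlongrightarrow> 1) (at 0)"
proof -
  have "((\<lambda>x. \<Prod>k \<leftarrow> ks. sinc_half (real k * x)) \<longlongrightarrow> (\<Prod>k \<leftarrow> ks. sinc_half (real k * 0))) (at 0)"
    by (intro tendsto_prod_list tendsto_sinc_half tendsto_intros)
  moreover have "(\<Prod>k \<leftarrow> ks. sinc_half (real k * 0)) = 1" by (induction ks) auto
  ultimately show ?thesis by simp
qed

text \<open>Dividing the sines by their arguments leaves the constants \<open>pk\<close> and
  \<open>ph\<close>, the products of 1, ..., n and of the hooks. Letting x tend to 0 identifies
  their quotient as the number of tableaux, which is the classical hook length formula.\<close>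

lemma sum_SYT_cis_sinc_half:
  assumes l: "sorted_wrt (\<ge>) l"
  shows "(\<Sum>T \<in> SYT l. cis (x * (real (maj l T) - maj_mean l))) * of_real (\<Prod>h \<leftarrow> hooks l. sinc_half (real h * x)) =
    of_nat (card (SYT l)) * of_real (\<Prod>k \<leftarrow> [1..<Suc (sum_list l)]. sinc_half (real k * x))"
proof -
  let ?n = "sum_list l"
  let ?C = "\<lambda>x. \<Sum>T \<in> SYT l. cis (x * (real (maj l T) - maj_mean l))"
  let ?H = "\<lambda>x. \<Prod>h \<leftarrow> hooks l. sinc_half (real h * x)"
  let ?K = "\<lambda>x. \<Prod>k \<leftarrow> [1..<Suc ?n]. sinc_half (real k * x)"
  define ph where "ph = (\<Prod>h \<leftarrow> hooks l. real h)"
  define pk where "pk = (\<Prod>k \<leftarrow> [1..<Suc ?n]. real k)"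
  have ph: "ph \<noteq> 0" using hooks_pos[of 0 l] by (auto simp: ph_def prod_list_zero_iff)
  have *: "?C x * of_real ph * of_real (?H x) = of_real pk * of_real (?K x)" if "x \<noteq> 0" for x
  proof -
    have nz: "complex_of_real ((x / 2) ^ ?n) \<noteq> 0" using that by simp
    have "complex_of_real ((x / 2) ^ ?n) * (?C x * of_real ph * of_real (?H x)) =
      complex_of_real ((x / 2) ^ ?n) * (of_real pk * of_real (?K x))"
      using sum_SYT_cis_sin[OF l, of x] unfolding prod_sin_half length_hooks length_upt diff_Suc_1
        ph_def[symmetric] pk_def[symmetric] of_real_mult by (simp only: mult_ac)
    thus ?thesis by (rule mult_left_cancel[OF nz, THEN iffD1])
  qed
  have limC: "(?C \<longlongrightarrow> of_nat (card (SYT l))) (at 0)"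
  proof -
    have "(?C \<longlongrightarrow> (\<Sum>T \<in> SYT l. cis (0 * (real (maj l T) - maj_mean l)))) (at 0)"
      by (intro tendsto_sum tendsto_cis tendsto_intros)
    thus ?thesis by simp
  qed
  have 1: "((\<lambda>x. ?C x * of_real ph * of_real (?H x)) \<longlongrightarrow> of_nat (card (SYT l)) * of_real ph * of_real 1) (at 0)"
    by (intro tendsto_mult limC tendsto_const tendsto_of_real tendsto_prod_sinc_half_0)
  have 2: "((\<lambda>x. of_real pk * of_real (?K x)) \<longlongrightarrow> of_real pk * (of_real 1 :: complex)) (at 0)"
    by (intro tendsto_mult tendsto_const tendsto_of_real tendsto_prod_sinc_half_0)
  have 3: "\<forall>\<^sub>F x in at 0. ?C x * of_real ph * of_real (?H x) = of_real pk * of_real (?K x)"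
    using * by (auto simp: eventually_at_filter)
  have pk: "of_nat (card (SYT l)) * of_real ph = (of_real pk :: complex)"
    using tendsto_unique[OF at_neq_bot Lim_transform_eventually[OF 1 3] 2] by (simp only: of_real_1 mult_1_right)
  show ?thesis
  proof (cases "x = 0")
    case True
    have "(\<Prod>k \<leftarrow> ks. sinc_half (real k * 0)) = 1" for ks by (induction ks) auto
    thus ?thesis using True by simp
  next
    case False
    have "of_real ph * (?C x * of_real (?H x)) = of_real ph * (of_nat (card (SYT l)) * of_real (?K x))"
      using *[OF False] unfolding pk[symmetric] by (simp only: mult_ac)
    moreover have "complex_of_real ph \<noteq> 0" using ph by simp
    ultimately show ?thesis by (metis mult_left_cancel)
  qed
qed

lemma sinc_half_expansion: "((\<lambda>x. (1 - sinc_half (k * x)) / x\<^sup>2) \<longlongrightarrow> k\<^sup>2 / 24) (at 0)"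
proof (cases "k = 0")
  case False
  have "((\<lambda>y :: real. (1 - sin (y / 2) / (y / 2)) / y\<^sup>2) \<longlongrightarrow> 1 / 24) (at 0)" by real_asymp
  hence 1: "((\<lambda>y. (1 - sinc_half y) / y\<^sup>2) \<longlongrightarrow> 1 / 24) (at 0)"
    by (rule Lim_transform_eventually) (auto simp: sinc_half_def eventually_at_filter)
  have 2: "filterlim (\<lambda>x. k * x) (at 0) (at 0)"
  proof (rule filterlim_atI)
    have "((\<lambda>x. k * x) \<longlongrightarrow> k * 0) (at 0)" by (intro tendsto_intros)
    thus "((\<lambda>x. k * x) \<longlongrightarrow> 0) (at 0)" by simp
    show "\<forall>\<^sub>F x in at 0. k * x \<noteq> 0" using False by (auto simp: eventually_at_filter)
  qed
  have "((\<lambda>x. k\<^sup>2 * ((1 - sinc_half (k * x)) / (k * x)\<^sup>2)) \<longlongrightarrow> k\<^sup>2 * (1 / 24)) (at 0)"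
    by (intro tendsto_mult tendsto_const filterlim_compose[OF 1 2])
  thus ?thesis using False by (simp add: power_mult_distrib)
qed simp

lemma prod_sinc_half_expansion:
  "((\<lambda>x. (1 - (\<Prod>k \<leftarrow> ks. sinc_half (real k * x))) / x\<^sup>2) \<longlongrightarrow> (\<Sum>k \<leftarrow> ks. (real k)\<^sup>2) / 24) (at 0)"
proof (induction ks)
  case (Cons k ks)
  have "((\<lambda>x. sinc_half (real k * x)) \<longlongrightarrow> 1) (at 0)"
    using tendsto_prod_sinc_half_0[of "[k]"] by simp
  hence "((\<lambda>x. (1 - sinc_half (real k * x)) / x\<^sup>2 + sinc_half (real k * x) * ((1 - (\<Prod>k \<leftarrow> ks. sinc_half (real k * x))) / x\<^sup>2))
      \<longlongrightarrow> (real k)\<^sup>2 / 24 + 1 * ((\<Sum>k \<leftarrow> ks. (real k)\<^sup>2) / 24)) (at 0)"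
    by (intro tendsto_add tendsto_mult sinc_half_expansion Cons)
  moreover have "(1 - sinc_half (real k * x)) / x\<^sup>2 + sinc_half (real k * x) * ((1 - (\<Prod>k \<leftarrow> ks. sinc_half (real k * x))) / x\<^sup>2) =
      (1 - (\<Prod>k \<leftarrow> k # ks. sinc_half (real k * x))) / x\<^sup>2" for x
    by (cases "x = 0") (simp_all add: field_simps)
  ultimately show ?case by (simp add: add_divide_distrib)
qed simp

lemma sum_squares_hook_defect:
  "(\<Sum>k \<leftarrow> [1..<Suc (sum_list l)]. (real k)\<^sup>2) - (\<Sum>h \<leftarrow> hooks l. (real h)\<^sup>2) = hook_defect l"
  unfolding hook_defect_def sum_list_upt_eq atLeastLessThanSuc_atLeastAtMost ..

text \<open>The sum in \<open>sum_SYT_cis_sinc_half\<close> times the hook product is real. Its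
  imaginary part divided by x yields the first moment as x tends to 0, and 1 - cos divided by x^2
  yields the second. The 12 comes from the coefficient 1/24 of \<open>sinc_half\<close> against the
  1/2 of the cosine.\<close>

lemma
  assumes l: "sorted_wrt (\<ge>) l"
  shows sum_maj_deviation: "(\<Sum>T \<in> SYT l. real (maj l T) - maj_mean l) = 0"
    and sum_maj_deviation_squared:
      "(\<Sum>T \<in> SYT l. (real (maj l T) - maj_mean l)\<^sup>2) = real (card (SYT l)) * hook_defect l / 12"
proof -
  let ?y = "\<lambda>T. real (maj l T) - maj_mean l"
  let ?H = "\<lambda>x. \<Prod>h \<leftarrow> hooks l. sinc_half (real h * x)"
  let ?K = "\<lambda>x. \<Prod>k \<leftarrow> [1..<Suc (sum_list l)]. sinc_half (real k * x)"
  let ?N = "real (card (SYT l))"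
  have im: "(\<Sum>T \<in> SYT l. sin (x * ?y T)) * ?H x = 0" for x
    using arg_cong[OF sum_SYT_cis_sinc_half[OF l, of x], of Im] by simp
  have re: "(\<Sum>T \<in> SYT l. cos (x * ?y T)) * ?H x = ?N * ?K x" for x
    using arg_cong[OF sum_SYT_cis_sinc_half[OF l, of x], of Re] by simp
  have "\<forall>\<^sub>F x in at 0. ?H x > 0"
    using tendsto_prod_sinc_half_0[of "hooks l"] by (rule order_tendstoD) simp
  hence ev: "\<forall>\<^sub>F x in at 0. (\<Sum>T \<in> SYT l. sin (x * ?y T) / x) = 0"
  proof eventually_elim
    case (elim x)
    hence "(\<Sum>T \<in> SYT l. sin (x * ?y T)) = 0" using im[of x] by (simp del: prod_list_zero_iff)
    thus ?case by (simp add: sum_divide_distrib[symmetric])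
  qed
  have "((\<lambda>x :: real. sin (x * y) / x) \<longlongrightarrow> y) (at 0)" for y :: real
    by real_asymp
  hence "((\<lambda>x. \<Sum>T \<in> SYT l. sin (x * ?y T) / x) \<longlongrightarrow> (\<Sum>T \<in> SYT l. ?y T)) (at 0)"
    by (intro tendsto_sum)
  from Lim_transform_eventually[OF this ev]
  show "(\<Sum>T \<in> SYT l. ?y T) = 0"
    by (intro tendsto_unique[OF at_neq_bot _ tendsto_const])
  have "((\<lambda>x :: real. (1 - cos (x * y)) / x\<^sup>2) \<longlongrightarrow> y\<^sup>2 / 2) (at 0)" for y :: real
    unfolding power2_eq_square[of y] by real_asymp
  hence 1: "((\<lambda>x. (\<Sum>T \<in> SYT l. (1 - cos (x * ?y T)) / x\<^sup>2) * ?H x) \<longlongrightarrow> (\<Sum>T \<in> SYT l. (?y T)\<^sup>2 / 2) * 1) (at 0)"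
    by (intro tendsto_mult tendsto_sum tendsto_prod_sinc_half_0)
  have 2: "((\<lambda>x. ?N * ((1 - ?K x) / x\<^sup>2 - (1 - ?H x) / x\<^sup>2)) \<longlongrightarrow>
      ?N * ((\<Sum>k \<leftarrow> [1..<Suc (sum_list l)]. (real k)\<^sup>2) / 24 - (\<Sum>h \<leftarrow> hooks l. (real h)\<^sup>2) / 24)) (at 0)"
    by (intro tendsto_mult tendsto_const tendsto_diff prod_sinc_half_expansion)
  have "(\<Sum>T \<in> SYT l. (1 - cos (x * ?y T)) / x\<^sup>2) * ?H x = ?N * ((1 - ?K x) / x\<^sup>2 - (1 - ?H x) / x\<^sup>2)" for x
  proof -
    have "(\<Sum>T \<in> SYT l. (1 - cos (x * ?y T)) / x\<^sup>2) * ?H x =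
        (?N * ?H x - (\<Sum>T \<in> SYT l. cos (x * ?y T)) * ?H x) / x\<^sup>2"
      by (simp add: sum_divide_distrib[symmetric] sum_subtractf left_diff_distrib)
    also have "\<dots> = ?N * ((1 - ?K x) / x\<^sup>2 - (1 - ?H x) / x\<^sup>2)"
      unfolding re by (simp add: right_diff_distrib diff_divide_distrib)
    finally show ?thesis .
  qed
  hence "(\<Sum>T \<in> SYT l. (?y T)\<^sup>2 / 2) =
      ?N * ((\<Sum>k \<leftarrow> [1..<Suc (sum_list l)]. (real k)\<^sup>2) / 24 - (\<Sum>h \<leftarrow> hooks l. (real h)\<^sup>2) / 24)"
    using tendsto_unique[OF at_neq_bot 1] 2 by simp
  thus "(\<Sum>T \<in> SYT l. (?y T)\<^sup>2) = ?N * hook_defect l / 12"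
    unfolding sum_squares_hook_defect[symmetric] sum_divide_distrib[symmetric]
    by (simp add: algebra_simps diff_divide_distrib)
qed

section \<open>The normalized law and its characteristic function\<close>

definition maj_sd :: "nat list \<Rightarrow> real" where
  "maj_sd l = sqrt (hook_defect l / 12)"

context
  fixes l :: "nat list"
  assumes l: "sorted_wrt (\<ge>) l"
begin

lemma expectation_SYT:
  fixes f :: "(nat \<times> nat \<Rightarrow> nat) \<Rightarrow> 'b::{banach, second_countable_topology}"
  shows "integral\<^sup>L (measure_pmf (pmf_of_set (SYT l))) f = (\<Sum>T \<in> SYT l. f T) /\<^sub>R real (card (SYT l))"
  using SYT_nonempty[OF l]
  by (subst integral_measure_pmf[of "SYT l"]) (auto simp: scaleR_sum_right divide_inverse)

lemma expectation_maj: "(\<integral>T. real (maj l T) \<partial>measure_pmf (pmf_of_set (SYT l))) = maj_mean l"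
  using sum_maj_deviation[OF l] SYT_nonempty[OF l] by (simp add: expectation_SYT sum_subtractf field_simps)

lemma std_dev_maj: "std_dev (measure_pmf (pmf_of_set (SYT l))) (\<lambda>T. real (maj l T)) = maj_sd l"
  using SYT_nonempty[OF l]
  by (simp add: std_dev_def expectation_maj expectation_SYT sum_maj_deviation_squared[OF l] maj_sd_def)

lemma hook_defect_nonneg: "hook_defect l \<ge> 0"
proof -
  have "0 \<le> (\<Sum>T \<in> SYT l. (real (maj l T) - maj_mean l)\<^sup>2)" by (simp add: sum_nonneg)
  thus ?thesis unfolding sum_maj_deviation_squared[OF l] using SYT_nonempty[OF l]
    by (simp add: zero_le_mult_iff)
qed

lemma maj_sd_eq_0_iff: "maj_sd l = 0 \<longleftrightarrow> hook_defect l = 0"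
  by (simp add: maj_sd_def)

lemma real_distribution_maj_law: "real_distribution (normalized_maj_law l)"
  unfolding normalized_maj_law_def normalized_law_def
  by (intro prob_space.real_distribution_distr prob_space_measure_pmf) simp

text \<open>The case distinction in \<open>normalized\<close> disappears because
  \<open>x / 0 = 0\<close> agrees with its default value.\<close>

lemma normalized_maj:
  "normalized (measure_pmf (pmf_of_set (SYT l))) (\<lambda>T. real (maj l T)) T =
    (real (maj l T) - maj_mean l) / maj_sd l"
  by (simp add: normalized_def std_dev_maj expectation_maj)

lemma char_maj_law_sum:
  "char (normalized_maj_law l) t =
    (\<Sum>T \<in> SYT l. cis (t / maj_sd l * (real (maj l T) - maj_mean l))) /\<^sub>R real (card (SYT l))"
proof -
  have "char (normalized_maj_law l) t =
      (\<integral>T. iexp (t * ((real (maj l T) - maj_mean l) / maj_sd l)) \<partial>measure_pmf (pmf_of_set (SYT l)))"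
    unfolding char_def normalized_maj_law_def normalized_law_def
    by (subst integral_distr) (simp_all add: normalized_maj)
  also have "\<dots> = (\<Sum>T \<in> SYT l. cis (t / maj_sd l * (real (maj l T) - maj_mean l))) /\<^sub>R real (card (SYT l))"
    by (simp add: expectation_SYT cis_conv_exp)
  finally show ?thesis .
qed

text \<open>The hook factors stay on the left because they may vanish at particular
  \<open>t\<close>.\<close>

lemma char_maj_law:
  "char (normalized_maj_law l) t * of_real (\<Prod>h \<leftarrow> hooks l. sinc_half (real h * (t / maj_sd l))) =
    of_real (\<Prod>k \<leftarrow> [1..<Suc (sum_list l)]. sinc_half (real k * (t / maj_sd l)))"
  unfolding char_maj_law_sum scaleR_conv_of_real mult.assoc sum_SYT_cis_sinc_half[OF l]
  using SYT_nonempty[OF l] by simp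

lemma char_maj_law_degenerate:
  assumes "maj_sd l = 0"
  shows "char (normalized_maj_law l) t = 1"
  unfolding char_maj_law_sum using assms SYT_nonempty[OF l] by (simp add: scaleR_conv_of_real)

text \<open>The difference of the summands is at most |t - s| |y|, and |y| <= (1 + y^2) / 2, which
  has mean 1 because the normalized variance is 1 unless the law is degenerate.\<close>

lemma char_maj_law_lipschitz:
  "norm (char (normalized_maj_law l) t - char (normalized_maj_law l) s) \<le> \<bar>t - s\<bar>"
proof (cases "maj_sd l = 0")
  case False
  let ?y = "\<lambda>T. (real (maj l T) - maj_mean l) / maj_sd l"
  let ?N = "real (card (SYT l))"
  have le: "norm (cis (t * y) - cis (s * y)) \<le> \<bar>t - s\<bar> * ((1 + y\<^sup>2) / 2)" for y :: real
  proof -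
    have "cis (t * y) - cis (s * y) = cis (s * y) * (cis ((t - s) * y) - 1)"
      by (simp add: algebra_simps cis_mult)
    hence "norm (cis (t * y) - cis (s * y)) = norm (iexp ((t - s) * y) - 1)"
      by (simp add: norm_mult cis_conv_exp)
    also have "\<dots> \<le> \<bar>(t - s) * y\<bar>" using iexp_approx1[of "(t - s) * y" 0] by simp
    also have "\<dots> \<le> \<bar>t - s\<bar> * ((1 + y\<^sup>2) / 2)"
    proof -
      have "0 \<le> (1 - \<bar>y\<bar>)\<^sup>2" by simp
      hence "\<bar>y\<bar> \<le> (1 + y\<^sup>2) / 2" by (simp add: power2_eq_square algebra_simps)
      thus ?thesis unfolding abs_mult by (intro mult_left_mono) auto
    qed
    finally show ?thesis .
  qed
  have *: "norm (\<Sum>T \<in> SYT l. cis (t * ?y T) - cis (s * ?y T)) \<le> (\<Sum>T \<in> SYT l. \<bar>t - s\<bar> * ((1 + (?y T)\<^sup>2) / 2))"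
    by (intro sum_norm_le le)
  have sd: "(maj_sd l)\<^sup>2 = hook_defect l / 12" using hook_defect_nonneg by (simp add: maj_sd_def)
  have "(\<Sum>T \<in> SYT l. (?y T)\<^sup>2) = (\<Sum>T \<in> SYT l. (real (maj l T) - maj_mean l)\<^sup>2) / (maj_sd l)\<^sup>2"
    by (simp add: power_divide sum_divide_distrib)
  also have "\<dots> = ?N"
    unfolding sd sum_maj_deviation_squared[OF l] using False by (simp add: maj_sd_eq_0_iff)
  finally have "(\<Sum>T \<in> SYT l. (?y T)\<^sup>2) = ?N" .
  hence **: "(\<Sum>T \<in> SYT l. \<bar>t - s\<bar> * ((1 + (?y T)\<^sup>2) / 2)) = \<bar>t - s\<bar> * ?N"
    by (simp add: sum_distrib_left[symmetric] sum_divide_distrib[symmetric] sum.distrib)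
  have "char (normalized_maj_law l) t - char (normalized_maj_law l) s =
      (\<Sum>T \<in> SYT l. cis (t * ?y T) - cis (s * ?y T)) /\<^sub>R ?N"
    unfolding char_maj_law_sum by (simp add: sum_subtractf scaleR_diff_right)
  hence "norm (char (normalized_maj_law l) t - char (normalized_maj_law l) s) =
      norm (\<Sum>T \<in> SYT l. cis (t * ?y T) - cis (s * ?y T)) / ?N"
    by (simp add: divide_inverse mult.commute)
  also have "\<dots> \<le> \<bar>t - s\<bar> * ?N / ?N"
    using * unfolding ** by (rule divide_right_mono) simp
  also have "\<dots> = \<bar>t - s\<bar>" using SYT_nonempty[OF l] by simp
  finally show ?thesis .
qed (simp add: char_maj_law_degenerate)

text \<open>Here it matters that the major index is integer valued.\<close>
lemma norm_char_maj_law_period: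
  assumes "maj_sd l \<noteq> 0"
  shows "norm (char (normalized_maj_law l) (2 * pi * maj_sd l)) = 1"
proof -
  have "cis (2 * pi * (real (maj l T) - maj_mean l)) = cis (- 2 * pi * maj_mean l)" for T
  proof -
    have "cis (2 * pi * (real (maj l T) - maj_mean l)) = cis (2 * pi * real (maj l T)) * cis (- 2 * pi * maj_mean l)"
      by (simp add: cis_mult algebra_simps)
    also have "cis (2 * pi * real (maj l T)) = 1" by (rule cis_multiple_2pi) simp
    finally show ?thesis by simp
  qed
  hence "char (normalized_maj_law l) (2 * pi * maj_sd l) = cis (- 2 * pi * maj_mean l)"
    unfolding char_maj_law_sum using assms SYT_nonempty[OF l] by (simp add: scaleR_conv_of_real)
  thus ?thesis by simp
qed

lemma discrete_maj_law: "discrete_law (normalized_maj_law l)"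
proof -
  let ?X = "normalized (measure_pmf (pmf_of_set (SYT l))) (\<lambda>T. real (maj l T))"
  have "countable (?X ` SYT l)" by (simp add: countable_finite)
  moreover have "AE x in normalized_maj_law l. x \<in> ?X ` SYT l"
    unfolding normalized_maj_law_def normalized_law_def
  proof (subst AE_distr_iff)
    show "{x \<in> space borel. x \<in> ?X ` SYT l} \<in> sets borel"
      by (simp add: finite_imp_closed borel_closed)
    show "AE x in measure_pmf (pmf_of_set (SYT l)). ?X x \<in> ?X ` SYT l"
      using SYT_nonempty[OF l] by (auto simp: AE_measure_pmf_iff)
  qed simp
  ultimately show ?thesis unfolding discrete_law_def by blast
qed

end

section \<open>The normal limit\<close>

lemma sinc_half_minus [simp]: "sinc_half (- x) = sinc_half x"
  by (simp add: sinc_half_def)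

lemma sinc_half_mult_abs: "sinc_half (a * \<bar>x\<bar>) = sinc_half (a * x)"
  by (cases "x \<ge> 0") (auto simp: abs_if)

lemma sinc_half_pos:
  assumes "0 \<le> x" "x \<le> pi"
  shows "0 < sinc_half x"
proof (cases "x = 0")
  case False
  hence "0 < sin (x / 2)" using assms by (intro sin_gt_zero) auto
  thus ?thesis using False assms by (simp add: sinc_half_def)
qed simp

definition sinc_half_rem :: "real \<Rightarrow> real" where
  "sinc_half_rem x = - ln (sinc_half x) - x\<^sup>2 / 24"

lemma sinc_half_exp: "0 \<le> x \<Longrightarrow> x \<le> pi \<Longrightarrow> sinc_half x = exp (- (sinc_half_rem x + x\<^sup>2 / 24))"
  using sinc_half_pos[of x] by (simp add: sinc_half_rem_def)

lemma sin_minus_mult_cos_nonneg: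
  fixes y :: real
  assumes "0 \<le> y" "y \<le> pi"
  shows "0 \<le> sin y - y * cos y"
proof -
  have "(\<lambda>y. sin y - y * cos y) 0 \<le> (\<lambda>y. sin y - y * cos y) y"
  proof (rule DERIV_nonneg_imp_nondecreasing[OF assms(1)])
    fix u :: real assume u: "0 \<le> u" "u \<le> y"
    have "((\<lambda>y. sin y - y * cos y) has_real_derivative u * sin u) (at u)"
      by (auto intro!: derivative_eq_intros)
    moreover have "0 \<le> u * sin u" using u assms by (intro mult_nonneg_nonneg sin_ge_zero) auto
    ultimately show "\<exists>d. ((\<lambda>y. sin y - y * cos y) has_real_derivative d) (at u) \<and> 0 \<le> d" by blast
  qed
  thus ?thesis by simp
qed

text \<open>The difference of the two sides has the derivative u / 3 times sin u - u cos u, which is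
  nonnegative. In the form y cot y <= 1 - y^2 / 3, with y = x / 2, this is the sign of the
  derivative of \<open>sinc_half_rem\<close> at x.\<close>

lemma sin_minus_mult_cos_lower:
  fixes y :: real
  assumes "0 \<le> y" "y \<le> pi"
  shows "y\<^sup>2 * sin y / 3 \<le> sin y - y * cos y"
proof -
  let ?p = "\<lambda>y :: real. sin y - y * cos y - y\<^sup>2 * sin y / 3"
  have "?p 0 \<le> ?p y"
  proof (rule DERIV_nonneg_imp_nondecreasing[OF assms(1)])
    fix u :: real assume u: "0 \<le> u" "u \<le> y"
    have "(?p has_real_derivative u / 3 * (sin u - u * cos u)) (at u)"
      by (auto intro!: derivative_eq_intros simp: field_simps power2_eq_square)
    moreover have "0 \<le> u / 3 * (sin u - u * cos u)"
      using u assms by (intro mult_nonneg_nonneg sin_minus_mult_cos_nonneg) auto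
    ultimately show "\<exists>d. (?p has_real_derivative d) (at u) \<and> 0 \<le> d" by blast
  qed
  thus ?thesis by simp
qed

lemma sinc_half_rem_0 [simp]: "sinc_half_rem 0 = 0"
  by (simp add: sinc_half_rem_def)

lemma sinc_half_rem_deriv:
  assumes "0 < u" "u < pi"
  shows "\<exists>d. (sinc_half_rem has_real_derivative d) (at u) \<and> 0 \<le> d"
proof -
  let ?f = "\<lambda>x. - ln (sin (x / 2) / (x / 2)) - x\<^sup>2 / 24"
  let ?d = "1 / u - cos (u / 2) / (2 * sin (u / 2)) - u / 12"
  have s: "0 < sin (u / 2)" using assms by (intro sin_gt_zero) auto
  have "(?f has_real_derivative ?d) (at u)"
    using s assms by (auto intro!: derivative_eq_intros simp: field_simps power2_eq_square)
  moreover have "\<forall>\<^sub>F x in nhds u. ?f x = sinc_half_rem x"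
    using t1_space_nhds[of u 0] assms by (auto elim!: eventually_mono simp: sinc_half_rem_def sinc_half_def)
  ultimately have "(sinc_half_rem has_real_derivative ?d) (at u)"
    by (subst (asm) DERIV_cong_ev[OF refl _ refl, of ?f sinc_half_rem]) auto
  moreover have "0 \<le> ?d"
  proof -
    have "(u / 2)\<^sup>2 * sin (u / 2) / 3 \<le> sin (u / 2) - u / 2 * cos (u / 2)"
      using assms by (intro sin_minus_mult_cos_lower) auto
    hence "0 \<le> (sin (u / 2) - u / 2 * cos (u / 2) - (u / 2)\<^sup>2 * sin (u / 2) / 3) / (u * sin (u / 2))"
      using s assms by (intro divide_nonneg_pos mult_pos_pos) auto
    also have "\<dots> = ?d" using s assms by (simp add: field_simps power2_eq_square)
    finally show ?thesis .
  qed
  ultimately show ?thesis by blast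
qed

lemma sinc_half_rem_mono:
  assumes "0 \<le> x" "x \<le> y" "y < pi"
  shows "sinc_half_rem x \<le> sinc_half_rem y"
proof (cases "x = y")
  case False
  hence "x < y" using assms by simp
  have "continuous_on {x..y} sinc_half_rem"
  proof -
    have "sinc_half u \<noteq> 0" if "u \<in> {x..y}" for u using that sinc_half_pos[of u] assms by auto
    thus ?thesis unfolding sinc_half_rem_def
      by (intro continuous_intros continuous_on_subset[OF continuous_on_sinc_half]) auto
  qed
  thus ?thesis
    using \<open>x < y\<close> assms by (intro DERIV_nonneg_imp_increasing_open[of x y sinc_half_rem] sinc_half_rem_deriv) auto
qed simp

lemma sinc_half_rem_small: "((\<lambda>x. sinc_half_rem x / x\<^sup>2) \<longlongrightarrow> 0) (at_right 0)"
proof -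
  have "((\<lambda>x :: real. (- ln (sin (x / 2) / (x / 2)) - x\<^sup>2 / 24) / x\<^sup>2) \<longlongrightarrow> 0) (at_right 0)"
    by real_asymp
  moreover have "\<forall>\<^sub>F x in at_right 0. (- ln (sin (x / 2) / (x / 2)) - x\<^sup>2 / 24) / x\<^sup>2 = sinc_half_rem x / x\<^sup>2"
    using eventually_at_right_less[of 0] by eventually_elim (simp add: sinc_half_rem_def sinc_half_def)
  ultimately show ?thesis by (rule Lim_transform_eventually)
qed

lemma prod_sinc_half_exp:
  assumes "\<And>k. k \<in> set ks \<Longrightarrow> real k * r \<le> pi" "0 \<le> r"
  shows "(\<Prod>k \<leftarrow> ks. sinc_half (real k * r)) =
    exp (- ((\<Sum>k \<leftarrow> ks. sinc_half_rem (real k * r)) + r\<^sup>2 * (\<Sum>k \<leftarrow> ks. (real k)\<^sup>2) / 24))"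
  using assms(1)
proof (induction ks)
  case (Cons k ks)
  have "sinc_half (real k * r) = exp (- (sinc_half_rem (real k * r) + (real k * r)\<^sup>2 / 24))"
    using Cons.prems[of k] assms(2) by (intro sinc_half_exp) auto
  thus ?case using Cons
    by (simp add: exp_add[symmetric] power_mult_distrib algebra_simps add_divide_distrib)
qed simp

text \<open>While n |t| / sd < pi, all sine factors are positive and logarithms can be taken. By the
  value of the variance the quadratic terms combine to t^2 / 2; \<open>D\<close> collects the
  remainders, to which \<open>sum_hooks_sandwich\<close> applies.\<close>

lemma char_maj_law_exp:
  assumes l: "is_partition l" and sd: "maj_sd l \<noteq> 0"
    and small: "real (sum_list l) * (\<bar>t\<bar> / maj_sd l) < pi"
  obtains D where "char (normalized_maj_law l) t = of_real (exp (- (t\<^sup>2 / 2 + D)))"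
    "0 \<le> D" "D \<le> real (aft l) * sinc_half_rem (real (sum_list l) * (\<bar>t\<bar> / maj_sd l))"
proof -
  note srt = is_partition_sorted[OF l]
  let ?n = "sum_list l"
  have sd: "0 < maj_sd l" using sd hook_defect_nonneg[OF srt] by (simp add: maj_sd_def)
  define r where "r = \<bar>t\<bar> / maj_sd l"
  have r: "0 \<le> r" using sd by (simp add: r_def)
  have le: "real k * r < pi" if "k \<le> ?n" for k
  proof -
    have "real k * r \<le> real ?n * r" using that r by (intro mult_right_mono) auto
    thus ?thesis using small by (simp add: r_def)
  qed
  define D where "D = (\<Sum>k = 1..?n. sinc_half_rem (real k * r)) - (\<Sum>h \<leftarrow> hooks l. sinc_half_rem (real h * r))"
  have mono: "sinc_half_rem (real i * r) \<le> sinc_half_rem (real j * r)" if "i \<le> j" "j \<le> ?n" for i j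
    using that r le[of j] by (intro sinc_half_rem_mono mult_right_mono mult_nonneg_nonneg) auto
  have nonneg: "0 \<le> sinc_half_rem (real i * r)" if "i \<le> ?n" for i
    using mono[of 0 i] that by simp
  have D: "0 \<le> D" "D \<le> real (aft l) * sinc_half_rem (real ?n * r)"
    unfolding D_def using sum_hooks_sandwich[OF l, of "\<lambda>k. sinc_half_rem (real k * r)"] mono nonneg by auto
  have abs: "sinc_half (real k * (t / maj_sd l)) = sinc_half (real k * r)" for k
    using sinc_half_mult_abs[of "real k / maj_sd l" t] by (simp add: r_def)
  let ?H = "exp (- ((\<Sum>h \<leftarrow> hooks l. sinc_half_rem (real h * r)) + r\<^sup>2 * (\<Sum>h \<leftarrow> hooks l. (real h)\<^sup>2) / 24))"
  let ?K = "exp (- ((\<Sum>k \<leftarrow> [1..<Suc ?n]. sinc_half_rem (real k * r)) + r\<^sup>2 * (\<Sum>k \<leftarrow> [1..<Suc ?n]. (real k)\<^sup>2) / 24))"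
  have H: "(\<Prod>h \<leftarrow> hooks l. sinc_half (real h * r)) = ?H"
    by (intro prod_sinc_half_exp less_imp_le le hooks_le_sum_list r)
  have K: "(\<Prod>k \<leftarrow> [1..<Suc ?n]. sinc_half (real k * r)) = ?K"
    by (intro prod_sinc_half_exp r less_imp_le[OF le]) auto
  have "char (normalized_maj_law l) t * of_real ?H = of_real ?K"
    using char_maj_law[OF srt, of t] unfolding abs H K .
  moreover have "?K = exp (- (t\<^sup>2 / 2 + D)) * ?H"
  proof -
    have "r\<^sup>2 * hook_defect l / 24 = t\<^sup>2 / 2"
    proof -
      have "(maj_sd l)\<^sup>2 = hook_defect l / 12" using hook_defect_nonneg[OF srt] by (simp add: maj_sd_def)
      hence "hook_defect l = 12 * (maj_sd l)\<^sup>2" by simp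
      thus ?thesis using sd by (simp add: r_def power_divide)
    qed
    moreover have "(\<Sum>k \<leftarrow> [1..<Suc ?n]. (real k)\<^sup>2) = hook_defect l + (\<Sum>h \<leftarrow> hooks l. (real h)\<^sup>2)"
      using sum_squares_hook_defect[of l] by linarith
    moreover have "(\<Sum>k \<leftarrow> [1..<Suc ?n]. sinc_half_rem (real k * r)) = D + (\<Sum>h \<leftarrow> hooks l. sinc_half_rem (real h * r))"
      unfolding D_def sum_list_upt_eq atLeastLessThanSuc_atLeastAtMost by simp
    ultimately have "r\<^sup>2 * (\<Sum>k \<leftarrow> [1..<Suc ?n]. (real k)\<^sup>2) / 24 = t\<^sup>2 / 2 + r\<^sup>2 * (\<Sum>h \<leftarrow> hooks l. (real h)\<^sup>2) / 24"
      "(\<Sum>k \<leftarrow> [1..<Suc ?n]. sinc_half_rem (real k * r)) = D + (\<Sum>h \<leftarrow> hooks l. sinc_half_rem (real h * r))"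
      by (simp_all only: distrib_left add_divide_distrib)
    thus ?thesis unfolding exp_add[symmetric] by (simp only:) (simp add: algebra_simps)
  qed
  ultimately have "char (normalized_maj_law l) t * of_real ?H = of_real (exp (- (t\<^sup>2 / 2 + D))) * of_real ?H"
    by (simp only: of_real_mult)
  moreover have "complex_of_real ?H \<noteq> 0" by simp
  ultimately have "char (normalized_maj_law l) t = of_real (exp (- (t\<^sup>2 / 2 + D)))"
    by (metis mult_right_cancel)
  thus ?thesis using D that unfolding r_def by blast
qed

lemma aft_le_sum_list: "aft l \<le> sum_list l"
  by (simp add: aft_def)

lemma char_maj_law_normal_limit:
  assumes part: "\<And>N. is_partition (lam N)"
    and aft: "filterlim (\<lambda>N. aft (lam N)) at_top sequentially"
  shows "(\<lambda>N. char (normalized_maj_law (lam N)) t) \<longlonglongrightarrow> of_real (exp (- (t\<^sup>2 / 2)))"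
proof -
  let ?a = "\<lambda>N. real (aft (lam N))" and ?n = "\<lambda>N. real (sum_list (lam N))"
  let ?x = "\<lambda>N. ?n N * (\<bar>t\<bar> / maj_sd (lam N))"
  have a_top: "filterlim ?a at_top sequentially"
    by (rule filterlim_compose[OF filterlim_real_sequentially aft])
  have a_pos: "\<forall>\<^sub>F N in sequentially. ?a N \<ge> 1"
    using a_top unfolding filterlim_at_top by blast
  \<comment> \<open>Here 384 = 12 * 32, with 12 from \<open>maj_sd\<close> and 32 from
    \<open>hook_defect_lower\<close>.\<close>
  have sd: "maj_sd (lam N) > 0 \<and> ?a N * (?x N)\<^sup>2 \<le> 384 * t\<^sup>2" if "?a N \<ge> 1" for N
  proof -
    have n: "?n N \<ge> 1" using that aft_le_sum_list[of "lam N"] by linarith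
    have lower: "hook_defect (lam N) \<ge> ?a N * (?n N)\<^sup>2 / 32" by (rule hook_defect_lower) (rule part)
    have pos: "?a N * (?n N)\<^sup>2 / 32 > 0" using n that by (intro divide_pos_pos mult_pos_pos zero_less_power) linarith+
    hence K: "hook_defect (lam N) > 0" using lower by linarith
    hence sdp: "maj_sd (lam N) > 0" by (simp add: maj_sd_def)
    have sq: "(maj_sd (lam N))\<^sup>2 = hook_defect (lam N) / 12" using K by (simp add: maj_sd_def)
    have "?a N * (?x N)\<^sup>2 = ?a N * ((?n N)\<^sup>2 * (t\<^sup>2 / (maj_sd (lam N))\<^sup>2))"
      by (simp add: power_mult_distrib power_divide)
    also have "\<dots> = 384 * t\<^sup>2 * ((?a N * (?n N)\<^sup>2 / 32) / hook_defect (lam N))"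
      unfolding sq using K by (simp add: field_simps)
    also have "\<dots> \<le> 384 * t\<^sup>2 * 1"
      using lower K by (intro mult_left_mono) auto
    finally show ?thesis using sdp by simp
  qed
  have x_sq: "(\<lambda>N. (?x N)\<^sup>2) \<longlonglongrightarrow> 0"
  proof (rule tendsto_sandwich[OF _ _ tendsto_const])
    show "\<forall>\<^sub>F N in sequentially. 0 \<le> (?x N)\<^sup>2" by simp
    show "\<forall>\<^sub>F N in sequentially. (?x N)\<^sup>2 \<le> 384 * t\<^sup>2 / ?a N"
      using a_pos by eventually_elim (use sd in \<open>auto simp: field_simps\<close>)
    show "(\<lambda>N. 384 * t\<^sup>2 / ?a N) \<longlonglongrightarrow> 0"
      by (rule real_tendsto_divide_at_top[OF tendsto_const a_top])
  qed
  have x_nonneg: "\<forall>\<^sub>F N in sequentially. 0 \<le> ?x N"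
    using a_pos by eventually_elim (use sd in \<open>force intro: mult_nonneg_nonneg divide_nonneg_pos\<close>)
  have x0: "?x \<longlonglongrightarrow> 0"
  proof -
    have "(\<lambda>N. sqrt ((?x N)\<^sup>2)) \<longlonglongrightarrow> sqrt 0" by (intro tendsto_intros x_sq)
    moreover have "\<forall>\<^sub>F N in sequentially. sqrt ((?x N)\<^sup>2) = ?x N"
      using x_nonneg by eventually_elim (simp only: real_sqrt_abs abs_of_nonneg)
    ultimately show ?thesis using Lim_transform_eventually by fastforce
  qed
  \<comment> \<open>The value 0 fills the removable gap, so that the limit along \<open>?x\<close>
    can be taken even where \<open>?x N\<close> is 0, as happens for t = 0.\<close>
  define q where "q = (\<lambda>x. if x = 0 then 0 else sinc_half_rem x / x\<^sup>2)"
  have q_eq: "sinc_half_rem y = y\<^sup>2 * q y" for y by (simp add: q_def)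
  have q_lim: "(\<lambda>N. q (?x N)) \<longlonglongrightarrow> 0"
  proof -
    have "(q \<longlongrightarrow> 0) (at_right 0)"
      using sinc_half_rem_small by (rule Lim_transform_eventually) (auto simp: q_def eventually_at_filter)
    hence "(q \<longlongrightarrow> q 0) (at 0 within {0..})"
      by (simp add: q_def at_within_Ici_at_right)
    hence "continuous (at 0 within {0..}) q" by (simp add: continuous_within)
    from continuous_within_tendsto_compose[OF this x_nonneg[folded atLeast_iff]  x0]
    show ?thesis by (simp add: q_def)
  qed
  have err: "(\<lambda>N. ?a N * sinc_half_rem (?x N)) \<longlonglongrightarrow> 0"
  proof (rule Lim_null_comparison)
    show "(\<lambda>N. 384 * t\<^sup>2 * \<bar>q (?x N)\<bar>) \<longlonglongrightarrow> 0"
      using tendsto_mult[OF tendsto_const[of "384 * t\<^sup>2"] tendsto_rabs[OF q_lim]] by simp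
    show "\<forall>\<^sub>F N in sequentially. norm (?a N * sinc_half_rem (?x N)) \<le> 384 * t\<^sup>2 * \<bar>q (?x N)\<bar>"
      using a_pos
    proof eventually_elim
      case (elim N)
      have "sinc_half_rem (?x N) = (?x N)\<^sup>2 * q (?x N)" by (rule q_eq)
      hence "norm (?a N * sinc_half_rem (?x N)) = ?a N * (?x N)\<^sup>2 * \<bar>q (?x N)\<bar>"
        by (simp only: abs_mult real_norm_def abs_of_nat abs_power2 mult.assoc)
      also have "\<dots> \<le> 384 * t\<^sup>2 * \<bar>q (?x N)\<bar>"
        using sd[OF elim] by (intro mult_right_mono) auto
      finally show ?case .
    qed
  qed
  have "\<forall>\<^sub>F N in sequentially. ?x N < pi"
    using x0 by (rule order_tendstoD) simp
  with a_pos have "\<forall>\<^sub>F N in sequentially. \<exists>D. char (normalized_maj_law (lam N)) t = of_real (exp (- (t\<^sup>2 / 2 + D))) \<and>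
      0 \<le> D \<and> D \<le> ?a N * sinc_half_rem (?x N)"
  proof eventually_elim
    case (elim N)
    have "maj_sd (lam N) \<noteq> 0" using sd[OF elim(1)] by simp
    from char_maj_law_exp[OF part this elim(2)] show ?case by blast
  qed
  then obtain D where D: "\<forall>\<^sub>F N in sequentially. char (normalized_maj_law (lam N)) t = of_real (exp (- (t\<^sup>2 / 2 + D N))) \<and>
      0 \<le> D N \<and> D N \<le> ?a N * sinc_half_rem (?x N)"
    unfolding eventually_ex by blast
  have "D \<longlonglongrightarrow> 0"
    by (rule tendsto_sandwich[OF _ _ tendsto_const err]) (use D in \<open>auto elim: eventually_mono\<close>)
  hence "(\<lambda>N. complex_of_real (exp (- (t\<^sup>2 / 2 + D N)))) \<longlonglongrightarrow> of_real (exp (- (t\<^sup>2 / 2 + 0)))"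
    by (intro tendsto_intros)
  moreover have "\<forall>\<^sub>F N in sequentially. complex_of_real (exp (- (t\<^sup>2 / 2 + D N))) = char (normalized_maj_law (lam N)) t"
    using D by eventually_elim simp
  ultimately show ?thesis using Lim_transform_eventually by fastforce
qed

section \<open>The Irwin-Hall limit\<close>

text \<open>For \<open>M = 0\<close> the division by zero is harmless, the value is 1.\<close>
definition ih_char :: "nat \<Rightarrow> real \<Rightarrow> real" where
  "ih_char M t = sinc_half (t / sqrt (real M / 12)) ^ M"

lemma isCont_ih_char: "isCont (ih_char M) t"
proof -
  have "isCont (\<lambda>t. sinc_half (t / sqrt (real M / 12)) ^ M) t"
    by (cases "M = 0") (auto intro!: continuous_intros isCont_o2[OF _ isCont_sinc_half])
  thus ?thesis by (simp add: ih_char_def[abs_def])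
qed

text \<open>\<open>A\<close> consists of the hooks of the first M cells of the longest line,
  \<open>B\<close> of the hooks outside that line; the other hooks of the line are 1, ..., n - 2 M.
  For M fixed and n growing, the entries of \<open>A\<close> divided by n tend to 1 and those of
  \<open>B\<close> to 0.\<close>

lemma hooks_long_row_split:
  assumes "is_partition l" "aft l = M" "2 * M \<le> sum_list l"
  obtains A B where "mset (hooks l) = mset A + mset [1..<Suc (sum_list l - 2 * M)] + mset B"
    "length A = M" "length B = M" "\<forall>h \<in> set A. sum_list l - 2 * M \<le> h \<and> h \<le> sum_list l"
    "\<forall>h \<in> set B. h \<le> M"
proof -
  obtain l' where l': "is_partition l'" "mset (hooks l') = mset (hooks l)" "sum_list l' = sum_list l"
    "length l' \<le> first_part l'" "aft l = sum_list l - first_part l'"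
    using wide_partition[OF assms(1)] .
  show ?thesis
  proof (cases l')
    case Nil
    have s: "sum_list l = 0" using l'(3) Nil by (simp only: sum_list.Nil)
    moreover have "M = 0" using assms(3) unfolding s by simp
    moreover have "hooks l = []" using l'(2) Nil by simp
    ultimately show ?thesis by (intro that[of "[]" "[]"]) (simp_all only:, simp_all)
  next
    case (Cons x m)
    hence m: "sum_list m = M" and x: "x = sum_list l - M"
      using l'(3,5) assms by (auto simp: first_part_def)
    let ?A = "map (\<lambda>c. x - c + length (filter (\<lambda>p. c < p) m)) [0..<M]"
    have "x - M = sum_list l - 2 * M" using x by simp
    hence "mset (hooks l) = mset ?A + mset [1..<Suc (sum_list l - 2 * M)] + mset (hooks m)"
      using mset_hooks_long_row[OF m, of x] l'(2) Cons x assms(3) by (simp only:)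
    moreover have "sum_list l - 2 * M \<le> h \<and> h \<le> sum_list l" if "h \<in> set ?A" for h
    proof -
      from that obtain c where c: "c < M" "h = x - c + length (filter (\<lambda>p. c < p) m)" by auto
      have "length (filter (\<lambda>p. c < p) m) \<le> M" using length_filter_le_sum_list[of c m] m by simp
      thus ?thesis using c x assms(3) by linarith
    qed
    moreover have "h \<le> M" if "h \<in> set (hooks m)" for h
      using hooks_le_sum_list[OF that] m by simp
    ultimately show ?thesis using m by (intro that[of ?A "hooks m"] ballI) (simp_all only: length_hooks length_map length_upt diff_zero)
  qed
qed

lemma prod_list_nth: "(\<Prod>h \<leftarrow> xs. f h) = (\<Prod>i<length xs. f (xs ! i))"
  by (simp add: prod.list_conv_set_nth lessThan_atLeast0)

lemma sum_list_nth: "(\<Sum>h \<leftarrow> xs. f h) = (\<Sum>i<length xs. f (xs ! i))"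
  by (simp add: sum.list_conv_set_nth lessThan_atLeast0)

text \<open>Serves both for the hooks and numbers close to n (limit 1) and for the bounded hooks
  (limit 0), without control over their individual values.\<close>

lemma
  fixes XS :: "nat \<Rightarrow> nat list" and a b n :: "nat \<Rightarrow> real"
  assumes len: "\<forall>\<^sub>F N in sequentially. length (XS N) = m"
    and bounds: "\<forall>\<^sub>F N in sequentially. \<forall>h \<in> set (XS N). a N \<le> real h / n N \<and> real h / n N \<le> b N"
    and a: "a \<longlonglongrightarrow> \<rho>" and b: "b \<longlonglongrightarrow> \<rho>"
  shows tendsto_prod_list_uniform:
      "y \<longlonglongrightarrow> v \<Longrightarrow> (\<lambda>N. \<Prod>h \<leftarrow> XS N. sinc_half (real h / n N * y N)) \<longlonglongrightarrow> sinc_half (\<rho> * v) ^ m"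
    and tendsto_sum_list_uniform: "(\<lambda>N. \<Sum>h \<leftarrow> XS N. (real h / n N)\<^sup>2) \<longlonglongrightarrow> real m * \<rho>\<^sup>2"
proof -
  have nth: "(\<lambda>N. real (XS N ! i) / n N) \<longlonglongrightarrow> \<rho>" if "i < m" for i
  proof (rule tendsto_sandwich[OF _ _ a b])
    have "\<forall>\<^sub>F N in sequentially. a N \<le> real (XS N ! i) / n N \<and> real (XS N ! i) / n N \<le> b N"
      using len bounds by eventually_elim (use that in auto)
    thus "\<forall>\<^sub>F N in sequentially. a N \<le> real (XS N ! i) / n N"
      "\<forall>\<^sub>F N in sequentially. real (XS N ! i) / n N \<le> b N" by (auto elim: eventually_mono)
  qed
  show "(\<lambda>N. \<Prod>h \<leftarrow> XS N. sinc_half (real h / n N * y N)) \<longlonglongrightarrow> sinc_half (\<rho> * v) ^ m" if y: "y \<longlonglongrightarrow> v"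
  proof (rule Lim_transform_eventually)
    have "(\<lambda>N. \<Prod>i<m. sinc_half (real (XS N ! i) / n N * y N)) \<longlonglongrightarrow> (\<Prod>i<m. sinc_half (\<rho> * v))"
      by (intro tendsto_prod tendsto_sinc_half tendsto_mult nth y) simp
    thus "(\<lambda>N. \<Prod>i<m. sinc_half (real (XS N ! i) / n N * y N)) \<longlonglongrightarrow> sinc_half (\<rho> * v) ^ m" by simp
    show "\<forall>\<^sub>F N in sequentially. (\<Prod>i<m. sinc_half (real (XS N ! i) / n N * y N)) = (\<Prod>h \<leftarrow> XS N. sinc_half (real h / n N * y N))"
      using len by eventually_elim (simp add: prod_list_nth)
  qed
  show "(\<lambda>N. \<Sum>h \<leftarrow> XS N. (real h / n N)\<^sup>2) \<longlonglongrightarrow> real m * \<rho>\<^sup>2"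
  proof (rule Lim_transform_eventually)
    have "(\<lambda>N. \<Sum>i<m. (real (XS N ! i) / n N)\<^sup>2) \<longlonglongrightarrow> (\<Sum>i<m. \<rho>\<^sup>2)"
      by (intro tendsto_sum tendsto_power nth) simp
    thus "(\<lambda>N. \<Sum>i<m. (real (XS N ! i) / n N)\<^sup>2) \<longlonglongrightarrow> real m * \<rho>\<^sup>2" by simp
    show "\<forall>\<^sub>F N in sequentially. (\<Sum>i<m. (real (XS N ! i) / n N)\<^sup>2) = (\<Sum>h \<leftarrow> XS N. (real h / n N)\<^sup>2)"
      using len by eventually_elim (simp add: sum_list_nth)
  qed
qed

lemma countable_sinc_half_zeros: "countable {t. sinc_half (c * t) = 0}"
proof (rule countable_subset)
  show "{t. sinc_half (c * t) = 0} \<subseteq> range (\<lambda>i :: int. 2 * of_int i * pi / c)"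
  proof
    fix t assume "t \<in> {t. sinc_half (c * t) = 0}"
    hence t: "sinc_half (c * t) = 0" by simp
    hence nz: "c * t \<noteq> 0" by (auto simp: sinc_half_def)
    hence "sin (c * t / 2) = 0" using t by (simp add: sinc_half_def)
    then obtain i :: int where "c * t / 2 = of_int i * pi" by (auto simp: sin_zero_iff_int2)
    moreover have "c \<noteq> 0" using nz by auto
    ultimately have "t = 2 * of_int i * pi / c" by (simp add: field_simps)
    thus "t \<in> range (\<lambda>i :: int. 2 * of_int i * pi / c)" by blast
  qed
qed simp

text \<open>The upper bound of the sandwich carries the factor \<open>aft l = 0\<close>, and a
  variance is nonnegative.\<close>

lemma hook_defect_zero_aft:
  assumes "is_partition l" "aft l = 0"
  shows "hook_defect l = 0"
proof -
  have "(\<Sum>k = 1..sum_list l. (real k)\<^sup>2) - (\<Sum>h \<leftarrow> hooks l. (real h)\<^sup>2) \<le> real (aft l) * (real (sum_list l))\<^sup>2"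
    by (rule sum_hooks_sandwich(2)[OF assms(1)]) (auto intro: power_mono)
  thus ?thesis
    using hook_defect_nonneg[OF is_partition_sorted[OF assms(1)]] assms(2) by (simp add: hook_defect_def)
qed

lemma char_maj_law_aft_0:
  assumes "is_partition l" "aft l = 0"
  shows "char (normalized_maj_law l) t = 1"
  using assms hook_defect_zero_aft[OF assms]
  by (intro char_maj_law_degenerate is_partition_sorted) (auto simp: maj_sd_def)

context
  fixes lam :: "nat \<Rightarrow> nat list" and M :: nat
  assumes part: "\<And>N. is_partition (lam N)"
    and size: "filterlim (\<lambda>N. sum_list (lam N)) at_top sequentially"
    and aft: "\<forall>\<^sub>F N in sequentially. aft (lam N) = M"
    and M: "M > 0"
begin

lemma hook_split_sequence:
  obtains A B where
    "\<forall>\<^sub>F N in sequentially. mset (hooks (lam N)) =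
      mset (A N) + mset [1..<Suc (sum_list (lam N) - 2 * M)] + mset (B N)"
    "\<forall>\<^sub>F N in sequentially. length (A N) = M" "\<forall>\<^sub>F N in sequentially. length (B N) = M"
    "\<forall>\<^sub>F N in sequentially. \<forall>h \<in> set (A N). sum_list (lam N) - 2 * M \<le> h \<and> h \<le> sum_list (lam N)"
    "\<forall>\<^sub>F N in sequentially. \<forall>h \<in> set (B N). h \<le> M"
proof -
  have "\<forall>\<^sub>F N in sequentially. 2 * M \<le> sum_list (lam N)"
    using size unfolding filterlim_at_top by blast
  with aft have "\<forall>\<^sub>F N in sequentially. \<exists>AB. mset (hooks (lam N)) =
      mset (fst AB) + mset [1..<Suc (sum_list (lam N) - 2 * M)] + mset (snd AB) \<and>
      length (fst AB) = M \<and> length (snd AB) = M \<and>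
      (\<forall>h \<in> set (fst AB). sum_list (lam N) - 2 * M \<le> h \<and> h \<le> sum_list (lam N)) \<and>
      (\<forall>h \<in> set (snd AB). h \<le> M)"
  proof eventually_elim
    case (elim N)
    obtain A B where "mset (hooks (lam N)) = mset A + mset [1..<Suc (sum_list (lam N) - 2 * M)] + mset B"
      "length A = M" "length B = M" "\<forall>h \<in> set A. sum_list (lam N) - 2 * M \<le> h \<and> h \<le> sum_list (lam N)"
      "\<forall>h \<in> set B. h \<le> M"
      using hooks_long_row_split[OF part elim] .
    thus ?case by (intro exI[of _ "(A, B)"]) auto
  qed
  then obtain AB where "\<forall>\<^sub>F N in sequentially. mset (hooks (lam N)) =
      mset (fst (AB N)) + mset [1..<Suc (sum_list (lam N) - 2 * M)] + mset (snd (AB N)) \<and>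
      length (fst (AB N)) = M \<and> length (snd (AB N)) = M \<and>
      (\<forall>h \<in> set (fst (AB N)). sum_list (lam N) - 2 * M \<le> h \<and> h \<le> sum_list (lam N)) \<and>
      (\<forall>h \<in> set (snd (AB N)). h \<le> M)"
    unfolding eventually_ex by blast
  thus ?thesis
    by (intro that[of "\<lambda>N. fst (AB N)" "\<lambda>N. snd (AB N)"]) (auto elim: eventually_mono)
qed

text \<open>\<open>C\<close> holds the 2 M numbers n - 2 M + 1, ..., n. The defect divided by n^2
  tends to 2 M - M - 0 = M, hence sd / n to sqrt (M / 12), and with v = t / sqrt (M / 12) the
  quotient of the sines tends to S(v)^(2 M) / (S(v)^M * 1). The assumptions keep the cancelled
  factors and the limiting denominator away from 0.\<close>

lemma char_maj_law_generic_limit: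
  assumes nz: "\<And>N k. k > 0 \<Longrightarrow> sinc_half (real k * (t / maj_sd (lam N))) \<noteq> 0"
    and v: "sinc_half (t / sqrt (real M / 12)) \<noteq> 0"
  shows "(\<lambda>N. char (normalized_maj_law (lam N)) t) \<longlonglongrightarrow> of_real (ih_char M t)"
proof -
  let ?n = "\<lambda>N. sum_list (lam N)"
  obtain A B where hooks: "\<forall>\<^sub>F N in sequentially. mset (hooks (lam N)) =
      mset (A N) + mset [1..<Suc (?n N - 2 * M)] + mset (B N)"
    and lenA: "\<forall>\<^sub>F N in sequentially. length (A N) = M" and lenB: "\<forall>\<^sub>F N in sequentially. length (B N) = M"
    and bA: "\<forall>\<^sub>F N in sequentially. \<forall>h \<in> set (A N). ?n N - 2 * M \<le> h \<and> h \<le> ?n N"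
    and bB: "\<forall>\<^sub>F N in sequentially. \<forall>h \<in> set (B N). h \<le> M"
    using hook_split_sequence .
  define C where "C = (\<lambda>N. [Suc (?n N - 2 * M)..<Suc (?n N)])"
  have large: "\<forall>\<^sub>F N in sequentially. Suc (2 * M) \<le> ?n N"
    using size unfolding filterlim_at_top by blast
  have n_top: "filterlim (\<lambda>N. real (?n N)) at_top sequentially"
    by (rule filterlim_compose[OF filterlim_real_sequentially size])
  define lo where "lo = (\<lambda>N. 1 - 2 * real M / real (?n N))"
  define up where "up = (\<lambda>N. real M / real (?n N))"
  have lo: "lo \<longlonglongrightarrow> 1"
  proof -
    have "(\<lambda>N. 1 - 2 * real M / real (?n N)) \<longlonglongrightarrow> 1 - 0"
      by (intro tendsto_diff tendsto_const real_tendsto_divide_at_top[OF tendsto_const n_top])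
    thus ?thesis by (simp add: lo_def)
  qed
  have up: "up \<longlonglongrightarrow> 0"
    unfolding up_def by (rule real_tendsto_divide_at_top[OF tendsto_const n_top])
  have near1: "lo N \<le> real h / real (?n N) \<and> real h / real (?n N) \<le> 1"
    if "Suc (2 * M) \<le> ?n N" "?n N - 2 * M \<le> h" "h \<le> ?n N" for N h
  proof -
    have pos: "0 < real (?n N)" using that(1) by linarith
    have "(real (?n N) - 2 * real M) / real (?n N) \<le> real h / real (?n N)"
      using that by (intro divide_right_mono) linarith+
    moreover have "lo N = (real (?n N) - 2 * real M) / real (?n N)"
      unfolding lo_def diff_divide_distrib divide_self[OF less_imp_neq[OF pos, symmetric]] ..
    moreover have "real h / real (?n N) \<le> 1" using that(3) pos by (intro divide_le_eq_1_pos[THEN iffD2]) linarith+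
    ultimately show ?thesis by linarith
  qed
  have lenC: "\<forall>\<^sub>F N in sequentially. length (C N) = 2 * M"
    using large by eventually_elim (simp add: C_def del: upt_Suc)
  have bC': "\<forall>\<^sub>F N in sequentially. \<forall>h \<in> set (C N). lo N \<le> real h / real (?n N) \<and> real h / real (?n N) \<le> 1"
    using large by eventually_elim (use near1 in \<open>auto simp: C_def simp del: upt_Suc\<close>)
  have bA': "\<forall>\<^sub>F N in sequentially. \<forall>h \<in> set (A N). lo N \<le> real h / real (?n N) \<and> real h / real (?n N) \<le> 1"
    using large bA by eventually_elim (use near1 in blast)
  have bB': "\<forall>\<^sub>F N in sequentially. \<forall>h \<in> set (B N). 0 \<le> real h / real (?n N) \<and> real h / real (?n N) \<le> up N"
    using bB by eventually_elim (auto simp: up_def divide_right_mono)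
  note limC = lenC bC' lo tendsto_const[of 1]
  note limA = lenA bA' lo tendsto_const[of 1]
  note limB = lenB bB' tendsto_const[of 0] up
  have upt_split: "[1..<Suc (?n N)] = [1..<Suc (?n N - 2 * M)] @ C N" for N
    unfolding C_def using upt_add_eq_append[of 1 "Suc (?n N - 2 * M)" "?n N - (?n N - 2 * M)"] by simp
  have defect: "\<forall>\<^sub>F N in sequentially. hook_defect (lam N) / (real (?n N))\<^sup>2 =
      (\<Sum>h \<leftarrow> C N. (real h / real (?n N))\<^sup>2) - (\<Sum>h \<leftarrow> A N. (real h / real (?n N))\<^sup>2) - (\<Sum>h \<leftarrow> B N. (real h / real (?n N))\<^sup>2)"
    using hooks
  proof eventually_elim
    case (elim N)
    have sq: "(\<Sum>h \<leftarrow> xs. (real h / real (?n N))\<^sup>2) = (\<Sum>h \<leftarrow> xs. (real h)\<^sup>2) / (real (?n N))\<^sup>2" for xs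
      by (induction xs) (auto simp: power_divide add_divide_distrib)
    have "(\<Sum>h \<leftarrow> hooks (lam N). (real h)\<^sup>2) = (\<Sum>h \<leftarrow> A N @ [1..<Suc (?n N - 2 * M)] @ B N. (real h)\<^sup>2)"
      by (rule sum_list_map_cong_mset) (simp only: elim mset_append add.assoc)
    hence "hook_defect (lam N) = (\<Sum>h \<leftarrow> C N. (real h)\<^sup>2) - (\<Sum>h \<leftarrow> A N. (real h)\<^sup>2) - (\<Sum>h \<leftarrow> B N. (real h)\<^sup>2)"
      unfolding sum_squares_hook_defect[symmetric] upt_split by simp
    thus ?case unfolding sq by (simp add: diff_divide_distrib)
  qed
  have "(\<lambda>N. hook_defect (lam N) / (real (?n N))\<^sup>2) \<longlonglongrightarrow> real M"
  proof -
    have "(\<lambda>N. (\<Sum>h \<leftarrow> C N. (real h / real (?n N))\<^sup>2) - (\<Sum>h \<leftarrow> A N. (real h / real (?n N))\<^sup>2) -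
        (\<Sum>h \<leftarrow> B N. (real h / real (?n N))\<^sup>2)) \<longlonglongrightarrow> real (2 * M) * 1\<^sup>2 - real M * 1\<^sup>2 - real M * 0\<^sup>2"
      by (intro tendsto_diff tendsto_sum_list_uniform[OF limC] tendsto_sum_list_uniform[OF limA]
          tendsto_sum_list_uniform[OF limB])
    hence "(\<lambda>N. (\<Sum>h \<leftarrow> C N. (real h / real (?n N))\<^sup>2) - (\<Sum>h \<leftarrow> A N. (real h / real (?n N))\<^sup>2) -
        (\<Sum>h \<leftarrow> B N. (real h / real (?n N))\<^sup>2)) \<longlonglongrightarrow> real M" by simp
    thus ?thesis by (rule Lim_transform_eventually) (use defect in \<open>auto elim: eventually_mono\<close>)
  qed
  hence "(\<lambda>N. sqrt (hook_defect (lam N) / (real (?n N))\<^sup>2 / 12)) \<longlonglongrightarrow> sqrt (real M / 12)"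
    by (intro tendsto_intros) auto
  moreover have "sqrt (hook_defect (lam N) / (real (?n N))\<^sup>2 / 12) = maj_sd (lam N) / real (?n N)" for N
  proof -
    have "hook_defect (lam N) / (real (?n N))\<^sup>2 / 12 = hook_defect (lam N) / 12 / (real (?n N))\<^sup>2"
      by (simp only: divide_divide_eq_left mult.commute)
    thus ?thesis by (simp only: maj_sd_def real_sqrt_divide real_sqrt_abs abs_of_nat)
  qed
  ultimately have sd_lim: "(\<lambda>N. maj_sd (lam N) / real (?n N)) \<longlonglongrightarrow> sqrt (real M / 12)" by simp
  define y where "y = (\<lambda>N. t / (maj_sd (lam N) / real (?n N)))"
  let ?v = "t / sqrt (real M / 12)"
  have y: "y \<longlonglongrightarrow> ?v"
    unfolding y_def using M by (intro tendsto_divide tendsto_const sd_lim) simp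
  let ?P = "\<lambda>N xs. \<Prod>h \<leftarrow> xs. sinc_half (real h / real (?n N) * y N)"
  have scale: "\<forall>\<^sub>F N in sequentially. \<forall>k. real k / real (?n N) * y N = real k * (t / maj_sd (lam N))"
    using large
  proof eventually_elim
    case (elim N)
    have "real (?n N) \<noteq> 0" using elim by linarith
    moreover have "k / n * (t / (d / n)) = k * (t / d)" if "n \<noteq> 0" for k n d :: real using that by simp
    ultimately show ?case unfolding y_def by blast
  qed
  have eq: "\<forall>\<^sub>F N in sequentially. of_real (?P N (C N) / (?P N (A N) * ?P N (B N))) = char (normalized_maj_law (lam N)) t"
    using scale hooks
  proof eventually_elim
    case (elim N)
    let ?D = "[1..<Suc (?n N - 2 * M)]"
    have scale: "real k * (t / maj_sd (lam N)) = real k / real (?n N) * y N" for k using elim(1) by simp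
    have hk: "?P N (hooks (lam N)) = ?P N (A N @ ?D @ B N)"
      by (rule prod_list_map_cong_mset) (simp only: elim mset_append add.assoc)
    have "?P N (hooks (lam N)) \<noteq> 0"
      using nz[OF hooks_pos, of _ "lam N" N] unfolding scale by (auto simp: prod_list_zero_iff)
    hence nz: "?P N (A N) \<noteq> 0" "?P N ?D \<noteq> 0" "?P N (B N) \<noteq> 0" unfolding hk by (auto simp del: upt_Suc)
    have "char (normalized_maj_law (lam N)) t * of_real (?P N (hooks (lam N))) = of_real (?P N [1..<Suc (?n N)])"
      using char_maj_law[OF is_partition_sorted[OF part], of N t] unfolding scale .
    hence "char (normalized_maj_law (lam N)) t * of_real (?P N (A N) * ?P N (B N)) * of_real (?P N ?D) =
        of_real (?P N (C N)) * of_real (?P N ?D)"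
      unfolding hk upt_split by (simp add: mult_ac del: upt_Suc)
    hence "char (normalized_maj_law (lam N)) t * of_real (?P N (A N) * ?P N (B N)) = of_real (?P N (C N))"
      using nz(2) by (metis mult_right_cancel of_real_eq_0_iff)
    thus ?case using nz(1,3) by (simp add: field_simps)
  qed
  have "(\<lambda>N. ?P N (C N) / (?P N (A N) * ?P N (B N))) \<longlonglongrightarrow>
      sinc_half (1 * ?v) ^ (2 * M) / (sinc_half (1 * ?v) ^ M * sinc_half (0 * ?v) ^ M)"
    using v by (intro tendsto_divide tendsto_mult tendsto_prod_list_uniform[OF limC y]
      tendsto_prod_list_uniform[OF limA y] tendsto_prod_list_uniform[OF limB y]) simp
  hence "(\<lambda>N. ?P N (C N) / (?P N (A N) * ?P N (B N))) \<longlonglongrightarrow> ih_char M t"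
    using v by (simp add: ih_char_def mult_2 power_add)
  hence "(\<lambda>N. complex_of_real (?P N (C N) / (?P N (A N) * ?P N (B N)))) \<longlonglongrightarrow> of_real (ih_char M t)"
    by (rule tendsto_of_real)
  thus ?thesis
    using eq by (rule Lim_transform_eventually)
qed

text \<open>The zeros excluded in the generic case form a countable set, hence have dense complement;
  the characteristic functions are equi-Lipschitz because the variances are at most 1.\<close>
lemma char_maj_law_limit_pos:
  "(\<lambda>N. char (normalized_maj_law (lam N)) t) \<longlonglongrightarrow> of_real (ih_char M t)"
proof (rule tendstoI)
  fix e :: real assume e: "e > 0"
  let ?bad = "(\<Union>N. \<Union>k. {t. sinc_half (real k / maj_sd (lam N) * t) = 0}) \<union> {t. sinc_half (1 / sqrt (real M / 12) * t) = 0}"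
  have "countable ?bad" by (intro countable_Un countable_UN countable_sinc_half_zeros) auto
  have "(\<lambda>s. ih_char M s) \<midarrow>t\<rightarrow> ih_char M t" using isCont_ih_char by (simp add: isCont_def)
  then obtain d where d: "d > 0" "\<And>s. s \<noteq> t \<Longrightarrow> \<bar>s - t\<bar> < d \<Longrightarrow> \<bar>ih_char M s - ih_char M t\<bar> < e / 3"
    using e LIM_D[of "ih_char M" "ih_char M t" t "e / 3"] by auto
  \<comment> \<open>The bound \<open>e / 3\<close> controls the change of the characteristic
    functions between \<open>s\<close> and \<open>t\<close>, the bound \<open>d\<close> that of
    their limit.\<close>
  have "uncountable {t<..<t + min d (e / 3)}" using d e by (simp add: uncountable_open_interval)
  with \<open>countable ?bad\<close> obtain s where s: "s \<in> {t<..<t + min d (e / 3)}" "s \<notin> ?bad"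
    by (meson countable_subset subsetI)
  have st: "t < s" "s < t + d" "s < t + e / 3" using s(1) by auto
  have lim: "(\<lambda>N. char (normalized_maj_law (lam N)) s) \<longlonglongrightarrow> of_real (ih_char M s)"
    by (rule char_maj_law_generic_limit) (use s(2) in auto)
  have "\<forall>\<^sub>F N in sequentially. dist (char (normalized_maj_law (lam N)) s) (of_real (ih_char M s)) < e / 3"
    using tendstoD[OF lim, of "e / 3"] e by simp
  thus "\<forall>\<^sub>F N in sequentially. dist (char (normalized_maj_law (lam N)) t) (of_real (ih_char M t)) < e"
  proof eventually_elim
    case (elim N)
    have "dist (char (normalized_maj_law (lam N)) t) (char (normalized_maj_law (lam N)) s) < e / 3"
      using char_maj_law_lipschitz[OF is_partition_sorted[OF part], of N t s] st by (simp add: dist_norm)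
    moreover have "dist (complex_of_real (ih_char M s)) (of_real (ih_char M t)) < e / 3"
      using d(2)[of s] st by (simp add: dist_norm flip: of_real_diff)
    ultimately show ?case using elim
      using dist_triangle[of "char (normalized_maj_law (lam N)) t" "of_real (ih_char M t)" "char (normalized_maj_law (lam N)) s"]
        dist_triangle[of "char (normalized_maj_law (lam N)) s" "of_real (ih_char M t)" "of_real (ih_char M s)"]
      by linarith
  qed
qed

end

lemma char_maj_law_irwin_hall_limit:
  assumes part: "\<And>N. is_partition (lam N)"
    and size: "filterlim (\<lambda>N. sum_list (lam N)) at_top sequentially"
    and aft: "(\<lambda>N. aft (lam N)) \<longlonglongrightarrow> M"
  shows "(\<lambda>N. char (normalized_maj_law (lam N)) t) \<longlonglongrightarrow> of_real (ih_char M t)"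
proof -
  have ev: "\<forall>\<^sub>F N in sequentially. aft (lam N) = M"
    using aft by (simp add: tendsto_discrete)
  show ?thesis
  proof (cases "M = 0")
    case True
    have "\<forall>\<^sub>F N in sequentially. 1 = char (normalized_maj_law (lam N)) t"
      using ev by eventually_elim (simp add: char_maj_law_aft_0 part True)
    thus ?thesis using True by (simp add: ih_char_def tendsto_eventually eq_commute[of 1])
  next
    case False
    thus ?thesis using char_maj_law_limit_pos[OF part size ev] by simp
  qed
qed

section \<open>The characteristic function of the Irwin-Hall law\<close>

abbreviation unit_unif :: "real measure" where
  "unit_unif \<equiv> uniform_measure lborel {0..1}"

lemma prob_space_unit_unif: "prob_space unit_unif"
  by (rule prob_space_uniform_measure) auto

lemma
  fixes F f :: "real \<Rightarrow> 'b::euclidean_space"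
  assumes "\<And>x. 0 \<le> x \<Longrightarrow> x \<le> 1 \<Longrightarrow> (F has_vector_derivative f x) (at x within {0..1})"
    and cont: "continuous_on UNIV f"
  shows integral_unit_unif: "integral\<^sup>L unit_unif f = F 1 - F 0"
    and integrable_unit_unif: "integrable unit_unif f"
proof -
  have [measurable]: "f \<in> borel_measurable borel"
    using cont by (rule borel_measurable_continuous_onI)
  have eq: "unit_unif = density lborel (\<lambda>x. ennreal (indicator {0..1} x))"
    unfolding uniform_measure_def by (intro density_cong) (auto simp: indicator_def divide_ennreal_def)
  have bi: "has_bochner_integral lborel (\<lambda>x. indicator {0..1} x *\<^sub>R f x) (F 1 - F 0)"
    using assms by (intro has_bochner_integral_FTC_Icc) (auto intro: continuous_on_subset)
  show "integral\<^sup>L unit_unif f = F 1 - F 0"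
    unfolding eq by (subst integral_density) (auto intro!: has_bochner_integral_integral_eq bi)
  show "integrable unit_unif f"
    unfolding eq by (subst integrable_density) (auto intro!: has_bochner_integral_iff[THEN iffD1, THEN conjunct1] bi)
qed

lemma char_unit_unif: "char unit_unif t = cis (t / 2) * of_real (sinc_half t)"
proof (cases "t = 0")
  case True
  interpret prob_space unit_unif by (rule prob_space_unit_unif)
  show ?thesis using True prob_space by (simp add: char_def)
next
  case False
  have "char unit_unif t = iexp (t * 1) / (\<i> * t) - iexp (t * 0) / (\<i> * t)"
    unfolding char_def
    by (rule integral_unit_unif)
       (use False in \<open>auto intro!: derivative_eq_intros continuous_intros simp: has_vector_derivative_complex_iff Re_exp Im_exp Re_divide Im_divide power2_eq_square\<close>)
  also have "\<dots> = - (1 - cis t) / (\<i> * t)" by (simp add: cis_conv_exp diff_divide_distrib)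
  also have "\<dots> = cis (t / 2) * of_real (sinc_half t)"
    unfolding one_minus_cis using False by (simp add: sinc_half_def field_simps)
  finally show ?thesis .
qed

lemma
  shows expectation_unit_unif: "(\<integral>x. x - 1 / 2 \<partial>unit_unif) = 0"
    and integrable_unit_unif_id: "integrable unit_unif (\<lambda>x. x - 1 / 2)"
    and variance_unit_unif: "(\<integral>x. (x - 1 / 2)\<^sup>2 \<partial>unit_unif) = 1 / 12"
    and integrable_unit_unif_square: "integrable unit_unif (\<lambda>x. (x - 1 / 2)\<^sup>2)"
proof -
  have 1: "((\<lambda>x. (x - 1 / 2)\<^sup>2 / 2) has_vector_derivative (x - 1 / 2)) (at x within {0..1})" for x :: real
    by (auto intro!: derivative_eq_intros simp: has_real_derivative_iff_has_vector_derivative[symmetric])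
  have 2: "((\<lambda>x. (x - 1 / 2) ^ 3 / 3) has_vector_derivative (x - 1 / 2)\<^sup>2) (at x within {0..1})" for x :: real
    by (auto intro!: derivative_eq_intros simp: has_real_derivative_iff_has_vector_derivative[symmetric])
  show "(\<integral>x. x - 1 / 2 \<partial>unit_unif) = 0"
    by (subst integral_unit_unif[OF 1]) (auto intro!: continuous_intros simp: power2_eq_square)
  show "(\<integral>x. (x - 1 / 2)\<^sup>2 \<partial>unit_unif) = 1 / 12"
    by (subst integral_unit_unif[OF 2]) (auto intro!: continuous_intros simp: power3_eq_cube)
  show "integrable unit_unif (\<lambda>x. x - 1 / 2)"
    by (rule integrable_unit_unif[OF 1]) (auto intro!: continuous_intros)
  show "integrable unit_unif (\<lambda>x. (x - 1 / 2)\<^sup>2)"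
    by (rule integrable_unit_unif[OF 2]) (auto intro!: continuous_intros)
qed

abbreviation unit_cube :: "nat \<Rightarrow> (nat \<Rightarrow> real) measure" where
  "unit_cube m \<equiv> PiM {..<m} (\<lambda>_. unit_unif)"

lemma prob_space_unit_cube: "prob_space (unit_cube m)"
  by (intro prob_space_PiM prob_space_unit_unif)

lemma measurable_cube_component [measurable]: "k < m \<Longrightarrow> (\<lambda>u. u k) \<in> borel_measurable (unit_cube m)"
  using measurable_component_singleton[of k "{..<m}" "\<lambda>_. unit_unif"] by (simp cong: measurable_cong_sets)

lemma distr_cube_component: "k < m \<Longrightarrow> distr (unit_cube m) borel (\<lambda>u. u k) = unit_unif"
  using distr_PiM_component[of "{..<m}" "\<lambda>_. unit_unif" k] prob_space_unit_unif
  by (simp cong: distr_cong)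

lemma indep_vars_unit_cube: "prob_space.indep_vars (unit_cube m) (\<lambda>_. borel) (\<lambda>k u. u k) {..<m}"
proof (cases "m = 0")
  case True
  interpret prob_space "unit_cube m" by (rule prob_space_unit_cube)
  show ?thesis unfolding indep_vars_def indep_sets_def using True by auto
next
  case False
  interpret prob_space "unit_cube m" by (rule prob_space_unit_cube)
  have "distr (unit_cube m) (PiM {..<m} (\<lambda>_. borel)) (\<lambda>u. \<lambda>k\<in>{..<m}. u k) = distr (unit_cube m) (unit_cube m) (\<lambda>u. u)"
    by (intro distr_cong sets_PiM_cong) (auto simp: space_PiM PiE_def extensional_def fun_eq_iff)
  also have "\<dots> = PiM {..<m} (\<lambda>k. distr (unit_cube m) borel (\<lambda>u. u k))"
    by (simp add: distr_id2) (intro PiM_cong refl, simp add: distr_cube_component)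
  finally show ?thesis
    using False by (subst indep_vars_iff_distr_eq_PiM') auto
qed

lemma integral_cube_component:
  fixes f :: "real \<Rightarrow> real"
  assumes "k < m" "f \<in> borel_measurable borel"
  shows "(\<integral>u. f (u k) \<partial>unit_cube m) = integral\<^sup>L unit_unif f"
    and "integrable (unit_cube m) (\<lambda>u. f (u k)) \<longleftrightarrow> integrable unit_unif f"
proof -
  have m: "(\<lambda>u. u k) \<in> measurable (unit_cube m) borel" using assms(1) by simp
  show "(\<integral>u. f (u k) \<partial>unit_cube m) = integral\<^sup>L unit_unif f"
    using integral_distr[OF m assms(2)] distr_cube_component[OF assms(1)] by simp
  show "integrable (unit_cube m) (\<lambda>u. f (u k)) \<longleftrightarrow> integrable unit_unif f"
    using integrable_distr_eq[OF m assms(2)] distr_cube_component[OF assms(1)] by simp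
qed

text \<open>After centring, the mixed products have mean 0 by independence, so the variances 1/12
  add up.\<close>

lemma
  shows expectation_cube_sum: "(\<integral>u. (\<Sum>k<m. u k - 1 / 2) \<partial>unit_cube m) = 0"
    and variance_cube_sum: "(\<integral>u. (\<Sum>k<m. u k - 1 / 2)\<^sup>2 \<partial>unit_cube m) = real m / 12"
    and integrable_cube_sum: "integrable (unit_cube m) (\<lambda>u. \<Sum>k<m. u k - 1 / 2)"
proof -
  interpret prob_space "unit_cube m" by (rule prob_space_unit_cube)
  have int: "integrable (unit_cube m) (\<lambda>u. u k - 1 / 2)" "(\<integral>u. u k - 1 / 2 \<partial>unit_cube m) = 0"
    if "k < m" for k
    using integral_cube_component[OF that, of "\<lambda>x. x - 1 / 2"] expectation_unit_unif integrable_unit_unif_id by auto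
  show "integrable (unit_cube m) (\<lambda>u. \<Sum>k<m. u k - 1 / 2)" by (intro Bochner_Integration.integrable_sum int) simp
  show "(\<integral>u. (\<Sum>k<m. u k - 1 / 2) \<partial>unit_cube m) = 0"
    by (subst Bochner_Integration.integral_sum) (auto simp: int)
  have prod: "integrable (unit_cube m) (\<lambda>u. (u j - 1 / 2) * (u k - 1 / 2)) \<and>
      (\<integral>u. (u j - 1 / 2) * (u k - 1 / 2) \<partial>unit_cube m) = (if j = k then 1 / 12 else 0)"
    if jk: "j < m" "k < m" for j k
  proof (cases "j = k")
    case True
    thus ?thesis
      using integral_cube_component[OF jk(1), of "\<lambda>x. (x - 1 / 2)\<^sup>2"] variance_unit_unif integrable_unit_unif_square
      by (simp add: power2_eq_square)
  next
    case False
    have "indep_vars (\<lambda>_. borel) (\<lambda>k u. u k - 1 / 2) {..<m}"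
      using indep_vars_unit_cube by (rule indep_vars_compose2) simp
    hence ind: "indep_vars (\<lambda>_. borel) (\<lambda>k u. u k - 1 / 2) {j, k}"
      by (rule indep_vars_subset) (use jk in auto)
    have "integrable (unit_cube m) (\<lambda>u. \<Prod>i \<in> {j, k}. u i - 1 / 2)"
      by (rule indep_vars_integrable[OF _ ind]) (use int jk in auto)
    moreover have "(\<integral>u. (\<Prod>i \<in> {j, k}. u i - 1 / 2) \<partial>unit_cube m) = (\<Prod>i \<in> {j, k}. \<integral>u. u i - 1 / 2 \<partial>unit_cube m)"
      by (rule indep_vars_lebesgue_integral[OF _ ind]) (use int jk in auto)
    ultimately show ?thesis using False int jk by simp
  qed
  have "(\<integral>u. (\<Sum>k<m. u k - 1 / 2)\<^sup>2 \<partial>unit_cube m) =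
      (\<integral>u. (\<Sum>j<m. \<Sum>k<m. (u j - 1 / 2) * (u k - 1 / 2)) \<partial>unit_cube m)"
    by (simp only: power2_eq_square sum_product)
  also have "\<dots> = (\<Sum>j<m. \<Sum>k<m. \<integral>u. (u j - 1 / 2) * (u k - 1 / 2) \<partial>unit_cube m)"
    using prod by (subst Bochner_Integration.integral_sum)
      (auto intro!: sum.cong Bochner_Integration.integral_sum Bochner_Integration.integrable_sum)
  also have "\<dots> = (\<Sum>j<m. \<Sum>k<m. if j = k then 1 / 12 else 0)"
    by (intro sum.cong refl) (use prod in auto)
  also have "\<dots> = real m / 12" by (simp add: sum.delta)
  finally show "(\<integral>u. (\<Sum>k<m. u k - 1 / 2)\<^sup>2 \<partial>unit_cube m) = real m / 12" .
qed

lemma real_distribution_irwin_hall: "real_distribution (irwin_hall m)"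
  unfolding irwin_hall_def
  by (intro prob_space.real_distribution_distr prob_space_unit_cube borel_measurable_sum) simp

lemma char_irwin_hall: "char (irwin_hall m) t = cis (real m * t / 2) * of_real (sinc_half t ^ m)"
proof -
  interpret prob_space "unit_cube m" by (rule prob_space_unit_cube)
  have "char (irwin_hall m) t = (\<Prod>k<m. char (distr (unit_cube m) borel (\<lambda>u. u k)) t)"
    unfolding irwin_hall_def by (rule char_distr_sum[OF indep_vars_unit_cube])
  also have "\<dots> = (\<Prod>k<m. cis (t / 2) * of_real (sinc_half t))"
    by (intro prod.cong refl) (simp add: distr_cube_component char_unit_unif)
  also have "\<dots> = cis (real m * t / 2) * of_real (sinc_half t ^ m)"
    by (simp add: power_mult_distrib Complex.DeMoivre)
  finally show ?thesis .
qed

lemma integral_irwin_hall: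
  fixes f :: "real \<Rightarrow> real"
  assumes "f \<in> borel_measurable borel"
  shows "integral\<^sup>L (irwin_hall m) f = (\<integral>u. f (\<Sum>k<m. u k) \<partial>unit_cube m)"
  unfolding irwin_hall_def using assms by (intro integral_distr borel_measurable_sum) simp_all

lemma sum_centred: "(\<Sum>k<m. u k - 1 / 2) = (\<Sum>k<m. u k) - real m / 2" for u :: "nat \<Rightarrow> real"
  by (simp add: sum_subtractf)

lemma expectation_irwin_hall: "(\<integral>x. x \<partial>irwin_hall m) = real m / 2"
proof -
  interpret prob_space "unit_cube m" by (rule prob_space_unit_cube)
  have "(\<integral>x. x \<partial>irwin_hall m) = (\<integral>u. (\<Sum>k<m. u k - 1 / 2) + real m / 2 \<partial>unit_cube m)"
    by (simp add: integral_irwin_hall sum_centred)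
  also have "\<dots> = real m / 2"
    by (subst Bochner_Integration.integral_add[OF integrable_cube_sum])
       (simp_all add: expectation_cube_sum prob_space)
  finally show ?thesis .
qed

lemma std_dev_irwin_hall: "std_dev (irwin_hall m) (\<lambda>x. x) = sqrt (real m / 12)"
  unfolding std_dev_def expectation_irwin_hall
  by (subst integral_irwin_hall) (simp_all add: variance_cube_sum flip: sum_centred)

lemma real_distribution_normalized_irwin_hall: "real_distribution (normalized_irwin_hall m)"
  unfolding normalized_irwin_hall_def normalized_law_def normalized_def
  using real_distribution_irwin_hall[of m]
  by (intro prob_space.real_distribution_distr) (auto simp: real_distribution_def irwin_hall_def)

lemma char_normalized_irwin_hall: "char (normalized_irwin_hall m) t = of_real (ih_char m t)"
proof -
  let ?s = "sqrt (real m / 12)"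
  \<comment> \<open>This includes \<open>m = 0\<close>, where the deviation is 0 and division by
    zero agrees with the default in \<open>normalized\<close>.\<close>
  have norm: "normalized (irwin_hall m) (\<lambda>x. x) x = (x - real m / 2) / ?s" for x
    by (simp add: normalized_def std_dev_irwin_hall expectation_irwin_hall)
  have "char (normalized_irwin_hall m) t = (\<integral>x. iexp (t * ((x - real m / 2) / ?s)) \<partial>irwin_hall m)"
    unfolding normalized_irwin_hall_def normalized_law_def char_def norm[abs_def]
    by (subst integral_distr) (auto simp: irwin_hall_def)
  also have "\<dots> = (\<integral>x. cis (- (t / ?s * (real m / 2))) * iexp (t / ?s * x) \<partial>irwin_hall m)"
    by (intro Bochner_Integration.integral_cong refl)
       (simp add: cis_conv_exp exp_add[symmetric] algebra_simps diff_divide_distrib)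
  also have "\<dots> = cis (- (t / ?s * (real m / 2))) * char (irwin_hall m) (t / ?s)"
    by (simp add: char_def)
  also have "\<dots> = cis (- (t / ?s * (real m / 2))) * cis (real m * (t / ?s) / 2) * of_real (ih_char m t)"
    by (simp add: char_irwin_hall ih_char_def)
  also have "cis (- (t / ?s * (real m / 2))) * cis (real m * (t / ?s) / 2) = 1"
    by (simp add: cis_mult)
  finally show ?thesis by simp
qed

section \<open>Classification of the limits\<close>

lemma normal_limit:
  assumes "\<And>N. is_partition (lam N)" "filterlim (\<lambda>N. aft (lam N)) at_top sequentially"
  shows "weak_conv_m (\<lambda>N. normalized_maj_law (lam N)) std_normal_distribution"
proof (rule levy_continuity)
  show "real_distribution std_normal_distribution" by (rule real_dist_normal_dist)
  show "(\<lambda>N. char (normalized_maj_law (lam N)) t) \<longlonglongrightarrow> char std_normal_distribution t" for t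
    using char_maj_law_normal_limit[OF assms, of t] by (simp add: char_std_normal_distribution)
qed (intro real_distribution_maj_law is_partition_sorted assms)

lemma irwin_hall_limit:
  assumes "\<And>N. is_partition (lam N)" "filterlim (\<lambda>N. sum_list (lam N)) at_top sequentially"
    "(\<lambda>N. aft (lam N)) \<longlonglongrightarrow> M"
  shows "weak_conv_m (\<lambda>N. normalized_maj_law (lam N)) (normalized_irwin_hall M)"
proof (rule levy_continuity)
  show "(\<lambda>N. char (normalized_maj_law (lam N)) t) \<longlonglongrightarrow> char (normalized_irwin_hall M) t" for t
    using char_maj_law_irwin_hall_limit[OF assms, of t] by (simp add: char_normalized_irwin_hall)
qed (intro real_distribution_maj_law is_partition_sorted assms real_distribution_normalized_irwin_hall)+

section \<open>Telling the possible limits apart\<close>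

lemma sinc_half_nonzero: "0 < x \<Longrightarrow> x < 2 * pi \<Longrightarrow> sinc_half x \<noteq> 0"
  using sin_gt_zero[of "x / 2"] by (simp add: sinc_half_def)

text \<open>Strictness comes from the double angle: |sin y| = 2 |sin (y/2)| |cos (y/2)|, and the
  cosine has modulus below 1 unless sin (y/2), and with it sin y, is 0.\<close>

lemma abs_sin_less_abs:
  fixes y :: real
  assumes "y \<noteq> 0"
  shows "\<bar>sin y\<bar> < \<bar>y\<bar>"
proof -
  have double: "\<bar>sin y\<bar> = 2 * \<bar>sin (y / 2)\<bar> * \<bar>cos (y / 2)\<bar>"
    using sin_double[of "y / 2"] by (simp add: abs_mult)
  show ?thesis
  proof (cases "sin (y / 2) = 0")
    case True
    thus ?thesis using double assms by simp
  next
    case False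
    hence "(cos (y / 2))\<^sup>2 < 1" using sin_cos_squared_add[of "y / 2"] by (smt (verit) zero_less_power2)
    hence "\<bar>cos (y / 2)\<bar> < 1" by (simp add: abs_square_less_1)
    hence "\<bar>sin y\<bar> < 2 * \<bar>sin (y / 2)\<bar> * 1"
      unfolding double using False by (intro mult_strict_left_mono) auto
    also have "\<dots> \<le> \<bar>y\<bar>" using abs_sin_x_le_abs_x[of "y / 2"] by simp
    finally show ?thesis .
  qed
qed

lemma abs_sinc_half_less_1:
  assumes "x \<noteq> 0"
  shows "\<bar>sinc_half x\<bar> < 1"
proof -
  have "\<bar>sin (x / 2)\<bar> < \<bar>x / 2\<bar>"
    using assms by (intro abs_sin_less_abs) simp
  thus ?thesis using assms by (simp add: sinc_half_def abs_divide)
qed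

lemma ih_char_0 [simp]: "ih_char 0 t = 1"
  by (simp add: ih_char_def)

lemma abs_ih_char_less_1: "0 < M \<Longrightarrow> t \<noteq> 0 \<Longrightarrow> \<bar>ih_char M t\<bar> < 1"
  using abs_sinc_half_less_1[of "t / sqrt (real M / 12)"]
  by (simp add: ih_char_def power_abs power_less_one_iff)

lemma ih_char_zero:
  assumes "0 < M"
  shows "ih_char M (2 * pi * sqrt (real M / 12)) = 0"
  using assms by (simp add: ih_char_def sinc_half_def)

text \<open>At the first positive zero of the function for M, the argument of
  \<open>sinc_half\<close> for the larger M' is still below 2 pi. The function for M = 0 has no
  zero, so there a zero of the other one is used.\<close>

lemma ih_char_neq:
  assumes "M < M'"
  shows "\<exists>t. ih_char M t \<noteq> ih_char M' t"
proof (cases "M = 0")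
  case True
  thus ?thesis using ih_char_zero[of M'] assms by (intro exI[of _ "2 * pi * sqrt (real M' / 12)"]) simp
next
  case False
  let ?t = "2 * pi * sqrt (real M / 12)"
  have "sqrt (real M / 12) < sqrt (real M' / 12)" "0 < sqrt (real M / 12)" using assms False by auto
  hence "0 < ?t / sqrt (real M' / 12)" "?t / sqrt (real M' / 12) < 2 * pi"
    by (auto simp: divide_less_eq)
  hence "ih_char M' ?t \<noteq> 0" unfolding ih_char_def using sinc_half_nonzero by simp
  thus ?thesis using ih_char_zero[of M] False by (intro exI[of _ ?t]) simp
qed

lemma ih_char_inj:
  assumes "\<And>t. ih_char M t = ih_char M' t"
  shows "M = M'"
proof (cases rule: linorder_cases[of M M'])
  case less
  then obtain t where "ih_char M t \<noteq> ih_char M' t" using ih_char_neq by blast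
  thus ?thesis using assms[of t] by contradiction
next
  case greater
  then obtain t where "ih_char M' t \<noteq> ih_char M t" using ih_char_neq by blast
  thus ?thesis using assms[of t, symmetric] by contradiction
qed

lemma ih_char_neq_normal: "\<exists>t. ih_char M t \<noteq> exp (- (t\<^sup>2 / 2))"
proof (cases "M = 0")
  case True
  thus ?thesis by (intro exI[of _ 1]) simp
next
  case False
  thus ?thesis using ih_char_zero[of M] by (intro exI[of _ "2 * pi * sqrt (real M / 12)"]) simp
qed

lemma char_maj_law_norm_1:
  assumes "sorted_wrt (\<ge>) l"
  shows "\<exists>t. t \<noteq> 0 \<and> norm (char (normalized_maj_law l) t) = 1"
proof (cases "maj_sd l = 0")
  case True
  thus ?thesis using char_maj_law_degenerate[OF assms] by (intro exI[of _ 1]) simp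
next
  case False
  thus ?thesis using norm_char_maj_law_period[OF assms] by (intro exI[of _ "2 * pi * maj_sd l"]) simp
qed

text \<open>By the pigeonhole principle, a size occurring infinitely often forces some shape to do
  so.\<close>

lemma finite_partitions: "finite {l. is_partition l \<and> sum_list l = n}"
proof (rule finite_subset)
  have len: "length l \<le> sum_list l" if "\<forall>p \<in> set l. 0 < p" for l :: "nat list"
    using that by (induction l) auto
  show "{l. is_partition l \<and> sum_list l = n} \<subseteq> {l. set l \<subseteq> {..n} \<and> length l \<le> n}"
  proof
    fix l assume "l \<in> {l. is_partition l \<and> sum_list l = n}"
    hence l: "is_partition l" "sum_list l = n" by simp_all
    have "length l \<le> n" using len[of l] l unfolding is_partition_def by blast
    moreover have "set l \<subseteq> {..n}" using member_le_sum_list[of _ l] l(2) by blast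
    ultimately show "l \<in> {l. set l \<subseteq> {..n} \<and> length l \<le> n}" by simp
  qed
  show "finite {l. set l \<subseteq> {..n} \<and> length l \<le> n}" by (rule finite_lists_length_le) simp
qed

section \<open>Subsequence arguments\<close>

lemma infinite_level:
  fixes f :: "nat \<Rightarrow> nat"
  assumes "infinite {N \<in> S. f N < K}"
  shows "\<exists>m. infinite {N \<in> S. f N = m}"
proof (rule ccontr)
  assume "\<not> ?thesis"
  hence "finite (\<Union>m<K. {N \<in> S. f N = m})" by simp
  moreover have "{N \<in> S. f N < K} = (\<Union>m<K. {N \<in> S. f N = m})" by auto
  ultimately show False using assms by simp
qed

lemma filterlim_subseq_at_top:
  fixes f :: "nat \<Rightarrow> nat"
  assumes "strict_mono r" "range r \<subseteq> S" "\<And>K. finite {N \<in> S. f N < K}"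
  shows "filterlim (\<lambda>n. f (r n)) at_top sequentially"
  unfolding filterlim_at_top
proof
  fix K
  have "finite (r -` {N \<in> S. f N < K})"
    using assms(1,3) by (intro finite_vimageI strict_mono_imp_inj_on)
  moreover have "r -` {N \<in> S. f N < K} = {n. \<not> K \<le> f (r n)}" using assms(2) by auto
  ultimately show "\<forall>\<^sub>F n in sequentially. K \<le> f (r n)"
    by (simp add: cofinite_eq_sequentially[symmetric] eventually_cofinite)
qed

lemma eventually_sequentially_iff_finite: "eventually P sequentially \<longleftrightarrow> finite {N. \<not> P N}"
  by (simp add: cofinite_eq_sequentially[symmetric] eventually_cofinite)

lemma infinite_Collect_obtain:
  assumes "infinite {N \<in> S. P N}"
  obtains N where "N \<in> S" "P N"
  using infinite_imp_nonempty[OF assms] by blast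

context
  fixes lam :: "nat \<Rightarrow> nat list" and L :: "real measure"
  assumes part: "\<And>N. is_partition (lam N)" and L: "real_distribution L"
    and conv: "weak_conv_m (\<lambda>N. normalized_maj_law (lam N)) L"
begin

lemma real_distribution_terms: "real_distribution (normalized_maj_law (lam N))"
  by (intro real_distribution_maj_law is_partition_sorted part)

lemma char_subseq: "strict_mono r \<Longrightarrow> (\<lambda>n. char (normalized_maj_law (lam (r n))) t) \<longlonglongrightarrow> char L t"
  using LIMSEQ_subseq_LIMSEQ[OF levy_continuity1[OF real_distribution_terms L conv, of t]] by (simp add: o_def)

lemma limit_of_repeated_shape:
  assumes "infinite {N \<in> S. lam N = l}"
  shows "L = normalized_maj_law l"
proof (rule Levy_uniqueness[OF L])
  obtain r :: "nat \<Rightarrow> nat" where r: "strict_mono r" "\<And>n. r n \<in> {N \<in> S. lam N = l}"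
    using infinite_enumerate[OF assms] by blast
  have "lam (r n) = l" for n using r(2) by auto
  hence "(\<lambda>n. char (normalized_maj_law l) t) \<longlonglongrightarrow> char L t" for t using char_subseq[OF r(1), of t] by simp
  thus "char L = char (normalized_maj_law l)" using LIMSEQ_unique[OF _ tendsto_const] by blast
  show "real_distribution (normalized_maj_law l)" using real_distribution_terms[of "r 0"] \<open>\<And>n. lam (r n) = l\<close> by simp
qed

text \<open>Along an infinite index set either some size recurs, and with it a shape, or the sizes
  tend to infinity; then either some aft recurs or the afts tend to infinity. In the last two cases
  a subsequence determines the characteristic function of \<open>L\<close>. The set \<open>S\<close>
  is arbitrary so that it can be the set of indices violating a desired conclusion.\<close>

lemma limit_cases:
  assumes S: "infinite S"
  obtains (shape) l where "infinite {N \<in> S. lam N = l}"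
  | (irwin_hall) M where "infinite {N \<in> S. aft (lam N) = M}" "\<And>t. char L t = of_real (ih_char M t)"
  | (normal) "\<And>K. finite {N \<in> S. aft (lam N) < K}" "\<And>t. char L t = of_real (exp (- (t\<^sup>2 / 2)))"
proof (cases "\<exists>n. infinite {N \<in> S. sum_list (lam N) = n}")
  case True
  then obtain n where n: "infinite {N \<in> S. sum_list (lam N) = n}" by blast
  have "finite (lam ` {N \<in> S. sum_list (lam N) = n})"
    by (rule finite_subset[OF _ finite_partitions[of n]]) (use part in auto)
  from pigeonhole_infinite[OF n this] obtain N0 where
    "infinite {N \<in> {N \<in> S. sum_list (lam N) = n}. lam N = lam N0}" by blast
  moreover have "{N \<in> {N \<in> S. sum_list (lam N) = n}. lam N = lam N0} \<subseteq> {N \<in> S. lam N = lam N0}" by blast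
  ultimately have "infinite {N \<in> S. lam N = lam N0}" using infinite_super by blast
  thus ?thesis by (rule shape)
next
  case False
  hence size: "finite {N \<in> S. sum_list (lam N) < K}" for K
    using infinite_level[of S "\<lambda>N. sum_list (lam N)" K] by blast
  show ?thesis
  proof (cases "\<exists>M. infinite {N \<in> S. aft (lam N) = M}")
    case True
    then obtain M where M: "infinite {N \<in> S. aft (lam N) = M}" by blast
    obtain r :: "nat \<Rightarrow> nat" where r: "strict_mono r" "\<And>n. r n \<in> {N \<in> S. aft (lam N) = M}"
      using infinite_enumerate[OF M] by blast
    have "filterlim (\<lambda>n. sum_list (lam (r n))) at_top sequentially"
      by (rule filterlim_subseq_at_top[OF r(1) _ size]) (use r(2) in auto)
    moreover have "(\<lambda>n. aft (lam (r n))) \<longlonglongrightarrow> M" using r(2) by simp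
    ultimately have "(\<lambda>n. char (normalized_maj_law (lam (r n))) t) \<longlonglongrightarrow> of_real (ih_char M t)" for t
      by (intro char_maj_law_irwin_hall_limit part)
    hence "char L t = of_real (ih_char M t)" for t
      using LIMSEQ_unique[OF char_subseq[OF r(1)]] by blast
    thus ?thesis using M by (intro irwin_hall)
  next
    case False
    hence aft: "finite {N \<in> S. aft (lam N) < K}" for K
      using infinite_level[of S "\<lambda>N. aft (lam N)" K] by blast
    obtain r :: "nat \<Rightarrow> nat" where r: "strict_mono r" "\<And>n. r n \<in> S"
      using infinite_enumerate[OF S] by blast
    have "filterlim (\<lambda>n. aft (lam (r n))) at_top sequentially"
      by (rule filterlim_subseq_at_top[OF r(1) _ aft]) (use r(2) in auto)
    hence "(\<lambda>n. char (normalized_maj_law (lam (r n))) t) \<longlonglongrightarrow> of_real (exp (- (t\<^sup>2 / 2)))" for t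
      by (intro char_maj_law_normal_limit part)
    hence "char L t = of_real (exp (- (t\<^sup>2 / 2)))" for t
      using LIMSEQ_unique[OF char_subseq[OF r(1)]] by blast
    thus ?thesis using aft by (intro normal)
  qed
qed

text \<open>If the laws differed from \<open>L\<close> infinitely often, those indices would fall
  under \<open>limit_cases\<close>. A second repeated shape, or aft 0, again gives the law
  \<open>L\<close>. In the other cases the characteristic function of \<open>L\<close> has modulus
  below 1 off 0, impossible since \<open>L\<close> is the law of the shape \<open>l\<close>.\<close>

lemma eventually_constant_of_repeated_shape:
  assumes l: "infinite {N \<in> S. lam N = l}"
  shows "eventually_constant (\<lambda>N. normalized_maj_law (lam N))"
proof (rule ccontr)
  assume "\<not> ?thesis"
  hence inf: "infinite {N. normalized_maj_law (lam N) \<noteq> L}" (is "infinite ?S")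
    by (auto simp: eventually_constant_def eventually_sequentially_iff_finite)
  have "sorted_wrt (\<ge>) l"
  proof -
    obtain N where "lam N = l" using infinite_Collect_obtain[OF l] .
    thus ?thesis using is_partition_sorted[OF part, of N] by simp
  qed
  then obtain t where t: "t \<noteq> 0" "norm (char L t) = 1"
    using char_maj_law_norm_1[of l] limit_of_repeated_shape[OF l] by blast
  from inf show False
  proof (cases rule: limit_cases)
    case (shape l')
    then obtain N where "N \<in> ?S" "lam N = l'"
      using infinite_Collect_obtain[OF shape] by blast
    thus False using limit_of_repeated_shape[OF shape] by simp
  next
    case (irwin_hall M)
    show False
    proof (cases "M = 0")
      case True
      obtain N where N: "N \<in> ?S" "aft (lam N) = M"
        using infinite_Collect_obtain[OF irwin_hall(1)] .
      hence "char (normalized_maj_law (lam N)) t = char L t" for t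
        using char_maj_law_aft_0[OF part, of N t] True irwin_hall(2)[of t] by simp
      hence "char (normalized_maj_law (lam N)) = char L" by blast
      hence "normalized_maj_law (lam N) = L" by (rule Levy_uniqueness[OF real_distribution_terms L])
      thus False using N by simp
    next
      case False
      thus False using irwin_hall(2)[of t] t abs_ih_char_less_1[of M t] by simp
    qed
  next
    case normal
    have "exp (- (t\<^sup>2 / 2)) < 1" using t(1) by simp
    thus False using normal(2)[of t] t(2) by simp
  qed
qed

text \<open>If no shape recurs infinitely often, the sizes tend to infinity. If the afts do not,
  some value M recurs and determines the characteristic function of \<open>L\<close>; infinitely
  many indices with another aft would give it the form for some M' different from M or the normal
  form, and both are excluded.\<close>

lemma convergence_cases:
  "filterlim (\<lambda>N. aft (lam N)) at_top sequentially \<or>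
   (\<exists>M. filterlim (\<lambda>N. sum_list (lam N)) at_top sequentially \<and> (\<lambda>N. aft (lam N)) \<longlonglongrightarrow> M) \<or>
   eventually_constant (\<lambda>N. normalized_maj_law (lam N))"
proof (cases "\<exists>l. infinite {N \<in> UNIV. lam N = l}")
  case True
  thus ?thesis using eventually_constant_of_repeated_shape by blast
next
  case False
  hence no_shape: "finite {N \<in> S. lam N = l}" for S l
  proof -
    have "{N \<in> S. lam N = l} \<subseteq> {N \<in> UNIV. lam N = l}" by blast
    thus ?thesis using False finite_subset by blast
  qed
  have to_top: "filterlim f at_top sequentially" if "\<And>K. finite {N \<in> UNIV. f N < K}" for f :: "nat \<Rightarrow> nat"
    using filterlim_subseq_at_top[of "\<lambda>n. n" UNIV f] that by (simp add: strict_mono_def)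
  show ?thesis
  proof (cases "\<exists>K. infinite {N \<in> UNIV. aft (lam N) < K}")
    case False
    thus ?thesis using to_top[of "\<lambda>N. aft (lam N)"] by blast
  next
    case True
    then obtain M where M: "infinite {N \<in> UNIV. aft (lam N) = M}"
      using infinite_level[of UNIV "\<lambda>N. aft (lam N)"] by blast
    have ih: "char L t = of_real (ih_char M t)" for t
      using M
    proof (cases rule: limit_cases)
      case (irwin_hall M')
      obtain N where "N \<in> {N \<in> UNIV. aft (lam N) = M}" "aft (lam N) = M'"
        using infinite_Collect_obtain[OF irwin_hall(1)] .
      hence "M = M'" by simp
      thus ?thesis using irwin_hall(2) by simp
    next
      case normal
      have "{N \<in> {N \<in> UNIV. aft (lam N) = M}. aft (lam N) < Suc M} = {N \<in> UNIV. aft (lam N) = M}" by auto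
      thus ?thesis using normal(1)[of "Suc M"] M by simp
    qed (use no_shape in blast)
    have "\<forall>\<^sub>F N in sequentially. aft (lam N) = M"
    proof (rule ccontr)
      assume "\<not> ?thesis"
      hence "infinite {N. aft (lam N) \<noteq> M}" by (simp add: eventually_sequentially_iff_finite)
      thus False
      proof (cases rule: limit_cases)
        case (irwin_hall M')
        have "complex_of_real (ih_char M t) = of_real (ih_char M' t)" for t
          unfolding ih[symmetric] irwin_hall(2)[symmetric] ..
        hence "M = M'" by (intro ih_char_inj) (simp only: of_real_eq_iff)
        moreover obtain N where "N \<in> {N. aft (lam N) \<noteq> M}" "aft (lam N) = M'"
          using infinite_Collect_obtain[OF irwin_hall(1)] .
        ultimately show False by simp
      next
        case normal
        have "complex_of_real (ih_char M t) = of_real (exp (- (t\<^sup>2 / 2)))" for t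
          unfolding ih[symmetric] normal(2)[symmetric] ..
        hence "ih_char M t = exp (- (t\<^sup>2 / 2))" for t by (simp only: of_real_eq_iff)
        thus False using ih_char_neq_normal[of M] by blast
      qed (use no_shape in blast)
    qed
    hence "(\<lambda>N. aft (lam N)) \<longlonglongrightarrow> M" by (rule tendsto_eventually)
    moreover have "filterlim (\<lambda>N. sum_list (lam N)) at_top sequentially"
    proof (rule to_top, rule ccontr)
      fix K assume "infinite {N \<in> UNIV. sum_list (lam N) < K}"
      then obtain n where n: "infinite {N \<in> UNIV. sum_list (lam N) = n}"
        using infinite_level[of UNIV "\<lambda>N. sum_list (lam N)" K] by blast
      have "finite (lam ` {N \<in> UNIV. sum_list (lam N) = n})"
        by (rule finite_subset[OF _ finite_partitions[of n]]) (use part in auto)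
      from pigeonhole_infinite[OF n this] show False using no_shape by blast
    qed
    ultimately show ?thesis by blast
  qed
qed

end

text \<open>Representing the constant by the law of a member \<open>lam N0\<close> shows that it is
  a probability law on the reals.\<close>

lemma eventually_constant_limit:
  assumes part: "\<And>N. is_partition (lam N)"
    and const: "eventually_constant (\<lambda>N. normalized_maj_law (lam N))"
  obtains N0 where "weak_conv_m (\<lambda>N. normalized_maj_law (lam N)) (normalized_maj_law (lam N0))"
    "\<forall>\<^sub>F N in sequentially. normalized_maj_law (lam N) = normalized_maj_law (lam N0)"
proof -
  obtain c where c: "\<forall>\<^sub>F N in sequentially. normalized_maj_law (lam N) = c"
    using const by (auto simp: eventually_constant_def)
  then obtain N0 where N0: "normalized_maj_law (lam N0) = c"
    by (auto simp: eventually_sequentially)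
  have rd: "real_distribution (normalized_maj_law (lam N))" for N
    by (intro real_distribution_maj_law is_partition_sorted part)
  have "weak_conv_m (\<lambda>N. normalized_maj_law (lam N)) (normalized_maj_law (lam N0))"
  proof (rule levy_continuity[OF rd rd])
    show "(\<lambda>N. char (normalized_maj_law (lam N)) t) \<longlonglongrightarrow> char (normalized_maj_law (lam N0)) t" for t
      by (rule tendsto_eventually) (use c N0 in \<open>auto elim: eventually_mono\<close>)
  qed
  thus ?thesis by (rule that[of N0]) (use c in \<open>simp add: N0\<close>)
qed

theorem theorem3p8:
  fixes lam :: "nat \<Rightarrow> nat list"
  assumes "\<And>N. is_partition (lam N)"
  shows
    "(converges_in_distribution (\<lambda>N. normalized_maj_law (lam N)) \<longleftrightarrow>
        filterlim (\<lambda>N. aft (lam N)) at_top sequentially \<or>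
        (\<exists>M::nat. filterlim (\<lambda>N. sum_list (lam N)) at_top sequentially \<and>
             (\<lambda>N. aft (lam N)) \<longlonglongrightarrow> M) \<or>
        eventually_constant (\<lambda>N. normalized_maj_law (lam N))) \<and>
     (filterlim (\<lambda>N. aft (lam N)) at_top sequentially \<longrightarrow>
        weak_conv_m (\<lambda>N. normalized_maj_law (lam N)) std_normal_distribution) \<and>
     (\<forall>M::nat. filterlim (\<lambda>N. sum_list (lam N)) at_top sequentially \<and>
          (\<lambda>N. aft (lam N)) \<longlonglongrightarrow> M \<longrightarrow>
        weak_conv_m (\<lambda>N. normalized_maj_law (lam N)) (normalized_irwin_hall M)) \<and>
     (eventually_constant (\<lambda>N. normalized_maj_law (lam N)) \<longrightarrow>
        (\<forall>L. real_distribution L \<and> weak_conv_m (\<lambda>N. normalized_maj_law (lam N)) L \<longrightarrow>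
           discrete_law L))"
proof (intro conjI impI allI)
  have rd: "real_distribution (normalized_maj_law (lam N))" for N
    by (intro real_distribution_maj_law is_partition_sorted assms)
  show "converges_in_distribution (\<lambda>N. normalized_maj_law (lam N)) \<longleftrightarrow>
        filterlim (\<lambda>N. aft (lam N)) at_top sequentially \<or>
        (\<exists>M::nat. filterlim (\<lambda>N. sum_list (lam N)) at_top sequentially \<and>
             (\<lambda>N. aft (lam N)) \<longlonglongrightarrow> M) \<or>
        eventually_constant (\<lambda>N. normalized_maj_law (lam N))" (is "_ \<longleftrightarrow> ?i \<or> ?ii \<or> ?iii")
  proof
    assume "converges_in_distribution (\<lambda>N. normalized_maj_law (lam N))"
    thus "?i \<or> ?ii \<or> ?iii"
      unfolding converges_in_distribution_def using convergence_cases[of lam, OF assms] by blast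
  next
    assume "?i \<or> ?ii \<or> ?iii"
    then consider ?i | ?ii | ?iii by blast
    thus "converges_in_distribution (\<lambda>N. normalized_maj_law (lam N))"
    proof cases
      case 1
      thus ?thesis unfolding converges_in_distribution_def
        using normal_limit[of lam, OF assms] real_dist_normal_dist by blast
    next
      case 2
      thus ?thesis unfolding converges_in_distribution_def
        using irwin_hall_limit[of lam, OF assms] real_distribution_normalized_irwin_hall by blast
    next
      case 3
      thus ?thesis unfolding converges_in_distribution_def
        using eventually_constant_limit[of lam, OF assms] rd by blast
    qed
  qed
  show "weak_conv_m (\<lambda>N. normalized_maj_law (lam N)) std_normal_distribution"
    if "filterlim (\<lambda>N. aft (lam N)) at_top sequentially"
    using normal_limit[of lam, OF assms that] .
  show "weak_conv_m (\<lambda>N. normalized_maj_law (lam N)) (normalized_irwin_hall M)"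
    if "filterlim (\<lambda>N. sum_list (lam N)) at_top sequentially \<and> (\<lambda>N. aft (lam N)) \<longlonglongrightarrow> M" for M
    using irwin_hall_limit[of lam, OF assms] that by blast
  show "discrete_law L"
    if const: "eventually_constant (\<lambda>N. normalized_maj_law (lam N))"
      and L: "real_distribution L \<and> weak_conv_m (\<lambda>N. normalized_maj_law (lam N)) L" for L
  proof -
    obtain N0 where N0: "weak_conv_m (\<lambda>N. normalized_maj_law (lam N)) (normalized_maj_law (lam N0))"
      using eventually_constant_limit[of lam, OF assms const] by blast
    \<comment> \<open>Weak limits are unique, so every limit is the law of \<open>lam N0\<close>,
      which has finite support.\<close>
    have "char L t = char (normalized_maj_law (lam N0)) t" for t
      using LIMSEQ_unique[OF levy_continuity1[OF rd conjunct1[OF L] conjunct2[OF L], of t] levy_continuity1[OF rd rd N0, of t]] .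
    hence "L = normalized_maj_law (lam N0)" using L rd by (intro Levy_uniqueness) auto
    thus ?thesis using discrete_maj_law[OF is_partition_sorted[OF assms]] by simp
  qed
qed

end
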